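(* (i) For every $n\in\mathbb N$, the set of all $\bar\gamma\in{\rm Aut}(\mathbb P)^n$ such that the orbit of $\bar\gamma$ under the diagonal conjugacy action of ${\rm Aut}(\mathbb P)$ is dense in ${\rm Homeo}(P)^n$ is comeager in ${\rm Aut}(\mathbb P)^n$. (ii) The set of all $\bar\gamma\in{\rm Aut}(\mathbb P)^{\mathbb N}$ such that the orbit of $\bar\gamma$ under the diagonal conjugacy action of ${\rm Aut}(\mathbb P)$ is dense in ${\rm Homeo}(P)^{\mathbb N}$ is comeager in ${\rm Aut}(\mathbb P)^{\mathbb N}$.
   Context: $\mathcal P$ is the category whose objects are the finite reflexive linear graphs (structures isomorphic to $L=\{0,\dots,n\}$ with $xRy\iff|x-y|\le1$) and whose morphisms ${\rm Epi}(A,B)$ are all epimorphisms, i.e. maps $f:A\to B$ with $aRb\Rightarrow f(a)Rf(b)$ such that every $R$-related pair in $B$ is the image of an $R$-related pair in $A$. $\mathcal P$ is a projective Fraïssé class; its projective Fraïssé limit is $\mathbb P=\varprojlim(A_n,\pi_n)$ for a generic sequence ($A_n\in\mathcal P$, $\pi_n\in{\rm Epi}(A_{n+1},A_n)$, every $A\in\mathcal P$ receives an epimorphism from some $A_m$, and every $f\in{\rm Epi}(A,A_m)$ satisfies $f\circ g=\pi_m\circ\cdots\circ\pi_{n-1}$ for some $n>m$, $g\in{\rm Epi}(A_n,A)$), with ${\rm Epi}(\mathbb P,A)=\{f\circ\pi^\infty_n:f\in{\rm Epi}(A_n,A)\}$. The relation $xR^{\mathbb P}y$ iff $\varphi(x)R\varphi(y)$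 for all such $\varphi$ is an equivalence relation and $P=\mathbb P/R^{\mathbb P}$ is homeomorphic to the pseudoarc; ${\rm pr}:\mathbb P\to P$ is the quotient map. ${\rm Aut}(\mathbb P)$: homeomorphisms $\sigma$ of $\mathbb P$ with $\varphi\circ\sigma,\varphi\circ\sigma^{-1}\in{\rm Epi}(\mathbb P,A)$ whenever $\varphi\in{\rm Epi}(\mathbb P,A)$, with the topology of uniform convergence on $\mathbb P$ (Polish). The induced homomorphism ${\rm Aut}(\mathbb P)\to{\rm Homeo}(P)$, $\sigma\mapsto(\,{\rm pr}(x)\mapsto{\rm pr}(\sigma(x))\,)$, is continuous and injective, and ${\rm Aut}(\mathbb P)$ is identified with its image in ${\rm Homeo}(P)$ (uniform convergence topology). Diagonal conjugacy action: $g\cdot(\gamma_i)_i=(g\gamma_ig^{-1})_i$; powers carry product topologies. *)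

theory Defs
  imports "HOL-Analysis.Analysis"
begin

section \<open>Finite reflexive linear graphs and epimorphisms\<close>

record 'a rgraph =
  verts :: "'a set"
  adj :: "('a \<times> 'a) set"

definition std_linear_graph :: "nat \<Rightarrow> nat rgraph" where
  "std_linear_graph n =
     \<lparr>verts = {0..n}, adj = {(x, y) \<in> {0..n} \<times> {0..n}. \<bar>int x - int y\<bar> \<le> 1}\<rparr>"

definition graph_iso :: "'a rgraph \<Rightarrow> 'b rgraph \<Rightarrow> ('a \<Rightarrow> 'b) \<Rightarrow> bool" where
  "graph_iso A B h \<longleftrightarrow> bij_betw h (verts A) (verts B) \<and>
     (\<forall>x\<in>verts A. \<forall>y\<in>verts A. (x, y) \<in> adj A \<longleftrightarrow> (h x, h y) \<in> adj B)"

definition linear_graph :: "'a rgraph \<Rightarrow> bool" where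
  "linear_graph A \<longleftrightarrow>
     adj A \<subseteq> verts A \<times> verts A \<and> (\<exists>n h. graph_iso (std_linear_graph n) A h)"

text \<open>Maps between sets are represented by extensional functions, so that equality of maps
  is equality in HOL and composition is \<^const>\<open>compose\<close>.\<close>

definition Epi :: "'a rgraph \<Rightarrow> 'b rgraph \<Rightarrow> ('a \<Rightarrow> 'b) set" where
  "Epi A B = {f \<in> verts A \<rightarrow>\<^sub>E verts B.
     (\<forall>(a, b)\<in>adj A. (f a, f b) \<in> adj B) \<and>
     (\<forall>(c, d)\<in>adj B. \<exists>(a, b)\<in>adj A. f a = c \<and> f b = d)}"


section \<open>Generic sequences and the projective limit\<close>

text \<open>\<open>bond A p m k\<close> is the composite of \<open>p m, \<dots>, p (m + k - 1)\<close>, a map from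
  \<open>A (m + k)\<close> to \<open>A m\<close>.\<close>

primrec bond :: "(nat \<Rightarrow> 'a rgraph) \<Rightarrow> (nat \<Rightarrow> 'a \<Rightarrow> 'a) \<Rightarrow> nat \<Rightarrow> nat \<Rightarrow> 'a \<Rightarrow> 'a" where
  "bond A p m 0 = (\<lambda>x\<in>verts (A m). x)"
| "bond A p m (Suc k) = compose (verts (A (m + Suc k))) (bond A p m k) (p (m + k))"

text \<open>Every finite structure is isomorphic to one with vertices in \<^typ>\<open>nat\<close>, so
  quantifying over all objects of the category is rendered by quantifying over linear graphs
  of type \<^typ>\<open>nat rgraph\<close>.\<close>

definition generic_sequence :: "(nat \<Rightarrow> nat rgraph) \<Rightarrow> (nat \<Rightarrow> nat \<Rightarrow> nat) \<Rightarrow> bool" where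
  "generic_sequence A p \<longleftrightarrow>
     (\<forall>n. linear_graph (A n)) \<and>
     (\<forall>n. p n \<in> Epi (A (Suc n)) (A n)) \<and>
     (\<forall>B :: nat rgraph. linear_graph B \<longrightarrow> (\<exists>m. Epi (A m) B \<noteq> {})) \<and>
     (\<forall>(B :: nat rgraph) m f. linear_graph B \<longrightarrow> f \<in> Epi B (A m) \<longrightarrow>
        (\<exists>n>m. \<exists>g\<in>Epi (A n) B. compose (verts (A n)) f g = bond A p m (n - m)))"

definition proj_lim :: "(nat \<Rightarrow> nat rgraph) \<Rightarrow> (nat \<Rightarrow> nat \<Rightarrow> nat) \<Rightarrow> (nat \<Rightarrow> nat) set" where
  "proj_lim A p = {x. (\<forall>n. x n \<in> verts (A n)) \<and> (\<forall>n. p n (x (Suc n)) = x n)}"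

definition lim_topology ::
    "(nat \<Rightarrow> nat rgraph) \<Rightarrow> (nat \<Rightarrow> nat \<Rightarrow> nat) \<Rightarrow> (nat \<Rightarrow> nat) topology" where
  "lim_topology A p =
     subtopology (product_topology (\<lambda>n. discrete_topology (verts (A n))) UNIV) (proj_lim A p)"

definition lim_Epi ::
    "(nat \<Rightarrow> nat rgraph) \<Rightarrow> (nat \<Rightarrow> nat \<Rightarrow> nat) \<Rightarrow> nat rgraph \<Rightarrow> ((nat \<Rightarrow> nat) \<Rightarrow> nat) set" where
  "lim_Epi A p B = {(\<lambda>x\<in>proj_lim A p. f (x n)) | n f. f \<in> Epi (A n) B}"

definition lim_rel ::
    "(nat \<Rightarrow> nat rgraph) \<Rightarrow> (nat \<Rightarrow> nat \<Rightarrow> nat) \<Rightarrow> ((nat \<Rightarrow> nat) \<times> (nat \<Rightarrow> nat)) set" where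
  "lim_rel A p = {(x, y) \<in> proj_lim A p \<times> proj_lim A p.
     \<forall>B. linear_graph B \<longrightarrow> (\<forall>\<phi>\<in>lim_Epi A p B. (\<phi> x, \<phi> y) \<in> adj B)}"


section \<open>The quotient space\<close>

definition quotient_topology :: "'a topology \<Rightarrow> ('a \<Rightarrow> 'b) \<Rightarrow> 'b topology" where
  "quotient_topology X q =
     topology (\<lambda>U. U \<subseteq> q ` topspace X \<and> openin X {x \<in> topspace X. q x \<in> U})"

lemma openin_quotient_topology:
  "openin (quotient_topology X q) U \<longleftrightarrow>
     U \<subseteq> q ` topspace X \<and> openin X {x \<in> topspace X. q x \<in> U}"
proof -
  have "istopology (\<lambda>U. U \<subseteq> q ` topspace X \<and> openin X {x \<in> topspace X. q x \<in> U})"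
    unfolding istopology_def
  proof (intro conjI allI impI)
    fix S T
    assume "S \<subseteq> q ` topspace X \<and> openin X {x \<in> topspace X. q x \<in> S}"
      and "T \<subseteq> q ` topspace X \<and> openin X {x \<in> topspace X. q x \<in> T}"
    moreover have "{x \<in> topspace X. q x \<in> S \<inter> T} =
        {x \<in> topspace X. q x \<in> S} \<inter> {x \<in> topspace X. q x \<in> T}" by blast
    ultimately show "S \<inter> T \<subseteq> q ` topspace X" "openin X {x \<in> topspace X. q x \<in> S \<inter> T}"
      by auto
  next
    fix \<K>
    assume K: "\<forall>K\<in>\<K>. K \<subseteq> q ` topspace X \<and> openin X {x \<in> topspace X. q x \<in> K}"
    then show "\<Union>\<K> \<subseteq> q ` topspace X" by blast
    have "{x \<in> topspace X. q x \<in> \<Union>\<K>} = (\<Union>K\<in>\<K>. {x \<in> topspace X. q x \<in> K})" by blast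
    then show "openin X {x \<in> topspace X. q x \<in> \<Union>\<K>}" using K by auto
  qed
  then show ?thesis
    by (simp add: quotient_topology_def topology_inverse')
qed

lemma topspace_quotient_topology: "topspace (quotient_topology X q) = q ` topspace X"
proof
  show "topspace (quotient_topology X q) \<subseteq> q ` topspace X"
    using openin_quotient_topology openin_topspace by metis
  have "{x \<in> topspace X. q x \<in> q ` topspace X} = topspace X" by blast
  then have "openin (quotient_topology X q) (q ` topspace X)"
    by (simp add: openin_quotient_topology)
  then show "q ` topspace X \<subseteq> topspace (quotient_topology X q)"
    by (rule openin_subset)
qed

lemma quotient_map_quotient_topology: "quotient_map X (quotient_topology X q) q"
  by (auto simp: quotient_map_def topspace_quotient_topology openin_quotient_topology)

definition pr ::
    "(nat \<Rightarrow> nat rgraph) \<Rightarrow> (nat \<Rightarrow> nat \<Rightarrow> nat) \<Rightarrow> (nat \<Rightarrow> nat) \<Rightarrow> (nat \<Rightarrow> nat) set" where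
  "pr A p x = lim_rel A p `` {x}"

definition pseudoarc ::
    "(nat \<Rightarrow> nat rgraph) \<Rightarrow> (nat \<Rightarrow> nat \<Rightarrow> nat) \<Rightarrow> (nat \<Rightarrow> nat) set topology" where
  "pseudoarc A p = quotient_topology (lim_topology A p) (pr A p)"


section \<open>Homeomorphism groups\<close>

definition Homeo :: "'a topology \<Rightarrow> ('a \<Rightarrow> 'a) set" where
  "Homeo X = {h \<in> extensional (topspace X). homeomorphic_map X X h}"

definition homeo_inv :: "'a topology \<Rightarrow> ('a \<Rightarrow> 'a) \<Rightarrow> 'a \<Rightarrow> 'a" where
  "homeo_inv X h = (\<lambda>x\<in>topspace X. inv_into (topspace X) h x)"

text \<open>The topology of uniform convergence with respect to a metric \<open>d\<close> on \<open>X\<close>. For compact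
  \<open>X\<close> it is the same for all \<open>d\<close> with \<open>mtopology_of d = X\<close>.\<close>

definition uniform_topology :: "'a topology \<Rightarrow> 'a metric \<Rightarrow> ('a \<Rightarrow> 'a) set \<Rightarrow> ('a \<Rightarrow> 'a) topology"
  where "uniform_topology X d G = subtopology (mtopology_of (cfunspace X d)) G"

lemma topspace_uniform_topology_Homeo:
  assumes "compact_space X" and d: "mtopology_of d = X" and "G \<subseteq> Homeo X"
  shows "topspace (uniform_topology X d G) = G"
proof -
  have X: "topspace X = mspace d" using d by auto
  have "h \<in> mspace (cfunspace X d)" if "h \<in> Homeo X" for h
  proof -
    have h: "continuous_map X X h" "h \<in> extensional (topspace X)"
      using that homeomorphic_imp_continuous_map by (auto simp: Homeo_def)
    then have "compactin X (h ` topspace X)"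
      using assms(1) compact_space_def image_compactin by blast
    then have "Metric_space.mbounded (mspace d) (mdist d) (h ` topspace X)"
      using Metric_space.compactin_imp_mbounded[OF Metric_space_mspace_mdist] d
      by (metis mtopology_of_def)
    with h show ?thesis
      using X d by (auto simp: continuous_map_def Pi_iff)
  qed
  then show ?thesis
    using assms(3) by (auto simp: uniform_topology_def)
qed

definition Aut :: "(nat \<Rightarrow> nat rgraph) \<Rightarrow> (nat \<Rightarrow> nat \<Rightarrow> nat) \<Rightarrow> ((nat \<Rightarrow> nat) \<Rightarrow> nat \<Rightarrow> nat) set" where
  "Aut A p = {\<sigma> \<in> Homeo (lim_topology A p). \<forall>B. linear_graph B \<longrightarrow> (\<forall>\<phi>\<in>lim_Epi A p B.
     compose (proj_lim A p) \<phi> \<sigma> \<in> lim_Epi A p B \<and>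
     compose (proj_lim A p) \<phi> (homeo_inv (lim_topology A p) \<sigma>) \<in> lim_Epi A p B)}"

text \<open>The induced map sends \<open>pr x\<close> to \<open>pr (\<sigma> x)\<close>; the union below is over sets that all
  coincide when \<open>\<sigma>\<close> respects \<open>lim_rel A p\<close> (see \<open>Aut_induced_pr\<close>).\<close>

definition induced :: "(nat \<Rightarrow> nat rgraph) \<Rightarrow> (nat \<Rightarrow> nat \<Rightarrow> nat) \<Rightarrow> ((nat \<Rightarrow> nat) \<Rightarrow> nat \<Rightarrow> nat) \<Rightarrow>
    (nat \<Rightarrow> nat) set \<Rightarrow> (nat \<Rightarrow> nat) set" where
  "induced A p \<sigma> = (\<lambda>c\<in>topspace (pseudoarc A p). \<Union>x\<in>c. pr A p (\<sigma> x))"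

lemma topspace_lim_topology: "topspace (lim_topology A p) = proj_lim A p"
  by (auto simp: lim_topology_def proj_lim_def)

lemma Aut_induced_pr:
  assumes equiv: "equiv (proj_lim A p) (lim_rel A p)"
    and \<sigma>: "\<sigma> \<in> Aut A p" and x: "x \<in> proj_lim A p"
  shows "induced A p \<sigma> (pr A p x) = pr A p (\<sigma> x)"
proof -
  have im: "\<sigma> ` proj_lim A p = proj_lim A p"
    using \<sigma> homeomorphic_imp_surjective_map[of "lim_topology A p" "lim_topology A p" \<sigma>]
    by (auto simp: Aut_def Homeo_def topspace_lim_topology)
  have "(\<sigma> y, \<sigma> z) \<in> lim_rel A p" if "(y, z) \<in> lim_rel A p" for y z
  proof -
    have yz: "y \<in> proj_lim A p" "z \<in> proj_lim A p" using that by (auto simp: lim_rel_def)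
    have "(\<phi> (\<sigma> y), \<phi> (\<sigma> z)) \<in> adj B" if "linear_graph B" "\<phi> \<in> lim_Epi A p B" for B \<phi>
    proof -
      have "compose (proj_lim A p) \<phi> \<sigma> \<in> lim_Epi A p B"
        using \<sigma> that by (simp add: Aut_def)
      then have "(compose (proj_lim A p) \<phi> \<sigma> y, compose (proj_lim A p) \<phi> \<sigma> z) \<in> adj B"
        using \<open>(y, z) \<in> lim_rel A p\<close> \<open>linear_graph B\<close> by (auto simp: lim_rel_def)
      then show ?thesis using yz by (simp add: compose_def)
    qed
    then show ?thesis using yz im by (auto simp: lim_rel_def)
  qed
  then have "pr A p (\<sigma> y) = pr A p (\<sigma> x)" if "y \<in> pr A p x" for y
    using that equiv_class_eq[OF equiv] by (metis Image_singleton_iff pr_def)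
  moreover have "x \<in> pr A p x"
    using equiv_class_self[OF equiv x] by (simp add: pr_def)
  ultimately have "(\<Union>y\<in>pr A p x. pr A p (\<sigma> y)) = pr A p (\<sigma> x)" by blast
  then show ?thesis
    using x by (simp add: induced_def pseudoarc_def topspace_quotient_topology topspace_lim_topology)
qed


section \<open>Diagonal conjugacy and Baire category\<close>

text \<open>A tuple indexed by \<open>I\<close> is an extensional function on \<open>I\<close>; the index set is \<open>{..<n}\<close> for
  \<open>n\<close>-tuples and \<open>UNIV\<close> for sequences.\<close>

definition diag_conj :: "'a topology \<Rightarrow> 'i set \<Rightarrow> ('a \<Rightarrow> 'a) \<Rightarrow> ('i \<Rightarrow> 'a \<Rightarrow> 'a) \<Rightarrow> 'i \<Rightarrow> 'a \<Rightarrow> 'a" where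
  "diag_conj X I g \<gamma> = (\<lambda>i\<in>I. compose (topspace X) g (compose (topspace X) (\<gamma> i) (homeo_inv X g)))"

definition nowhere_dense_in :: "'a topology \<Rightarrow> 'a set \<Rightarrow> bool" where
  "nowhere_dense_in X S \<longleftrightarrow> S \<subseteq> topspace X \<and> X interior_of (X closure_of S) = {}"

definition meagre_in :: "'a topology \<Rightarrow> 'a set \<Rightarrow> bool" where
  "meagre_in X S \<longleftrightarrow> (\<exists>\<N>. countable \<N> \<and> (\<forall>N\<in>\<N>. nowhere_dense_in X N) \<and> S = \<Union>\<N>)"

definition comeagre_in :: "'a topology \<Rightarrow> 'a set \<Rightarrow> bool" where
  "comeagre_in X S \<longleftrightarrow> S \<subseteq> topspace X \<and> meagre_in X (topspace X - S)"

text \<open>Tuples from the automorphism group whose diagonal conjugacy orbit, viewed through the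
  induced homomorphism, is dense in the power of the homeomorphism group of the quotient;
  \<open>d\<close> is a metric on the quotient.\<close>

definition dense_orbit_tuples ::
    "(nat \<Rightarrow> nat rgraph) \<Rightarrow> (nat \<Rightarrow> nat \<Rightarrow> nat) \<Rightarrow> (nat \<Rightarrow> nat) set metric \<Rightarrow> 'i set \<Rightarrow>
     ('i \<Rightarrow> (nat \<Rightarrow> nat) \<Rightarrow> nat \<Rightarrow> nat) set" where
  "dense_orbit_tuples A p d I = {\<gamma> \<in> I \<rightarrow>\<^sub>E Aut A p.
     (product_topology (\<lambda>i. uniform_topology (pseudoarc A p) d (Homeo (pseudoarc A p))) I) closure_of
       ((\<lambda>g. \<lambda>i\<in>I. induced A p (diag_conj (lim_topology A p) I g \<gamma> i)) ` Aut A p)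
     = (I \<rightarrow>\<^sub>E Homeo (pseudoarc A p))}"

end

theory Submission
  imports Defs
begin

text \<open>By Baire category it suffices that countably many open conditions are dense. The condition on
  a tuple \<open>\<gamma>\<close> of automorphisms is that some conjugate of it follows, up to a bounded error on a level
  of the generic sequence, a prescribed tuple of epimorphisms; every tuple of homeomorphisms of
  the quotient is approximated by such epimorphisms. For density, one has to realize exactly a
  tuple of walks \<open>p\<^sub>i\<close> on a path and, up to a bounded error and for a conjugate, a tuple of walks
  \<open>q\<^sub>i\<close> on another path. Both are combined in the zigzag path that runs through the first path once
  over each vertex of the second one: a walk \<open>p\<close> lifts to it while following \<open>q\<close>, since \<open>p\<close> may
  change the tooth whenever it meets an end of its path. Homogeneity of the limit, which
  rests on amalgamation of walks (the mountain climbing problem), turns the lifts into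
  automorphisms.\<close>


section \<open>Walks on intervals\<close>

text \<open>The obstacle is dimension. A pair of walks \<open>(p, q)\<close> moves through a product
  of two paths, but only linear graphs are available, so both walks cannot be carried along exactly.
  Exactness is spent on \<open>p\<close>, because a neighbourhood in the automorphism group fixes a
  level of the limit. The error is put on \<open>q\<close>, because density is asked only in the
  homeomorphism group of the quotient: a bounded coordinate error on a fine level is adjacency on a
  coarser one, hence a small distance between points of the quotient. Homogeneity produces an
  automorphism from two epimorphisms onto one graph. The identity is therefore lifted as well, and
  the new \<open>\<gamma>'\<close> carries the lift of the identity to the lift of the tuple. For
  this all lifts must live on the same two paths, so these are fixed before the walks to be lifted.
  One lift costs an error of 2, comparing the lift of the tuple with that of the identity gives 4,
  and replacing a homeomorphism by an epimorphism gives 5.\<close>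

definition wmap :: "nat \<Rightarrow> nat \<Rightarrow> (nat \<Rightarrow> nat) \<Rightarrow> bool" where
  "wmap m n w \<longleftrightarrow> w ` {..m} = {..n} \<and> (\<forall>i<m. \<bar>int (w (Suc i)) - int (w i)\<bar> \<le> 1)"

section \<open>Integer walks and intermediate values\<close>

text \<open>Total functions on the integers spare the climbers all boundary conditions; a finite
  walk takes this form after composition with a clamped walk, as in
  \<open>wmap_lip1\<close>.\<close>

definition lip1 :: "(int \<Rightarrow> int) \<Rightarrow> bool" where
  "lip1 f \<longleftrightarrow> (\<forall>x. \<bar>f (x + 1) - f x\<bar> \<le> 1)"

lemma lip1_dist:
  assumes "lip1 f"
  shows "\<bar>f x - f y\<bar> \<le> \<bar>x - y\<bar>"
proof -
  have *: "\<bar>f (z + int k) - f z\<bar> \<le> int k" for z k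
  proof (induction k)
    case (Suc k)
    have "\<bar>f (z + int k + 1) - f (z + int k)\<bar> \<le> 1"
      using assms by (simp add: lip1_def)
    moreover have "z + int (Suc k) = z + int k + 1" by simp
    ultimately show ?case using Suc by presburger
  qed simp
  show ?thesis
  proof (cases "x \<le> y")
    case True
    then show ?thesis using *[of x "nat (y - x)"] by simp
  next
    case False
    then show ?thesis using *[of y "nat (x - y)"] by simp
  qed
qed

text \<open>Symmetric in its end points, so that a climb and its reversal satisfy the same
  hypotheses.\<close>

definition seg :: "int \<Rightarrow> int \<Rightarrow> int set" where
  "seg a b = {min a b..max a b}"

lemma lip1_ivt:
  assumes "lip1 f" and "v \<in> seg (f a) (f b)"
  shows "\<exists>x\<in>seg a b. f x = v"
proof -
  have *: "\<exists>x. a \<le> x \<and> x \<le> b \<and> f x = v" if "a \<le> b" "v \<in> seg (f a) (f b)" for a b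
  proof -
    define F where "F i = f (a + int i)" for i
    have st: "\<bar>F (Suc i) - F i\<bar> \<le> 1" for i
      using assms(1) unfolding F_def lip1_def by (metis add.assoc of_nat_Suc add.commute)
    have ends: "F 0 = f a" "F (nat (b - a)) = f b" using that by (auto simp: F_def)
    have "\<exists>i. 0 \<le> i \<and> i \<le> nat (b - a) \<and> F i = v"
    proof (cases "f a \<le> f b")
      case True
      then show ?thesis using nat_intermed_int_val[of 0 "nat (b - a)" F v] st ends that
        by (auto simp: seg_def)
    next
      case False
      have "\<exists>i. 0 \<le> i \<and> i \<le> nat (b - a) \<and> (\<lambda>i. - F i) i = - v"
        by (rule nat_intermed_int_val) (use st ends that False in \<open>auto simp: seg_def abs_minus_commute\<close>)
      then show ?thesis by auto
    qed
    then obtain i where "i \<le> nat (b - a)" "F i = v" by blast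
    then have "a \<le> a + int i \<and> a + int i \<le> b \<and> f (a + int i) = v"
      using that by (auto simp: F_def)
    then show ?thesis by blast
  qed
  have "seg (f a) (f b) = seg (f b) (f a)" by (auto simp: seg_def)
  then show ?thesis
    using *[of a b] *[of b a] assms(2) by (cases "a \<le> b") (force simp: seg_def)+
qed

section \<open>The mountain climbing lemma\<close>

text \<open>One simultaneous move of two climbers who are at equal height before and after it; each
  may rest. Mountain climbing is reachability in this symmetric relation.\<close>

definition sync :: "(int \<Rightarrow> int) \<Rightarrow> (int \<Rightarrow> int) \<Rightarrow> ((int \<times> int) \<times> int \<times> int) set" where
  "sync f g = {((x, y), (x', y')).
     \<bar>x - x'\<bar> \<le> 1 \<and> \<bar>y - y'\<bar> \<le> 1 \<and> f x = g y \<and> f x' = g y'}"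

lemma sync_sym: "(u, v) \<in> (sync f g)\<^sup>* \<Longrightarrow> (v, u) \<in> (sync f g)\<^sup>*"
proof -
  have "sym (sync f g)" by (auto simp: sync_def sym_def)
  then show "(u, v) \<in> (sync f g)\<^sup>* \<Longrightarrow> (v, u) \<in> (sync f g)\<^sup>*"
    using sym_rtrancl by (meson symD)
qed

lemma sync_swap:
  assumes "((a, c), (b, d)) \<in> (sync f g)\<^sup>*"
  shows "((c, a), (d, b)) \<in> (sync g f)\<^sup>*"
proof -
  have "((snd u, fst u), (snd v, fst v)) \<in> (sync g f)\<^sup>*" if "(u, v) \<in> (sync f g)\<^sup>*" for u v
    using that
  proof (induction rule: rtrancl_induct)
    case (step y z)
    then have "((snd y, fst y), (snd z, fst z)) \<in> sync g f"
      by (auto simp: sync_def)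
    then show ?case using step by (meson rtrancl.rtrancl_into_rtrancl)
  qed simp
  from this[OF assms] show ?thesis by simp
qed

lemma sync_const:
  assumes "\<And>x. x \<in> seg a b \<Longrightarrow> f x = g c"
  shows "((a, c), (b, c)) \<in> (sync f g)\<^sup>*"
proof -
  have *: "((a, c), (a + int k, c)) \<in> (sync f g)\<^sup>*"
    if "\<And>x. a \<le> x \<Longrightarrow> x \<le> a + int k \<Longrightarrow> f x = g c" for k a
    using that
  proof (induction k)
    case (Suc k)
    have "((a + int k, c), (a + int (Suc k), c)) \<in> sync f g"
      using Suc.prems by (auto simp: sync_def)
    moreover have "((a, c), (a + int k, c)) \<in> (sync f g)\<^sup>*"
      by (rule Suc.IH) (rule Suc.prems, auto)
    ultimately show ?case by (meson rtrancl.rtrancl_into_rtrancl)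
  qed simp
  show ?thesis
  proof (cases "a \<le> b")
    case True
    then show ?thesis using *[of a "nat (b - a)"] assms by (simp add: seg_def)
  next
    case False
    then show ?thesis using *[of b "nat (a - b)"] assms sync_sym by (simp add: seg_def)
  qed
qed

text \<open>The inductive step of the mountain climbing lemma when \<open>f\<close> returns to its initial value at
  an interior point \<open>t'\<close>: the first climber makes the excursion up to its extreme value and back
  while the second one follows, reaches the same value for the first time, and retreats to \<open>c\<close>.\<close>

lemma mountain_fold:
  assumes f: "lip1 f" and g: "lip1 g"
    and ac: "f a = g c" and bd: "f b = g d"
    and fs: "f ` seg a b \<subseteq> seg (f a) (f b)" and gs: "g ` seg c d \<subseteq> seg (f a) (f b)"
    and t': "t' \<in> seg a b" "t' \<noteq> a" "t' \<noteq> b" "f t' = f a"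
    and IH: "\<And>a' b' c' d'. \<lbrakk>\<bar>a' - b'\<bar> + \<bar>c' - d'\<bar> < \<bar>a - b\<bar> + \<bar>c - d\<bar>; f a' = g c'; f b' = g d';
        f ` seg a' b' \<subseteq> seg (f a') (f b'); g ` seg c' d' \<subseteq> seg (f a') (f b')\<rbrakk>
        \<Longrightarrow> ((a', c'), (b', d')) \<in> (sync f g)\<^sup>*"
  shows "((a, c), (b, d)) \<in> (sync f g)\<^sup>*"
proof -
  have "finite (seg a t')" "seg a t' \<noteq> {}" by (auto simp: seg_def)
  then obtain t where t: "t \<in> seg a t'" "\<And>x. x \<in> seg a t' \<Longrightarrow> \<bar>f x - f a\<bar> \<le> \<bar>f t - f a\<bar>"
    using ex_is_arg_min_if_finite[of "seg a t'" "\<lambda>x. - \<bar>f x - f a\<bar>"]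
    unfolding is_arg_min_linorder by (metis neg_le_iff_le)
  have sub: "seg a t' \<subseteq> seg a b" "seg t' b \<subseteq> seg a b" using t' by (auto simp: seg_def)
  have fat: "f x \<in> seg (f a) (f t)" if "x \<in> seg a t'" for x
  proof -
    have "f x \<in> seg (f a) (f b)" "f t \<in> seg (f a) (f b)" using that t(1) sub fs by blast+
    then show ?thesis using t(2)[OF that] by (auto simp: seg_def)
  qed
  have "f t \<in> seg (g c) (g d)" using t(1) sub fs ac bd by auto
  then obtain s0 where s0: "s0 \<in> seg c d" "g s0 = f t" using lip1_ivt[OF g] by blast
  define Q where "Q = {s \<in> seg c d. g s = f t}"
  have "finite Q" unfolding Q_def seg_def by (rule finite_subset[of _ "{min c d..max c d}"]) auto
  moreover have "Q \<noteq> {}" using s0 by (auto simp: Q_def)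
  ultimately
  obtain s where s: "s \<in> Q" "\<And>x. x \<in> Q \<Longrightarrow> \<bar>s - c\<bar> \<le> \<bar>x - c\<bar>"
    using ex_is_arg_min_if_finite[of Q "\<lambda>x. \<bar>x - c\<bar>"]
    unfolding is_arg_min_linorder by metis
  have scd: "s \<in> seg c d" and gst: "g s = f t" using s(1) by (auto simp: Q_def)
  \<comment> \<open>A height beyond \<open>f t\<close> before \<open>s\<close> would force an
    earlier visit to the height \<open>f t\<close>, against the choice of \<open>s\<close> as a
    point of \<open>Q\<close> nearest to \<open>c\<close>.\<close>
  have gcs: "g x \<in> seg (f a) (f t)" if x: "x \<in> seg c s" for x
  proof (rule ccontr)
    assume n: "g x \<notin> seg (f a) (f t)"
    have xcd: "x \<in> seg c d" using x scd by (auto simp: seg_def)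
    have "g x \<in> seg (f a) (f b)" using gs xcd by blast
    moreover have "f t \<in> seg (f a) (f b)" using fs t(1) sub by blast
    ultimately have "f t \<in> seg (g c) (g x)" using n ac by (auto simp: seg_def)
    then obtain z where z: "z \<in> seg c x" "g z = f t" using lip1_ivt[OF g] by blast
    then have "z \<in> Q" using xcd by (auto simp: Q_def seg_def)
    then have "\<bar>s - c\<bar> \<le> \<bar>z - c\<bar>" by (rule s(2))
    then have "x = s" using z(1) x by (auto simp: seg_def)
    then show False using n gst by (auto simp: seg_def)
  qed
  \<comment> \<open>The induction measure drops because \<open>t'\<close> is interior: each of the
    three stretches of the first climber is shorter than the whole, while the second climber never
    needs a longer one.\<close>
  have tb: "\<bar>a - t\<bar> < \<bar>a - b\<bar>" "\<bar>t - t'\<bar> < \<bar>a - b\<bar>" "\<bar>t' - b\<bar> < \<bar>a - b\<bar>"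
    using t(1) t' by (auto simp: seg_def)
  have sb: "\<bar>c - s\<bar> \<le> \<bar>c - d\<bar>" using scd by (auto simp: seg_def)
  have 1: "((a, c), (t, s)) \<in> (sync f g)\<^sup>*"
  proof (rule IH)
    have "seg a t \<subseteq> seg a t'" using t(1) by (auto simp: seg_def)
    then show "f ` seg a t \<subseteq> seg (f a) (f t)" using fat by blast
    show "g ` seg c s \<subseteq> seg (f a) (f t)" using gcs by blast
  qed (use tb sb ac gst in auto)
  have sw: "seg (f t) (f t') = seg (f a) (f t)" "seg s c = seg c s"
    using t'(4) by (auto simp: seg_def)
  have 2: "((t, s), (t', c)) \<in> (sync f g)\<^sup>*"
  proof (rule IH)
    have "seg t t' \<subseteq> seg a t'" using t(1) by (auto simp: seg_def)
    then show "f ` seg t t' \<subseteq> seg (f t) (f t')" unfolding sw using fat by blast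
    show "g ` seg s c \<subseteq> seg (f t) (f t')" unfolding sw using gcs by blast
    show "\<bar>t - t'\<bar> + \<bar>s - c\<bar> < \<bar>a - b\<bar> + \<bar>c - d\<bar>"
      using tb(2) sb by (simp add: abs_minus_commute[of s c])
  qed (use ac gst t' in auto)
  have 3: "((t', c), (b, d)) \<in> (sync f g)\<^sup>*"
  proof (rule IH)
    show "f ` seg t' b \<subseteq> seg (f t') (f b)" using fs sub t'(4) by auto
    show "g ` seg c d \<subseteq> seg (f t') (f b)" using gs t'(4) by auto
  qed (use tb sb ac bd t' in auto)
  from 1 2 3 show ?thesis by (meson rtrancl_trans)
qed

text \<open>Induction on the total length. A return to an end height at an interior point is handled
  by \<open>mountain_fold\<close>, after exchanging the walks or reversing time if necessary; this
  is why the walks vary in the induction. Without such a return both walks must leave their end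
  heights at once and in the same direction, so the outermost moves are made jointly and the inner
  stretches fall under the induction hypothesis.\<close>

lemma mountain:
  assumes "lip1 f" "lip1 g" "f a = g c" "f b = g d"
    and "f ` seg a b \<subseteq> seg (f a) (f b)" "g ` seg c d \<subseteq> seg (f a) (f b)"
  shows "((a, c), (b, d)) \<in> (sync f g)\<^sup>*"
  using assms
proof (induction "nat (\<bar>a - b\<bar> + \<bar>c - d\<bar>)" arbitrary: a b c d f g rule: less_induct)
  case less
  note f = \<open>lip1 f\<close> and g = \<open>lip1 g\<close> and ac = \<open>f a = g c\<close> and bd = \<open>f b = g d\<close>
  note fs = \<open>f ` seg a b \<subseteq> seg (f a) (f b)\<close> and gs = \<open>g ` seg c d \<subseteq> seg (f a) (f b)\<close>
  have IH: "((a', c'), (b', d')) \<in> (sync f' g')\<^sup>*"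
    if "\<bar>a' - b'\<bar> + \<bar>c' - d'\<bar> < \<bar>a - b\<bar> + \<bar>c - d\<bar>" "lip1 f'" "lip1 g'" "f' a' = g' c'" "f' b' = g' d'"
      "f' ` seg a' b' \<subseteq> seg (f' a') (f' b')" "g' ` seg c' d' \<subseteq> seg (f' a') (f' b')"
    for a' b' c' d' f' g'
    by (rule less.hyps[OF _ that(2-7)]) (use that(1) in simp)
  have sc: "seg x y = seg y x" for x y by (auto simp: seg_def)
  consider (const) "f a = f b"
    | (fa) t where "f a \<noteq> f b" "t \<in> seg a b" "t \<noteq> a" "t \<noteq> b" "f t = f a"
    | (fb) t where "f a \<noteq> f b" "t \<in> seg a b" "t \<noteq> a" "t \<noteq> b" "f t = f b"
    | (ga) t where "f a \<noteq> f b" "t \<in> seg c d" "t \<noteq> c" "t \<noteq> d" "g t = f a"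
    | (gb) t where "f a \<noteq> f b" "t \<in> seg c d" "t \<noteq> c" "t \<noteq> d" "g t = f b"
    | (int) "f a \<noteq> f b" "\<And>t. t \<in> seg a b \<Longrightarrow> t \<noteq> a \<Longrightarrow> t \<noteq> b \<Longrightarrow> f t \<noteq> f a \<and> f t \<noteq> f b"
       "\<And>t. t \<in> seg c d \<Longrightarrow> t \<noteq> c \<Longrightarrow> t \<noteq> d \<Longrightarrow> g t \<noteq> f a \<and> g t \<noteq> f b"
    by blast
  then show ?case
  proof cases
    case const
    have sg: "seg (f a) (f b) = {f b}" using const by (simp add: seg_def)
    have "f x = g c" if "x \<in> seg a b" for x using fs sg const ac that by auto
    then have 1: "((a, c), (b, c)) \<in> (sync f g)\<^sup>*" by (rule sync_const)
    have "g y = f b" if "y \<in> seg c d" for y using gs sg that by auto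
    then have "((c, b), (d, b)) \<in> (sync g f)\<^sup>*" by (rule sync_const)
    then show ?thesis using 1 sync_swap by (meson rtrancl_trans)
  next
    case fa
    show ?thesis
      by (rule mountain_fold[OF f g ac bd fs gs fa(2-5)]) (rule IH, use f g in auto)
  next
    case fb
    have "((b, d), (a, c)) \<in> (sync f g)\<^sup>*"
      by (rule mountain_fold[OF f g bd ac _ _ _ fb(4,3,5)])
        (use fs gs fb(2) IH f g in \<open>auto simp: sc[of b a] sc[of d c] sc[of "f b" "f a"] abs_minus_commute\<close>)
    then show ?thesis by (rule sync_sym)
  next
    case ga
    have "((c, a), (d, b)) \<in> (sync g f)\<^sup>*"
      by (rule mountain_fold[OF g f ac[symmetric] bd[symmetric] _ _ ga(2-4)])
        (use fs gs IH f g ac bd ga(5) in auto)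
    then show ?thesis by (rule sync_swap)
  next
    case gb
    have "((d, b), (c, a)) \<in> (sync g f)\<^sup>*"
      by (rule mountain_fold[OF g f bd[symmetric] ac[symmetric] _ _ _ gb(4,3)])
        (use fs gs gb(2,5) IH f g ac bd in
          \<open>auto simp: sc[of b a] sc[of d c] sc[of "g d" "g c"] abs_minus_commute\<close>)
    then show ?thesis by (rule sync_swap[OF sync_sym])
  next
    case int
    define nxt where "nxt x y = (if x < y then x + 1 else x - 1)" for x y :: int
    have ne: "a \<noteq> b" "c \<noteq> d" using int(1) ac bd by auto
    have nx: "nxt x y \<in> seg x y" "\<bar>x - nxt x y\<bar> \<le> 1" "nxt x y \<noteq> x" if "x \<noteq> y" for x y
      using that by (auto simp: nxt_def seg_def)
    have fv: "\<And>x. x \<in> seg a b \<Longrightarrow> f x \<in> seg (f a) (f b)"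
      and gv: "\<And>y. y \<in> seg c d \<Longrightarrow> g y \<in> seg (f a) (f b)" using fs gs by auto
    have lf: "\<bar>f x - f y\<bar> \<le> 1" if "\<bar>x - y\<bar> \<le> 1" for x y using lip1_dist[OF f] that order_trans by blast
    have lg: "\<bar>g x - g y\<bar> \<le> 1" if "\<bar>x - y\<bar> \<le> 1" for x y using lip1_dist[OF g] that order_trans by blast
    show ?thesis
    proof (cases "\<bar>f a - f b\<bar> = 1")
      \<comment> \<open>No integer lies strictly between the end heights, so an interior point would
        revisit one of them; hence each stretch is a single move.\<close>
      case True
      then have two: "v = f a \<or> v = f b" if "v \<in> seg (f a) (f b)" for v
        using that unfolding seg_def atLeastAtMost_iff by linarith
      have "nxt a b = b"
        using two[OF fv[OF nx(1)[OF ne(1)]]] int(2)[OF nx(1)[OF ne(1)] nx(3)[OF ne(1)]] by blast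
      moreover have "nxt c d = d"
        using two[OF gv[OF nx(1)[OF ne(2)]]] int(3)[OF nx(1)[OF ne(2)] nx(3)[OF ne(2)]] by blast
      ultimately have "((a, c), (b, d)) \<in> sync f g"
        using nx(2)[OF ne(1)] nx(2)[OF ne(2)] ac bd by (auto simp: sync_def)
      then show ?thesis by blast
    next
      case False
      let ?a = "nxt a b" and ?b = "nxt b a" and ?c = "nxt c d" and ?d = "nxt d c"
      have a1: "?a \<in> seg a b" "\<bar>a - ?a\<bar> \<le> 1" "?a \<noteq> a" and b1: "?b \<in> seg a b" "\<bar>b - ?b\<bar> \<le> 1" "?b \<noteq> b"
        and c1: "?c \<in> seg c d" "\<bar>c - ?c\<bar> \<le> 1" "?c \<noteq> c" and d1: "?d \<in> seg c d" "\<bar>d - ?d\<bar> \<le> 1" "?d \<noteq> d"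
        using nx[OF ne(1)] nx[OF ne(2)] nx[OF ne(1)[symmetric]] nx[OF ne(2)[symmetric]] sc by auto
      have "?a \<noteq> b" "?b \<noteq> a" "?c \<noteq> d" "?d \<noteq> c"
        using lf[OF a1(2)] lf[OF b1(2)] lg[OF c1(2)] lg[OF d1(2)] False int(1) ac bd by auto
      note ne2 = this
      \<comment> \<open>The first move changes the height by at most 1, stays between the end
        heights and may not rest at \<open>f a\<close>, so it goes one unit towards
        \<open>f b\<close>.\<close>
      have va: "f ?a = f a + sgn (f b - f a)"
        using fv[OF a1(1)] int(2)[OF a1(1,3) ne2(1)] lf[OF a1(2)] by (auto simp: seg_def sgn_if)
      have vb: "f ?b = f b - sgn (f b - f a)"
        using fv[OF b1(1)] int(2)[OF b1(1) ne2(2) b1(3)] lf[OF b1(2)] by (auto simp: seg_def sgn_if)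
      have vc: "g ?c = f a + sgn (f b - f a)"
        using gv[OF c1(1)] int(3)[OF c1(1,3) ne2(3)] lg[OF c1(2)] ac by (auto simp: seg_def sgn_if)
      have vd: "g ?d = f b - sgn (f b - f a)"
        using gv[OF d1(1)] int(3)[OF d1(1) ne2(4) d1(3)] lg[OF d1(2)] bd by (auto simp: seg_def sgn_if)
      have sub: "x \<in> seg a b \<and> x \<noteq> a \<and> x \<noteq> b" if "x \<in> seg ?a ?b" for x
        using that a1 b1 ne2 by (auto simp: seg_def nxt_def split: if_splits)
      have sub2: "x \<in> seg c d \<and> x \<noteq> c \<and> x \<noteq> d" if "x \<in> seg ?c ?d" for x
        using that c1 d1 ne2 by (auto simp: seg_def nxt_def split: if_splits)
      have inner: "v \<in> seg (f ?a) (f ?b)" if "v \<in> seg (f a) (f b)" "v \<noteq> f a" "v \<noteq> f b" for v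
        using that unfolding va vb by (auto simp: seg_def sgn_if)
      have "((?a, ?c), (?b, ?d)) \<in> (sync f g)\<^sup>*"
      proof (rule IH[OF _ f g])
        have "\<bar>?a - ?b\<bar> < \<bar>a - b\<bar>" "\<bar>?c - ?d\<bar> < \<bar>c - d\<bar>"
          using ne ne2 by (auto simp: nxt_def)
        then show "\<bar>?a - ?b\<bar> + \<bar>?c - ?d\<bar> < \<bar>a - b\<bar> + \<bar>c - d\<bar>" by linarith
        show "f ?a = g ?c" "f ?b = g ?d" using va vb vc vd by auto
        show "f ` seg ?a ?b \<subseteq> seg (f ?a) (f ?b)" using sub fv int(2) inner by blast
        show "g ` seg ?c ?d \<subseteq> seg (f ?a) (f ?b)" using sub2 gv int(3) inner by blast
      qed
      moreover have "((a, c), (?a, ?c)) \<in> sync f g" "((?b, ?d), (b, d)) \<in> sync f g"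
        using a1 b1 c1 d1 ac bd va vb vc vd by (auto simp: sync_def abs_minus_commute)
      ultimately show ?thesis
        by (meson rtrancl.rtrancl_into_rtrancl converse_rtrancl_into_rtrancl)
    qed
  qed
qed

section \<open>Amalgamation of surjective walks\<close>

text \<open>Mountain climbing controls only the end points of the climb, whereas an amalgam must
  visit every vertex. The remedy is a detour: from \<open>a\<close> down to \<open>0\<close>, up to
  \<open>m\<close>, down to \<open>b\<close>, of total length \<open>a + 2 * m - b\<close>, and
  constant outside that time span.\<close>

lemma folded_walk:
  fixes m a b :: int
  assumes "0 \<le> a" "a \<le> m" "0 \<le> b" "b \<le> m"
  obtains \<rho> L where "0 \<le> L" "\<rho> 0 = a" "\<rho> L = b" "lip1 \<rho>" "\<And>x. \<rho> x \<in> {0..m}"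
    "\<And>y. y \<in> {0..m} \<Longrightarrow> \<exists>x\<in>{0..L}. \<rho> x = y"
proof -
  define L where "L = a + 2 * m - b"
  define \<rho> where "\<rho> x = m - \<bar>m - \<bar>max 0 (min L x) - a\<bar>\<bar>" for x
  show thesis
  proof (rule that)
    show "0 \<le> L" "\<rho> 0 = a" "\<rho> L = b" using assms by (auto simp: L_def \<rho>_def)
    show "lip1 \<rho>" unfolding lip1_def \<rho>_def by linarith
    show "\<rho> x \<in> {0..m}" for x
    proof -
      have "0 \<le> max 0 (min L x) \<and> max 0 (min L x) \<le> L" using assms by (auto simp: L_def)
      then show ?thesis using assms by (auto simp: \<rho>_def L_def)
    qed
    show "\<exists>x\<in>{0..L}. \<rho> x = y" if "y \<in> {0..m}" for y
      using assms that by (intro bexI[of _ "a + y"]) (auto simp: L_def \<rho>_def)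
  qed
qed

lemma wmap_le: "wmap m n w \<Longrightarrow> i \<le> m \<Longrightarrow> w i \<le> n"
  unfolding wmap_def by blast

lemma wmap_onto: "wmap m n w \<Longrightarrow> j \<le> n \<Longrightarrow> \<exists>i\<le>m. w i = j"
  unfolding wmap_def by (metis atMost_iff imageE)

lemma wmapI:
  assumes "\<And>i. i \<le> m \<Longrightarrow> w i \<le> n" and "\<And>j. j \<le> n \<Longrightarrow> \<exists>i\<le>m. w i = j"
    and "\<And>i. i < m \<Longrightarrow> \<bar>int (w (Suc i)) - int (w i)\<bar> \<le> 1"
  shows "wmap m n w"
proof -
  have "w ` {..m} \<subseteq> {..n}" using assms(1) by blast
  moreover have "{..n} \<subseteq> w ` {..m}" using assms(2) by blast
  ultimately show ?thesis using assms(3) by (simp add: wmap_def)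
qed

lemma wmap_dist:
  assumes "wmap m n w" "i \<le> m" "j \<le> m"
  shows "\<bar>int (w i) - int (w j)\<bar> \<le> \<bar>int i - int j\<bar>"
proof -
  have *: "i + k \<le> m \<Longrightarrow> \<bar>int (w (i + k)) - int (w i)\<bar> \<le> int k" for i k
  proof (induction k)
    case (Suc k)
    then have "\<bar>int (w (Suc (i + k))) - int (w (i + k))\<bar> \<le> 1"
      using assms(1) by (simp add: wmap_def)
    then show ?case using Suc by auto
  qed simp
  show ?thesis
    using *[of i "j - i"] *[of j "i - j"] assms by (cases "i \<le> j") auto
qed

lemma wmap_lip1:
  assumes "wmap m n u" "lip1 \<rho>" "\<And>x. \<rho> x \<in> {0..int m}"
  shows "lip1 (\<lambda>x. int (u (nat (\<rho> x))))"
  unfolding lip1_def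
proof
  fix x
  have "nat (\<rho> y) \<le> m" for y using assms(3)[of y] by auto
  then have "\<bar>int (u (nat (\<rho> (x + 1)))) - int (u (nat (\<rho> x)))\<bar>
      \<le> \<bar>int (nat (\<rho> (x + 1))) - int (nat (\<rho> x))\<bar>"
    by (intro wmap_dist[OF assms(1)])
  also have "\<dots> \<le> 1" using assms(2) assms(3)[of x] assms(3)[of "x + 1"] by (simp add: lip1_def)
  finally show "\<bar>int (u (nat (\<rho> (x + 1)))) - int (u (nat (\<rho> x)))\<bar> \<le> 1" .
qed

text \<open>By discrete intermediate values the times \<open>z i\<close> pass through all of
  \<open>{0..L}\<close>, where \<open>\<rho>\<close> already takes every value.\<close>

lemma folded_walk_onto:
  assumes \<rho>: "\<And>x. \<rho> x \<in> {0..int m}" "lip1 \<rho>" "\<And>y. y \<in> {0..int m} \<Longrightarrow> \<exists>x\<in>{0..L}. \<rho> x = y"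
    and z: "z 0 = 0" "z l = L" "\<And>i. i < l \<Longrightarrow> \<bar>z (Suc i) - z i\<bar> \<le> 1"
  shows "wmap l m (\<lambda>i. nat (\<rho> (z i)))"
proof (rule wmapI)
  show "nat (\<rho> (z i)) \<le> m" for i using \<rho>(1)[of "z i"] by auto
  show "\<exists>i\<le>l. nat (\<rho> (z i)) = j" if j: "j \<le> m" for j
  proof -
    obtain x where x: "x \<in> {0..L}" "\<rho> x = int j" using \<rho>(3)[of "int j"] j by auto
    have "\<exists>i. 0 \<le> i \<and> i \<le> l \<and> z i = x"
      by (rule nat_intermed_int_val) (use z x in auto)
    then show ?thesis using x by auto
  qed
  show "\<bar>int (nat (\<rho> (z (Suc i)))) - int (nat (\<rho> (z i)))\<bar> \<le> 1" if "i < l" for i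
    using lip1_dist[OF \<rho>(2), of "z (Suc i)" "z i"] z(3)[OF that] \<rho>(1)[of "z i"] \<rho>(1)[of "z (Suc i)"]
    by auto
qed

text \<open>Both walks are precomposed with a detour that starts over height \<open>0\<close> and
  ends over height \<open>n\<close>. These are the extreme heights, so the range conditions of
  \<open>mountain\<close> hold automatically, and the detours make the synchronized climbs
  surjective.\<close>

lemma wmap_amalgam:
  assumes u: "wmap m n u" and v: "wmap k n v"
  obtains l s t where "wmap l m s" "wmap l k t" "\<And>i. i \<le> l \<Longrightarrow> u (s i) = v (t i)"
proof -
  obtain a b where ab: "a \<le> m" "u a = 0" "b \<le> m" "u b = n"
    using wmap_onto[OF u, of 0] wmap_onto[OF u, of n] by auto
  obtain c d where cd: "c \<le> k" "v c = 0" "d \<le> k" "v d = n"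
    using wmap_onto[OF v, of 0] wmap_onto[OF v, of n] by auto
  obtain \<rho> L where \<rho>: "0 \<le> L" "\<rho> 0 = int a" "\<rho> L = int b" "lip1 \<rho>" "\<And>x. \<rho> x \<in> {0..int m}"
    "\<And>y. y \<in> {0..int m} \<Longrightarrow> \<exists>x\<in>{0..L}. \<rho> x = y"
    by (rule folded_walk[of "int a" "int m" "int b"]) (use ab in \<open>simp_all only: of_nat_0_le_iff of_nat_le_iff\<close>)
  obtain \<sigma> K where \<sigma>: "0 \<le> K" "\<sigma> 0 = int c" "\<sigma> K = int d" "lip1 \<sigma>" "\<And>x. \<sigma> x \<in> {0..int k}"
    "\<And>y. y \<in> {0..int k} \<Longrightarrow> \<exists>x\<in>{0..K}. \<sigma> x = y"
    by (rule folded_walk[of "int c" "int k" "int d"]) (use cd in \<open>simp_all only: of_nat_0_le_iff of_nat_le_iff\<close>)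
  define f where "f x = int (u (nat (\<rho> x)))" for x
  define g where "g x = int (v (nat (\<sigma> x)))" for x
  have e: "f 0 = 0" "f L = int n" "g 0 = 0" "g K = int n"
    using \<rho> \<sigma> ab cd by (auto simp: f_def g_def)
  have "((0, 0), (L, K)) \<in> (sync f g)\<^sup>*"
  proof (rule mountain)
    show "lip1 f" "lip1 g"
      using wmap_lip1[OF u \<rho>(4,5)] wmap_lip1[OF v \<sigma>(4,5)] by (simp_all add: f_def[abs_def] g_def[abs_def])
    have "u (nat (\<rho> x)) \<le> n" for x
      using \<rho>(5)[of x] by (intro wmap_le[OF u]) auto
    then show "f ` seg 0 L \<subseteq> seg (f 0) (f L)"
      unfolding e by (auto simp: seg_def f_def)
    have "v (nat (\<sigma> x)) \<le> n" for x
      using \<sigma>(5)[of x] by (intro wmap_le[OF v]) auto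
    then show "g ` seg 0 K \<subseteq> seg (f 0) (f L)"
      unfolding e by (auto simp: seg_def g_def)
  qed (use e in auto)
  then obtain l where "((0, 0), (L, K)) \<in> sync f g ^^ l" by (meson rtrancl_imp_relpow)
  then obtain z where z: "z 0 = (0, 0)" "z l = (L, K)" "\<And>i. i < l \<Longrightarrow> (z i, z (Suc i)) \<in> sync f g"
    by (auto simp: relpow_fun_conv)
  have st: "\<bar>fst (z (Suc i)) - fst (z i)\<bar> \<le> 1 \<and> \<bar>snd (z (Suc i)) - snd (z i)\<bar> \<le> 1 \<and>
      f (fst (z i)) = g (snd (z i))" if "i < l" for i
    using z(3)[OF that] by (auto simp: sync_def abs_minus_commute)
  show thesis
  proof (rule that)
    show "wmap l m (\<lambda>i. nat (\<rho> (fst (z i))))"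
      by (rule folded_walk_onto[OF \<rho>(5,4,6)]) (use z st in auto)
    show "wmap l k (\<lambda>i. nat (\<sigma> (snd (z i))))"
      by (rule folded_walk_onto[OF \<sigma>(5,4,6)]) (use z st in auto)
    show "u (nat (\<rho> (fst (z i)))) = v (nat (\<sigma> (snd (z i))))" if "i \<le> l" for i
    proof -
      have "f (fst (z i)) = g (snd (z i))"
        using that st[of i] z(2) e by (cases "i = l") auto
      then show ?thesis by (simp add: f_def g_def)
    qed
  qed
qed

section \<open>The zigzag path and lifts through it\<close>

text \<open>Tooth \<open>b\<close> occupies the positions from \<open>M * b\<close> to
  \<open>M * b + M\<close> and is run through upwards for even \<open>b\<close> and downwards for
  odd \<open>b\<close>. The same involution turns a height into an offset within the tooth and
  back.\<close>

definition fold_pos :: "nat \<Rightarrow> nat \<Rightarrow> nat \<Rightarrow> nat" where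
  "fold_pos M b h = (if even b then h else M - h)"

lemma fold_pos_le: "h \<le> M \<Longrightarrow> fold_pos M b h \<le> M"
  by (simp add: fold_pos_def)

lemma fold_pos_fold_pos: "h \<le> M \<Longrightarrow> fold_pos M b (fold_pos M b h) = h"
  by (simp add: fold_pos_def)

text \<open>The teeth \<open>b\<close> and \<open>Suc b\<close> meet at the top for even
  \<open>b\<close> and at the bottom for odd \<open>b\<close>; at that height both describe the same
  position, so a lift may pass from one to the other without moving.\<close>

lemma fold_pos_switch:
  assumes "\<bar>int b - int b'\<bar> \<le> 1" "h = (if even (min b b') then M else 0)"
  shows "M * b + fold_pos M b h = M * b' + fold_pos M b' h"
proof -
  consider "b = b'" | "b' = Suc b" | "b = Suc b'" using assms(1) by linarith
  then show ?thesis by cases (use assms(2) in \<open>auto simp: fold_pos_def\<close>)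
qed

definition zigzag :: "nat \<Rightarrow> nat \<Rightarrow> nat" where
  "zigzag M y = fold_pos M (y div M) (y mod M)"

lemma zigzag_fold_pos:
  assumes "0 < M" "h \<le> M"
  shows "zigzag M (M * b + fold_pos M b h) = h"
\<comment> \<open>The offset \<open>M\<close> is a joint, which \<open>div\<close> and
  \<open>mod\<close> assign to the next tooth with offset \<open>0\<close>.\<close>
proof (cases "fold_pos M b h = M")
  case True
  then have "M * b + fold_pos M b h = M * Suc b" by simp
  then have "zigzag M (M * b + fold_pos M b h) = fold_pos M (Suc b) 0"
    using assms(1) by (simp only: zigzag_def nonzero_mult_div_cancel_left mod_mult_self1_is_0)
  then show ?thesis using True assms by (auto simp: fold_pos_def split: if_splits)
next
  case False
  then have "fold_pos M b h < M" using fold_pos_le[OF assms(2)] by (simp add: le_neq_implies_less)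
  then have "(M * b + fold_pos M b h) div M = b" "(M * b + fold_pos M b h) mod M = fold_pos M b h"
    by simp_all
  then show ?thesis using assms by (simp add: zigzag_def fold_pos_fold_pos)
qed

text \<open>There is one tooth of length \<open>M\<close> for each of the \<open>Suc N\<close>
  vertices of the second path.\<close>

lemma wmap_zigzag:
  assumes "0 < M"
  shows "wmap (M * Suc N) M (zigzag M)"
proof (rule wmapI)
  show "zigzag M y \<le> M" for y
    using assms by (simp add: zigzag_def fold_pos_le less_imp_le)
  show "\<exists>y\<le>M * Suc N. zigzag M y = h" if "h \<le> M" for h
    using zigzag_fold_pos[OF assms that, of 0] that by (intro exI[of _ h]) (simp add: fold_pos_def)
  show "\<bar>int (zigzag M (Suc y)) - int (zigzag M y)\<bar> \<le> 1" for y
  proof (cases "Suc (y mod M) = M")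
    case True
    then have "Suc y mod M = 0" "Suc y div M = Suc (y div M)" by (simp_all add: mod_Suc div_Suc)
    then show ?thesis using True by (auto simp: zigzag_def fold_pos_def)
  next
    case False
    then have "Suc y mod M = Suc (y mod M)" "Suc y div M = y div M" by (simp_all add: mod_Suc div_Suc)
    moreover have "Suc (y mod M) < M" using False assms by (meson Suc_lessI mod_less_divisor)
    ultimately show ?thesis by (auto simp: zigzag_def fold_pos_def)
  qed
qed

text \<open>On the \<open>v\<close>-th block of length \<open>2 (K + 1)\<close> the walk \<open>f\<close> goes up
  and down \<open>{0..K}\<close> once while \<open>g\<close> rests at \<open>v\<close>. The lift \<open>r\<close> of \<open>p \<circ> f\<close> through the zigzag map
  runs in the \<open>q (v - 1)\<close>-th tooth until a time \<open>d v\<close> when \<open>p \<circ> f\<close> has the height at which the teeth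
  \<open>q (v - 1)\<close> and \<open>q v\<close> are joined; there it changes to the tooth \<open>q v\<close>.\<close>

lemma wmap_lift:
  assumes M: "0 < M"
  obtains l L f g e where "wmap l K f" "wmap l S g" "wmap L M e"
    "\<And>p q. wmap K M p \<Longrightarrow> wmap S N q \<Longrightarrow>
      \<exists>r. wmap l L r \<and> (\<forall>x\<le>l. e (r x) = p (f x) \<and> \<bar>int (r x div M) - int (q (g x))\<bar> \<le> 2)"
proof -
  \<comment> \<open>A block consists of \<open>Suc K\<close> times going up and \<open>Suc K\<close>
    times coming down; \<open>f\<close> rests for one step at the turn and at the passage to the
    next block. There are \<open>Suc S\<close> blocks, and \<open>l\<close> is the last
    time.\<close>
  define T where "T = 2 * Suc K"
  define l where "l = T * Suc S - 1"
  define f where "f x = (if x mod T \<le> K then x mod T else T - 1 - x mod T)" for x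
  have T0: "0 < T" by (simp add: T_def)
  have l: "x \<le> l \<longleftrightarrow> x < T * Suc S" for x using T0 by (auto simp: l_def)
  have modT: "x mod T < T" for x using T0 by simp
  have fK: "f x \<le> K" for x using modT[of x] by (auto simp: f_def T_def)
  have gS: "x div T \<le> S" if "x \<le> l" for x
    using that less_mult_imp_div_less[of x "Suc S" T] by (simp add: l mult.commute)
  have f: "wmap l K f"
  proof (rule wmapI)
    show "f x \<le> K" for x by (rule fK)
    show "\<exists>x\<le>l. f x = j" if "j \<le> K" for j
      using that by (intro exI[of _ j]) (auto simp: l f_def T_def)
    show "\<bar>int (f (Suc x)) - int (f x)\<bar> \<le> 1" for x
    proof (cases "Suc (x mod T) = T")
      case True
      then have "Suc x mod T = 0" by (simp add: mod_Suc)
      then show ?thesis using True by (auto simp: f_def T_def)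
    next
      case False
      define m where "m = x mod T"
      have "Suc x mod T = Suc m" using False by (simp add: mod_Suc m_def)
      then have "f x = (if m \<le> K then m else T - 1 - m)"
        "f (Suc x) = (if Suc m \<le> K then Suc m else T - 1 - Suc m)" by (simp_all add: f_def m_def)
      moreover have "Suc m < T" using modT[of x] False by (simp add: m_def)
      ultimately show ?thesis using T_def by auto
    qed
  qed
  have g: "wmap l S (\<lambda>x. x div T)"
  proof (rule wmapI)
    show "x div T \<le> S" if "x \<le> l" for x using that by (rule gS)
    show "\<exists>x\<le>l. x div T = j" if "j \<le> S" for j
    proof -
      have "T * j < T * Suc S" using that T0 by (simp only: mult_less_cancel1) simp
      then show ?thesis using T0 l by (intro exI[of _ "T * j"]) simp
    qed
    show "\<bar>int (Suc x div T) - int (x div T)\<bar> \<le> 1" for x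
      by (simp add: div_Suc)
  qed
  have "\<exists>r. wmap l (M * Suc N) r \<and>
      (\<forall>x\<le>l. zigzag M (r x) = p (f x) \<and> \<bar>int (r x div M) - int (q (x div T))\<bar> \<le> 2)"
    if p: "wmap K M p" and q: "wmap S N q" for p q
  proof -
    \<comment> \<open>Truncated subtraction gives \<open>q (v - 1) = q v\<close> for
      \<open>v = 0\<close>, so the first block fits without a special case.\<close>
    have q1: "\<bar>int (q (v - 1)) - int (q v)\<bar> \<le> 1" if "v \<le> S" for v
      using wmap_dist[OF q, of "v - 1" v] that by (cases v) auto
    define h where "h v = (if even (min (q (v - 1)) (q v)) then M else 0)" for v
    \<comment> \<open>Surjectivity of \<open>p\<close> supplies a time for the change. It is taken
      at most \<open>K\<close>, hence in the upward half of the block, where \<open>f\<close> at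
      that time is the time itself.\<close>
    have "\<exists>d. \<forall>v. d v \<le> K \<and> p (d v) = h v"
      using wmap_onto[OF p] by (intro choice allI) (simp add: h_def)
    then obtain d where d: "\<And>v. d v \<le> K" "\<And>v. p (d v) = h v" by blast
    define s where "s x = (if x mod T \<le> d (x div T) then q (x div T - 1) else q (x div T))" for x
    define r where "r x = M * s x + fold_pos M (s x) (p (f x))" for x
    have pM: "p (f x) \<le> M" for x using wmap_le[OF p fK] .
    have sN: "s x \<le> N" if "x \<le> l" for x
    proof -
      have "x div T \<le> S" "x div T - 1 \<le> S" using gS[OF that] by auto
      then show ?thesis unfolding s_def using wmap_le[OF q] by simp
    qed
    have sq: "\<bar>int (s x) - int (q (x div T))\<bar> \<le> 1" if "x \<le> l" for x
      using q1[OF gS[OF that]] by (simp add: s_def)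
    have step: "\<bar>int (M * b + fold_pos M b (p (f (Suc x)))) - int (M * b + fold_pos M b (p (f x)))\<bar> \<le> 1"
      if "x < l" for x b
    proof -
      have "\<bar>int (f (Suc x)) - int (f x)\<bar> \<le> 1" using f that by (simp add: wmap_def)
      then have "\<bar>int (p (f (Suc x))) - int (p (f x))\<bar> \<le> 1"
        using wmap_dist[OF p fK[of "Suc x"] fK[of x]] by linarith
      then show ?thesis using pM[of x] pM[of "Suc x"] by (auto simp: fold_pos_def of_nat_diff)
    qed
    have "wmap l (M * Suc N) r"
    proof (rule wmapI)
      show "r x \<le> M * Suc N" if "x \<le> l" for x
      proof -
        have "M * s x \<le> M * N" by (rule mult_le_mono2[OF sN[OF that]])
        then show ?thesis using fold_pos_le[OF pM, of "s x" x] unfolding r_def mult_Suc_right by linarith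
      qed
      show "\<exists>x\<le>l. r x = y" if "y \<le> M * Suc N" for y
      proof -
        \<comment> \<open>Only the last position is not covered by \<open>div\<close> and
          \<open>mod\<close>: it is the far end of tooth \<open>N\<close>.\<close>
        obtain b o' where bo: "y = M * b + o'" "b \<le> N" "o' \<le> M"
        proof (cases "y = M * Suc N")
          case True
          then show ?thesis by (intro that[of N M]) auto
        next
          case False
          then have "y div M < Suc N" using \<open>y \<le> M * Suc N\<close>
            by (intro less_mult_imp_div_less) (simp add: mult.commute)
          then show ?thesis using M by (intro that[of "y div M" "y mod M"]) (auto simp: less_imp_le)
        qed
        obtain v where v: "v \<le> S" "q v = b" using wmap_onto[OF q bo(2)] by blast
        obtain c where c: "c \<le> K" "p c = fold_pos M b o'"
          using wmap_onto[OF p fold_pos_le[OF bo(3)]] by blast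
        \<comment> \<open>The position is reached in the downward half of block \<open>v\<close>,
          when the change to tooth \<open>q v = b\<close> has certainly taken place.\<close>
        define x where "x = T * v + (T - 1 - c)"
        have "T - 1 - c < T" using T0 by simp
        then have x: "x div T = v" "x mod T = T - 1 - c" by (simp_all add: x_def)
        have gt: "K < T - 1 - c" using c by (simp add: T_def)
        then have "f x = c" using x c by (simp add: f_def T_def)
        moreover have "s x = b" using gt x v d(1)[of v] by (simp add: s_def)
        ultimately have "r x = y" using bo c by (simp add: r_def fold_pos_fold_pos)
        moreover have "x < T * Suc v" using T0 by (simp add: x_def)
        then have "x < T * Suc S" using v(1) by (meson Suc_le_mono less_le_trans mult_le_mono2)
        ultimately show ?thesis using l by blast
      qed
      show "\<bar>int (r (Suc x)) - int (r x)\<bar> \<le> 1" if xl: "x < l" for x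
      proof -
        consider (same) "s (Suc x) = s x"
          | (switch) "s x = q (x div T - 1)" "s (Suc x) = q (x div T)" "x mod T = d (x div T)"
        proof (cases "Suc (x mod T) = T")
          case True
          then have "Suc x mod T = 0" "Suc x div T = Suc (x div T)" by (simp_all add: mod_Suc div_Suc)
          moreover have "\<not> x mod T \<le> d (x div T)" using True d(1)[of "x div T"] by (simp add: T_def)
          ultimately show ?thesis by (intro that(1)) (simp add: s_def)
        next
          case False
          then have "Suc x mod T = Suc (x mod T)" "Suc x div T = x div T" by (simp_all add: mod_Suc div_Suc)
          note nxt = this
          show ?thesis
          proof (cases "x mod T = d (x div T)")
            case True
            then show ?thesis using nxt by (intro that(2)) (simp_all add: s_def)
          next
            case False
            then show ?thesis using nxt by (intro that(1)) (simp add: s_def)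
          qed
        qed
        then show ?thesis
        proof cases
          case same
          then show ?thesis using step[OF xl, of "s x"] by (simp only: r_def)
        next
          case switch
          \<comment> \<open>At the moment of change \<open>r x\<close> is rewritten as a position in
            the new tooth; after that the move takes place within one tooth.\<close>
          have "f x = d (x div T)" using switch(3) d(1)[of "x div T"] by (simp add: f_def)
          then have "r x = M * s (Suc x) + fold_pos M (s (Suc x)) (p (f x))"
            unfolding r_def using fold_pos_switch[of "s x" "s (Suc x)"] q1[OF gS[of x]] xl switch d(2)
            by (simp add: h_def)
          then show ?thesis using step[OF xl, of "s (Suc x)"] by (simp only: r_def)
        qed
      qed
    qed
    moreover have "zigzag M (r x) = p (f x)" for x
      unfolding r_def by (rule zigzag_fold_pos[OF M pM])
    \<comment> \<open>One unit of the error is the delay in following \<open>q\<close>, the other is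
      the rounding of a joint to the later tooth.\<close>
    moreover have "\<bar>int (r x div M) - int (q (x div T))\<bar> \<le> 2" if "x \<le> l" for x
    proof -
      have "M * s x \<le> r x" "r x \<le> M * Suc (s x)" using fold_pos_le[OF pM, of "s x" x] by (auto simp: r_def)
      then have "s x \<le> r x div M" "r x div M \<le> Suc (s x)"
        using M div_le_mono[of "M * s x" "r x" M] div_le_mono[of "r x" "M * Suc (s x)" M] by simp_all
      then show ?thesis using sq[OF that] by linarith
    qed
    ultimately show ?thesis by blast
  qed
  with f g wmap_zigzag[OF M, of N] show thesis by (rule that)
qed


section \<open>Coordinates on linear graphs\<close>

definition len :: "'a rgraph \<Rightarrow> nat" where
  "len A = card (verts A) - 1"

text \<open>Such an isomorphism is unique only up to reversal; choosing one fixes the coordinate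
  \<open>crd\<close> in which all errors are measured.\<close>

definition vtx :: "'a rgraph \<Rightarrow> nat \<Rightarrow> 'a" where
  "vtx A = (SOME h. graph_iso (std_linear_graph (len A)) A h)"

definition crd :: "'a rgraph \<Rightarrow> 'a \<Rightarrow> nat" where
  "crd A = inv_into {..len A} (vtx A)"

lemma linear_graph_vtx:
  assumes "linear_graph A"
  shows "graph_iso (std_linear_graph (len A)) A (vtx A)"
proof -
  obtain n h where h: "graph_iso (std_linear_graph n) A h"
    using assms by (auto simp: linear_graph_def)
  then have "card {0..n} = card (verts A)"
    by (intro bij_betw_same_card[of h]) (simp add: graph_iso_def std_linear_graph_def)
  then have "len A = n" by (simp add: len_def)
  then show ?thesis unfolding vtx_def using h by (metis someI)
qed

lemma bij_betw_vtx: "linear_graph A \<Longrightarrow> bij_betw (vtx A) {..len A} (verts A)"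
  using linear_graph_vtx[of A] by (simp add: graph_iso_def std_linear_graph_def atLeast0AtMost)

lemma vtx_in:
  assumes "linear_graph A" "i \<le> len A"
  shows "vtx A i \<in> verts A"
  using bspec[OF bij_betwE[OF bij_betw_vtx[OF assms(1)]], of i] assms(2) by simp

lemma crd_le:
  assumes "linear_graph A" "a \<in> verts A"
  shows "crd A a \<le> len A"
  using bspec[OF bij_betwE[OF bij_betw_inv_into[OF bij_betw_vtx[OF assms(1)]]] assms(2)]
  by (simp add: crd_def)

lemma vtx_crd [simp]: "linear_graph A \<Longrightarrow> a \<in> verts A \<Longrightarrow> vtx A (crd A a) = a"
  unfolding crd_def by (rule bij_betw_inv_into_right[OF bij_betw_vtx])

lemma crd_vtx [simp]: "linear_graph A \<Longrightarrow> i \<le> len A \<Longrightarrow> crd A (vtx A i) = i"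
  unfolding crd_def by (rule bij_betw_inv_into_left[OF bij_betw_vtx]) auto

lemma finite_verts: "linear_graph A \<Longrightarrow> finite (verts A)"
  using bij_betw_finite[OF bij_betw_vtx, of A] by simp

lemma adj_iff:
  assumes "linear_graph A"
  shows "(a, b) \<in> adj A \<longleftrightarrow> a \<in> verts A \<and> b \<in> verts A \<and> \<bar>int (crd A a) - int (crd A b)\<bar> \<le> 1"
proof (cases "a \<in> verts A \<and> b \<in> verts A")
  case True
  let ?S = "std_linear_graph (len A)"
  have "crd A a \<in> verts ?S" "crd A b \<in> verts ?S"
    using True crd_le[OF assms] by (auto simp: std_linear_graph_def)
  then have "(crd A a, crd A b) \<in> adj ?S \<longleftrightarrow> (vtx A (crd A a), vtx A (crd A b)) \<in> adj A"
    using linear_graph_vtx[OF assms] unfolding graph_iso_def by blast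
  then show ?thesis using True assms crd_le[OF assms] by (simp add: std_linear_graph_def)
next
  case False
  then show ?thesis using assms by (auto simp: linear_graph_def)
qed

lemma adj_refl: "linear_graph A \<Longrightarrow> a \<in> verts A \<Longrightarrow> (a, a) \<in> adj A"
  by (simp add: adj_iff)

lemma adj_sym: "linear_graph A \<Longrightarrow> (a, b) \<in> adj A \<Longrightarrow> (b, a) \<in> adj A"
  by (auto simp: adj_iff)

lemma linear_std: "linear_graph (std_linear_graph n)"
proof -
  have "graph_iso (std_linear_graph n) (std_linear_graph n) id"
    by (simp add: graph_iso_def)
  then show ?thesis unfolding linear_graph_def by (auto simp: std_linear_graph_def)
qed

lemma len_std [simp]: "len (std_linear_graph n) = n"
  by (simp add: len_def std_linear_graph_def)

section \<open>Epimorphisms as surjective walks\<close>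

text \<open>Through \<open>mk_Epi\<close> and \<open>Epi_mk\<close> the epimorphisms between linear
  graphs become exactly the surjective walks in coordinates.\<close>

definition mk :: "'a rgraph \<Rightarrow> 'b rgraph \<Rightarrow> (nat \<Rightarrow> nat) \<Rightarrow> 'a \<Rightarrow> 'b" where
  "mk A B w = (\<lambda>a\<in>verts A. vtx B (w (crd A a)))"

lemma mk_apply: "a \<in> verts A \<Longrightarrow> mk A B w a = vtx B (w (crd A a))"
  by (simp add: mk_def)

text \<open>Without such a step the walk would remain on one side of the gap between
  \<open>j\<close> and \<open>Suc j\<close>, against surjectivity. Thus surjectivity on vertices
  already gives surjectivity on edges.\<close>

lemma wmap_crossing:
  assumes "wmap m n w" "j < n"
  shows "\<exists>i<m. {w i, w (Suc i)} = {j, Suc j}"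
proof (rule ccontr)
  assume no: "\<not> ?thesis"
  have st: "w i \<le> j \<longleftrightarrow> w (Suc i) \<le> j" if "i < m" for i
  proof -
    have "\<bar>int (w (Suc i)) - int (w i)\<bar> \<le> 1" using assms(1) that by (simp add: wmap_def)
    moreover have "{w i, w (Suc i)} \<noteq> {j, Suc j}" using no that by simp
    then have "\<not> (w i = j \<and> w (Suc i) = Suc j)" "\<not> (w i = Suc j \<and> w (Suc i) = j)" by auto
    ultimately show ?thesis by linarith
  qed
  have all: "w i \<le> j \<longleftrightarrow> w 0 \<le> j" if "i \<le> m" for i using that
    by (induction i) (use st in auto)
  obtain a b where ab: "a \<le> m" "w a = j" "b \<le> m" "w b = Suc j"
    using wmap_onto[OF assms(1), of j] wmap_onto[OF assms(1), of "Suc j"] assms(2) by auto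
  show False using all[OF ab(1)] all[OF ab(3)] ab by simp
qed

lemma mk_Epi:
  assumes A: "linear_graph A" and B: "linear_graph B" and w: "wmap (len A) (len B) w"
  shows "mk A B w \<in> Epi A B"
  unfolding Epi_def
proof (intro CollectI conjI)
  have wl: "w (crd A a) \<le> len B" if "a \<in> verts A" for a
    using wmap_le[OF w crd_le[OF A that]] .
  show "mk A B w \<in> verts A \<rightarrow>\<^sub>E verts B"
    using wl vtx_in[OF B] by (auto simp: mk_def)
  show "\<forall>(a, b)\<in>adj A. (mk A B w a, mk A B w b) \<in> adj B"
  proof clarify
    fix a b assume "(a, b) \<in> adj A"
    then have ab: "a \<in> verts A" "b \<in> verts A" "\<bar>int (crd A a) - int (crd A b)\<bar> \<le> 1"
      using adj_iff[OF A] by auto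
    moreover have "\<bar>int (w (crd A a)) - int (w (crd A b))\<bar> \<le> \<bar>int (crd A a) - int (crd A b)\<bar>"
      by (rule wmap_dist[OF w]) (use ab crd_le[OF A] in auto)
    ultimately show "(mk A B w a, mk A B w b) \<in> adj B"
      using wl by (simp add: mk_apply adj_iff[OF B] vtx_in[OF B] B)
  qed
  show "\<forall>(c, d)\<in>adj B. \<exists>(a, b)\<in>adj A. mk A B w a = c \<and> mk A B w b = d"
  proof clarify
    fix c d assume "(c, d) \<in> adj B"
    then have cd: "c \<in> verts B" "d \<in> verts B" "\<bar>int (crd B c) - int (crd B d)\<bar> \<le> 1"
      using adj_iff[OF B] by auto
    have "\<exists>i j. i \<le> len A \<and> j \<le> len A \<and> \<bar>int i - int j\<bar> \<le> 1 \<and> w i = crd B c \<and> w j = crd B d"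
    proof -
      consider "crd B c = crd B d" | x where "Suc x \<le> len B" "{crd B c, crd B d} = {x, Suc x}"
      proof -
        consider "crd B c = crd B d" | "crd B d = Suc (crd B c)" | "crd B c = Suc (crd B d)"
          using cd(3) by linarith
        then show thesis
          by cases (use that crd_le[OF B cd(1)] crd_le[OF B cd(2)] in auto)
      qed
      then show ?thesis
      proof cases
        case 1
        then show ?thesis using wmap_onto[OF w crd_le[OF B cd(1)]] by force
      next
        case (2 x)
        then obtain i where i: "i < len A" "{w i, w (Suc i)} = {crd B c, crd B d}"
          using wmap_crossing[OF w, of x] by auto
        then consider "w i = crd B c" "w (Suc i) = crd B d" | "w (Suc i) = crd B c" "w i = crd B d"
          by (auto simp: doubleton_eq_iff)
        then show ?thesis
        proof cases
          case 1
          then show ?thesis using i by (intro exI[of _ i] exI[of _ "Suc i"]) simp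
        next
          case 2
          then show ?thesis using i by (intro exI[of _ "Suc i"] exI[of _ i]) simp
        qed
      qed
    qed
    then obtain i j where ij: "i \<le> len A" "j \<le> len A" "\<bar>int i - int j\<bar> \<le> 1"
      "w i = crd B c" "w j = crd B d" by blast
    have "(vtx A i, vtx A j) \<in> adj A" using ij by (simp add: adj_iff[OF A] vtx_in[OF A] A)
    moreover have "mk A B w (vtx A i) = c" "mk A B w (vtx A j) = d"
      using ij cd by (simp_all add: mk_apply vtx_in[OF A] A B)
    ultimately show "\<exists>(a, b)\<in>adj A. mk A B w a = c \<and> mk A B w b = d" by blast
  qed
qed

lemma Epi_funcset: "f \<in> Epi A B \<Longrightarrow> f \<in> verts A \<rightarrow>\<^sub>E verts B"
  by (simp add: Epi_def)

lemma Epi_mem: "f \<in> Epi A B \<Longrightarrow> a \<in> verts A \<Longrightarrow> f a \<in> verts B"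
  by (rule PiE_mem[OF Epi_funcset])

lemma Epi_ext: "f \<in> Epi A B \<Longrightarrow> f \<in> extensional (verts A)"
  using Epi_funcset[of f A B] by (simp add: PiE_iff)

lemma Epi_adj:
  assumes "f \<in> Epi A B" "(a, b) \<in> adj A"
  shows "(f a, f b) \<in> adj B"
proof -
  have "\<forall>x\<in>adj A. case x of (a, b) \<Rightarrow> (f a, f b) \<in> adj B"
    using assms(1) unfolding Epi_def by (elim CollectE conjE)
  from bspec[OF this assms(2)] show ?thesis by simp
qed

lemma Epi_edge:
  assumes "f \<in> Epi A B" "(c, d) \<in> adj B"
  obtains a b where "(a, b) \<in> adj A" "f a = c" "f b = d"
proof -
  have "\<forall>x\<in>adj B. case x of (c, d) \<Rightarrow> \<exists>(a, b)\<in>adj A. f a = c \<and> f b = d"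
    using assms(1) unfolding Epi_def by (elim CollectE conjE)
  from bspec[OF this assms(2)] show thesis using that by auto
qed

lemma Epi_onto:
  assumes "linear_graph A" "linear_graph B" "f \<in> Epi A B" "b \<in> verts B"
  shows "\<exists>a\<in>verts A. f a = b"
proof -
  obtain a a' where "(a, a') \<in> adj A" "f a = b"
    by (rule Epi_edge[OF assms(3) adj_refl[OF assms(2,4)]])
  then show ?thesis using adj_iff[OF assms(1), of a a'] by blast
qed

lemma Epi_mk:
  assumes A: "linear_graph A" and B: "linear_graph B" and f: "f \<in> Epi A B"
  obtains w where "wmap (len A) (len B) w" "f = mk A B w"
proof (rule that)
  let ?w = "\<lambda>i. crd B (f (vtx A i))"
  show "wmap (len A) (len B) ?w"
  proof (rule wmapI)
    show "?w i \<le> len B" if "i \<le> len A" for i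
      using crd_le[OF B Epi_mem[OF f vtx_in[OF A that]]] .
    show "\<exists>i\<le>len A. ?w i = j" if j: "j \<le> len B" for j
    proof -
      obtain a where "a \<in> verts A" "f a = vtx B j"
        using Epi_onto[OF A B f vtx_in[OF B j]] by blast
      then show ?thesis using crd_le[OF A] A B j by (intro exI[of _ "crd A a"]) simp
    qed
    show "\<bar>int (?w (Suc i)) - int (?w i)\<bar> \<le> 1" if "i < len A" for i
    proof -
      have "(vtx A (Suc i), vtx A i) \<in> adj A" using that by (simp add: adj_iff[OF A] vtx_in[OF A] A)
      then show ?thesis using Epi_adj[OF f] adj_iff[OF B] by blast
    qed
  qed
  show "f = mk A B ?w"
    by (rule extensionalityI[of _ "verts A"]) (use Epi_ext[OF f] Epi_mem[OF f] A B in \<open>auto simp: mk_def\<close>)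
qed

lemma Epi_compose:
  assumes f: "f \<in> Epi A B" and g: "g \<in> Epi B C" and A: "adj A \<subseteq> verts A \<times> verts A"
  shows "compose (verts A) g f \<in> Epi A C"
  unfolding Epi_def
proof (intro CollectI conjI)
  show "compose (verts A) g f \<in> verts A \<rightarrow>\<^sub>E verts C"
    using Epi_mem[OF f] Epi_mem[OF g] by (auto simp: compose_def)
  show "\<forall>(a, b)\<in>adj A. (compose (verts A) g f a, compose (verts A) g f b) \<in> adj C"
    using A Epi_adj[OF g Epi_adj[OF f]] by (auto simp: compose_def)
  show "\<forall>(c, d)\<in>adj C. \<exists>(a, b)\<in>adj A. compose (verts A) g f a = c \<and> compose (verts A) g f b = d"
  proof clarify
    fix c d assume "(c, d) \<in> adj C"
    then obtain x y where "(x, y) \<in> adj B" "g x = c" "g y = d" by (rule Epi_edge[OF g])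
    obtain a b where "(a, b) \<in> adj A" "f a = x" "f b = y" by (rule Epi_edge[OF f \<open>(x, y) \<in> adj B\<close>])
    then show "\<exists>(a, b)\<in>adj A. compose (verts A) g f a = c \<and> compose (verts A) g f b = d"
      using A \<open>g x = c\<close> \<open>g y = d\<close> by (intro bexI[of _ "(a, b)"]) (auto simp: compose_def)
  qed
qed

lemma Epi_id:
  assumes "adj B \<subseteq> verts B \<times> verts B"
  shows "(\<lambda>x\<in>verts B. x) \<in> Epi B B"
proof -
  have *: "a \<in> verts B \<and> b \<in> verts B" if "(a, b) \<in> adj B" for a b using assms that by blast
  show ?thesis unfolding Epi_def
  proof (intro CollectI conjI)
    show "(\<lambda>x\<in>verts B. x) \<in> verts B \<rightarrow>\<^sub>E verts B" by simp
    show "\<forall>(a, b)\<in>adj B. ((\<lambda>x\<in>verts B. x) a, (\<lambda>x\<in>verts B. x) b) \<in> adj B"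
      by clarify (use * in simp)
    show "\<forall>(c, d)\<in>adj B. \<exists>(a, b)\<in>adj B. (\<lambda>x\<in>verts B. x) a = c \<and> (\<lambda>x\<in>verts B. x) b = d"
    proof clarify
      fix c d assume "(c, d) \<in> adj B"
      then show "\<exists>(a, b)\<in>adj B. (\<lambda>x\<in>verts B. x) a = c \<and> (\<lambda>x\<in>verts B. x) b = d"
        using * by (intro bexI[of _ "(c, d)"]) simp_all
    qed
  qed
qed

section \<open>Amalgamation, lifting and selection for linear graphs\<close>

lemma Epi_amalgam:
  assumes B: "linear_graph B" and C: "linear_graph C" and D: "linear_graph D"
    and f: "f \<in> Epi B D" and g: "g \<in> Epi C D"
  obtains E :: "nat rgraph" and u v where "linear_graph E" "u \<in> Epi E B" "v \<in> Epi E C"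
    "\<And>x. x \<in> verts E \<Longrightarrow> f (u x) = g (v x)"
proof -
  obtain w1 where w1: "wmap (len B) (len D) w1" "f = mk B D w1" by (rule Epi_mk[OF B D f])
  obtain w2 where w2: "wmap (len C) (len D) w2" "g = mk C D w2" by (rule Epi_mk[OF C D g])
  obtain l s t where st: "wmap l (len B) s" "wmap l (len C) t" "\<And>i. i \<le> l \<Longrightarrow> w1 (s i) = w2 (t i)"
    by (rule wmap_amalgam[OF w1(1) w2(1)]) blast
  let ?E = "std_linear_graph l"
  have E: "linear_graph ?E" by (rule linear_std)
  show thesis
  proof (rule that[OF E])
    show "mk ?E B s \<in> Epi ?E B" "mk ?E C t \<in> Epi ?E C" using st by (auto intro!: mk_Epi E B C)
    fix x assume x: "x \<in> verts ?E"
    then have "crd ?E x \<le> l" using crd_le[OF E] by fastforce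
    then show "f (mk ?E B s x) = g (mk ?E C t x)"
      using x st wmap_le[OF st(1)] wmap_le[OF st(2)]
      by (simp add: w1(2) w2(2) mk_apply vtx_in B C)
  qed
qed

text \<open>The graphs and the maps \<open>f\<close>, \<open>g\<close>, \<open>e\<close> precede
  \<open>p\<close> and \<open>q\<close>, so that a whole tuple lifts through the same path. The
  function \<open>c\<close> is the number of the tooth; it stands in for a coordinate on
  \<open>A'\<close>. Positive length of \<open>A\<close> keeps the teeth nondegenerate.\<close>

lemma Epi_lift:
  assumes D: "linear_graph D" and E: "linear_graph E" and A: "linear_graph A" and A': "linear_graph A'"
    and M: "0 < len A"
  obtains E' A'' :: "nat rgraph" and f g e and c :: "nat \<Rightarrow> int"
  where "linear_graph E'" "linear_graph A''" "f \<in> Epi E' D" "g \<in> Epi E' E" "e \<in> Epi A'' A"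
    "\<And>p q. p \<in> Epi D A \<Longrightarrow> q \<in> Epi E A' \<Longrightarrow> \<exists>r\<in>Epi E' A''. \<forall>x\<in>verts E'.
      e (r x) = p (f x) \<and> \<bar>c (r x) - int (crd A' (q (g x)))\<bar> \<le> 2"
proof -
  obtain l L f g e where w: "wmap l (len D) f" "wmap l (len E) g" "wmap L (len A) e"
    and lift: "\<And>p q. wmap (len D) (len A) p \<Longrightarrow> wmap (len E) (len A') q \<Longrightarrow>
      \<exists>r. wmap l L r \<and> (\<forall>x\<le>l. e (r x) = p (f x) \<and> \<bar>int (r x div len A) - int (q (g x))\<bar> \<le> 2)"
    by (rule wmap_lift[OF M, of "len D" "len E" "len A'"]) blast
  let ?E' = "std_linear_graph l" and ?A'' = "std_linear_graph L"
  have L: "linear_graph ?E'" "linear_graph ?A''" by (rule linear_std)+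
  show thesis
  proof (rule that[OF L])
    show "mk ?E' D f \<in> Epi ?E' D" "mk ?E' E g \<in> Epi ?E' E" "mk ?A'' A e \<in> Epi ?A'' A"
      using w by (auto intro!: mk_Epi L D E A)
    fix p q assume p: "p \<in> Epi D A" and q: "q \<in> Epi E A'"
    obtain p' where p': "wmap (len D) (len A) p'" "p = mk D A p'" by (rule Epi_mk[OF D A p])
    obtain q' where q': "wmap (len E) (len A') q'" "q = mk E A' q'" by (rule Epi_mk[OF E A' q])
    obtain r where r: "wmap l L r" "\<And>x. x \<le> l \<Longrightarrow> e (r x) = p' (f x)"
      "\<And>x. x \<le> l \<Longrightarrow> \<bar>int (r x div len A) - int (q' (g x))\<bar> \<le> 2" using lift[OF p'(1) q'(1)] by blast
    show "\<exists>r\<in>Epi ?E' ?A''. \<forall>x\<in>verts ?E'. mk ?A'' A e (r x) = p (mk ?E' D f x) \<and>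
        \<bar>(\<lambda>y. int (crd ?A'' y div len A)) (r x) - int (crd A' (q (mk ?E' E g x)))\<bar> \<le> 2"
    proof (intro bexI ballI)
      show "mk ?E' ?A'' r \<in> Epi ?E' ?A''" using r by (auto intro!: mk_Epi L)
      fix x assume x: "x \<in> verts ?E'"
      then have cl: "crd ?E' x \<le> l" using crd_le[OF L(1)] by fastforce
      have le: "f (crd ?E' x) \<le> len D" "g (crd ?E' x) \<le> len E" "r (crd ?E' x) \<le> L"
        "q' (g (crd ?E' x)) \<le> len A'"
        using wmap_le[OF w(1) cl] wmap_le[OF w(2) cl] wmap_le[OF r(1) cl] wmap_le[OF q'(1)] by auto
      show "mk ?A'' A e (mk ?E' ?A'' r x) = p (mk ?E' D f x) \<and>
        \<bar>(\<lambda>y. int (crd ?A'' y div len A)) (mk ?E' ?A'' r x) - int (crd A' (q (mk ?E' E g x)))\<bar> \<le> 2"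
        using x le r(2,3)[OF cl] by (simp add: p'(2) q'(2) mk_apply vtx_in L D E A A')
    qed
  qed
qed

text \<open>Each vertex of \<open>A\<close> is repeated \<open>Suc K\<close> times, so a
  displacement by at most \<open>K\<close> leads at most to the next vertex.\<close>

lemma Epi_thin:
  fixes A :: "'a rgraph"
  assumes A: "linear_graph A"
  obtains B :: "nat rgraph" and f where "linear_graph B" "f \<in> Epi B A"
    "\<And>x y. x \<in> verts B \<Longrightarrow> y \<in> verts B \<Longrightarrow> \<bar>int (crd B x) - int (crd B y)\<bar> \<le> int K \<Longrightarrow> (f x, f y) \<in> adj A"
proof -
  let ?n = "len A"
  define l where "l = Suc K * Suc ?n - 1"
  let ?w = "\<lambda>x. x div Suc K"
  have l: "x \<le> l \<longleftrightarrow> x < Suc K * Suc ?n" for x by (auto simp: l_def)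
  have wl: "?w x \<le> ?n" if "x \<le> l" for x
    using that less_mult_imp_div_less[of x "Suc ?n" "Suc K"] by (simp only: l mult.commute) simp
  have w: "wmap l ?n ?w"
  proof (rule wmapI)
    show "?w x \<le> ?n" if "x \<le> l" for x using that by (rule wl)
    show "\<exists>x\<le>l. ?w x = j" if "j \<le> ?n" for j
    proof -
      have "Suc K * j < Suc K * Suc ?n" using that by (simp only: mult_less_cancel1) simp
      moreover have "Suc K * j div Suc K = j" by (rule nonzero_mult_div_cancel_left) simp
      ultimately show ?thesis using l by blast
    qed
    show "\<bar>int (?w (Suc x)) - int (?w x)\<bar> \<le> 1" for x by (simp add: div_Suc)
  qed
  have near: "\<bar>int (?w x) - int (?w y)\<bar> \<le> 1" if "\<bar>int x - int y\<bar> \<le> int K" for x y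
  proof -
    have *: "?w a \<le> ?w b \<and> ?w b \<le> Suc (?w a)" if "a \<le> b" "b \<le> a + K" for a b
    proof -
      have "?w b \<le> (a + Suc K) div Suc K" using that by (intro div_le_mono) simp
      also have "(a + Suc K) div Suc K = Suc (?w a)" by (simp only: div_add_self2)
      finally show ?thesis using that(1) by (simp add: div_le_mono)
    qed
    show ?thesis
    proof (cases "x \<le> y")
      case True
      then show ?thesis using *[of x y] that by simp
    next
      case False
      then show ?thesis using *[of y x] that by simp
    qed
  qed
  let ?B = "std_linear_graph l"
  have B: "linear_graph ?B" by (rule linear_std)
  show thesis
  proof (rule that[OF B])
    show "mk ?B A ?w \<in> Epi ?B A" using w by (auto intro!: mk_Epi B A)
    fix x y assume x: "x \<in> verts ?B" "y \<in> verts ?B" and d: "\<bar>int (crd ?B x) - int (crd ?B y)\<bar> \<le> int K"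
    have "?w (crd ?B x) \<le> ?n" "?w (crd ?B y) \<le> ?n" using crd_le[OF B] x by (auto intro!: wl)
    then show "(mk ?B A ?w x, mk ?B A ?w y) \<in> adj A"
      using near[OF d] x by (simp add: mk_apply adj_iff[OF A] vtx_in A)
  qed
qed

text \<open>A multivalued map with pairwise adjacent values on adjacent vertices is resolved by staying
  at each vertex for three steps, at the second of which the larger value is taken.\<close>

lemma Epi_select:
  assumes A: "linear_graph A" and B: "linear_graph B"
    and S: "\<And>a. a \<in> verts A \<Longrightarrow> S a \<noteq> {} \<and> S a \<subseteq> verts B"
    and near: "\<And>a a' b b'. (a, a') \<in> adj A \<Longrightarrow> b \<in> S a \<Longrightarrow> b' \<in> S a' \<Longrightarrow> (b, b') \<in> adj B"
    and onto: "\<And>b. b \<in> verts B \<Longrightarrow> \<exists>a\<in>verts A. b \<in> S a"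
  obtains C :: "nat rgraph" and f q where "linear_graph C" "f \<in> Epi C A" "q \<in> Epi C B"
    "\<And>x. x \<in> verts C \<Longrightarrow> q x \<in> S (f x)"
proof -
  let ?m = "len A" and ?n = "len B"
  define l where "l = 3 * ?m + 2"
  define V where "V i = crd B ` S (vtx A i)" for i
  define w where "w x = (if x mod 3 = 1 then Max (V (x div 3)) else Min (V (x div 3)))" for x
  have f: "wmap l ?m (\<lambda>x. x div 3)"
  proof (rule wmapI)
    show "x div 3 \<le> ?m" if "x \<le> l" for x using that by (auto simp: l_def)
    show "\<exists>x\<le>l. x div 3 = j" if "j \<le> ?m" for j
      using that by (intro exI[of _ "3 * j"]) (auto simp: l_def)
  qed (simp add: div_Suc)
  have V: "finite (V i)" "V i \<noteq> {}" "V i \<subseteq> {..?n}" if "i \<le> ?m" for i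
  proof -
    have "S (vtx A i) \<noteq> {}" "S (vtx A i) \<subseteq> verts B" using S[OF vtx_in[OF A that]] by auto
    then show "finite (V i)" "V i \<noteq> {}" "V i \<subseteq> {..?n}"
      using finite_verts[OF B] crd_le[OF B] by (auto simp: V_def intro: finite_subset)
  qed
  have Vn: "\<bar>int b - int b'\<bar> \<le> 1"
    if "i \<le> ?m" "j \<le> ?m" "\<bar>int i - int j\<bar> \<le> 1" "b \<in> V i" "b' \<in> V j" for i j b b'
  proof -
    have "(vtx A i, vtx A j) \<in> adj A" using that by (simp add: adj_iff[OF A] vtx_in A)
    then show ?thesis using near that(4,5) adj_iff[OF B] by (fastforce simp: V_def)
  qed
  have wV: "w x \<in> V (x div 3)" if "x \<le> l" for x
    using V[OF wmap_le[OF f that]] by (simp add: w_def)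
  have w: "wmap l ?n w"
  proof (rule wmapI)
    show "w x \<le> ?n" if "x \<le> l" for x using wV[OF that] V(3)[OF wmap_le[OF f that]] by auto
    show "\<bar>int (w (Suc x)) - int (w x)\<bar> \<le> 1" if "x < l" for x
      by (rule Vn[OF _ _ _ wV wV]) (use that f wmap_le[OF f] in \<open>auto simp: wmap_def\<close>)
    show "\<exists>x\<le>l. w x = j" if j: "j \<le> ?n" for j
    proof -
      obtain a where a: "a \<in> verts A" "vtx B j \<in> S a" using onto[OF vtx_in[OF B j]] by blast
      let ?i = "crd A a"
      have i: "?i \<le> ?m" using crd_le[OF A a(1)] .
      have jV: "j \<in> V ?i" unfolding V_def using a j A B by (simp add: image_iff) (metis crd_vtx)
      note mem = Min_in[OF V(1,2)[OF i]] Max_in[OF V(1,2)[OF i]]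
      \<comment> \<open>The loop at a vertex makes the values over it pairwise adjacent, so the
        minimum and the maximum are the only ones, and visiting both makes the selection
        surjective.\<close>
      have "\<bar>int (Max (V ?i)) - int (Min (V ?i))\<bar> \<le> 1"
        by (rule Vn[OF i i _ mem(2,1)]) simp
      moreover have "Min (V ?i) \<le> j" "j \<le> Max (V ?i)" using jV V(1)[OF i] by auto
      ultimately consider "j = Min (V ?i)" | "j = Max (V ?i)" by linarith
      then show ?thesis
      proof cases
        case 1
        then show ?thesis using i by (intro exI[of _ "3 * ?i"]) (auto simp: w_def l_def)
      next
        case 2
        have "(3 * ?i + 1) mod 3 = 1" "(3 * ?i + 1) div 3 = ?i" by presburger+
        then show ?thesis using i 2 by (intro exI[of _ "3 * ?i + 1"]) (auto simp: w_def l_def)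
      qed
    qed
  qed
  let ?C = "std_linear_graph l"
  have C: "linear_graph ?C" by (rule linear_std)
  show thesis
  proof (rule that[OF C])
    show "mk ?C A (\<lambda>x. x div 3) \<in> Epi ?C A" "mk ?C B w \<in> Epi ?C B"
      using f w by (auto intro!: mk_Epi C A B)
    fix x assume x: "x \<in> verts ?C"
    then have cl: "crd ?C x \<le> l" using crd_le[OF C] by fastforce
    then obtain b where b: "b \<in> S (vtx A (crd ?C x div 3))" "w (crd ?C x) = crd B b"
      using wV[OF cl] by (auto simp: V_def)
    moreover have "b \<in> verts B" using b S[OF vtx_in[OF A wmap_le[OF f cl]]] by auto
    ultimately show "mk ?C B w x \<in> S (mk ?C A (\<lambda>x. x div 3) x)" using x B by (simp add: mk_apply)
  qed
qed


section \<open>The projective limit of a generic sequence\<close>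

locale generic_seq =
  fixes A :: "nat \<Rightarrow> nat rgraph" and p :: "nat \<Rightarrow> nat \<Rightarrow> nat"
  assumes generic: "generic_sequence A p"
begin

abbreviation "P \<equiv> proj_lim A p"
abbreviation "X \<equiv> lim_topology A p"

lemma lin: "linear_graph (A n)"
  using generic by (simp add: generic_sequence_def)

lemma p_Epi: "p n \<in> Epi (A (Suc n)) (A n)"
  using generic by (simp add: generic_sequence_def)

lemma cofinal: "linear_graph (B :: nat rgraph) \<Longrightarrow> \<exists>m f. f \<in> Epi (A m) B"
  using generic unfolding generic_sequence_def by blast

lemma adj_sub: "adj (A n) \<subseteq> verts (A n) \<times> verts (A n)"
  using lin[of n] by (simp add: linear_graph_def)

lemma lim_verts: "x \<in> P \<Longrightarrow> x n \<in> verts (A n)"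
  by (simp add: proj_lim_def)

lemma lim_p: "x \<in> P \<Longrightarrow> p n (x (Suc n)) = x n"
  by (simp add: proj_lim_def)

lemma bond_Epi: "bond A p m k \<in> Epi (A (m + k)) (A m)"
proof (induction k)
  case 0
  show ?case using Epi_id[OF adj_sub, of m] by (simp only: bond.simps add_0_right)
next
  case (Suc k)
  have "p (m + k) \<in> Epi (A (m + Suc k)) (A (m + k))" using p_Epi[of "m + k"] by simp
  from Epi_compose[OF this Suc adj_sub] show ?case by simp
qed

lemma bond_lim: "x \<in> P \<Longrightarrow> bond A p m k (x (m + k)) = x m"
proof (induction k)
  case (Suc k)
  then show ?case using lim_verts[of x "m + Suc k"] lim_p[of x "m + k"] by (simp add: compose_def)
qed (simp add: lim_verts)

text \<open>The recursion for \<open>bond\<close> peels off the map from the highest level; the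
  downward part of \<open>proj_onto\<close> needs to peel off the lowest one.\<close>

lemma bond_left:
  "v \<in> verts (A (m + Suc k)) \<Longrightarrow> bond A p m (Suc k) v = p m (bond A p (Suc m) k v)"
proof (induction k arbitrary: v)
  case 0
  then have "p m v \<in> verts (A m)" using Epi_mem[OF p_Epi[of m], of v] by simp
  then show ?case using 0 by (simp add: compose_def)
next
  case (Suc k)
  have m: "p (m + Suc k) v \<in> verts (A (m + Suc k))"
    using Epi_mem[OF p_Epi[of "m + Suc k"], of v] Suc.prems by simp
  have "bond A p m (Suc (Suc k)) v = bond A p m (Suc k) (p (m + Suc k) v)"
    using Suc.prems by (simp only: bond.simps(2)[of A p m "Suc k"] compose_def restrict_apply')
  also have "\<dots> = p m (bond A p (Suc m) k (p (m + Suc k) v))" using Suc.IH[OF m] .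
  also have "bond A p (Suc m) k (p (m + Suc k) v) = bond A p (Suc m) (Suc k) v"
    using Suc.prems by (simp add: compose_def)
  finally show ?case .
qed

text \<open>Above \<open>n\<close> preimages are chosen successively, since the bonding maps are
  onto; below \<open>n\<close> the coordinates are forced.\<close>

lemma proj_onto:
  assumes a: "a \<in> verts (A n)"
  shows "\<exists>x\<in>P. x n = a"
proof -
  have "\<exists>u. \<forall>k. (u k \<in> verts (A (n + k)) \<and> (k = 0 \<longrightarrow> u k = a)) \<and> p (n + k) (u (Suc k)) = u k"
  proof (rule dependent_nat_choice)
    show "\<exists>x. x \<in> verts (A (n + 0)) \<and> ((0::nat) = 0 \<longrightarrow> x = a)" using a by simp
    fix v k assume "v \<in> verts (A (n + k)) \<and> (k = 0 \<longrightarrow> v = a)"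
    then obtain w where "w \<in> verts (A (Suc (n + k)))" "p (n + k) w = v"
      using Epi_onto[OF lin lin p_Epi] by blast
    then show "\<exists>y. (y \<in> verts (A (n + Suc k)) \<and> (Suc k = 0 \<longrightarrow> y = a)) \<and> p (n + k) y = v" by auto
  qed
  then obtain u where u: "\<And>k. u k \<in> verts (A (n + k))" "u 0 = a" "\<And>k. p (n + k) (u (Suc k)) = u k"
    by blast
  define x where "x i = (if n \<le> i then u (i - n) else bond A p i (n - i) a)" for i
  have "x i \<in> verts (A i)" for i
    using u(1)[of "i - n"] Epi_mem[OF bond_Epi[of i "n - i"], of a] a by (auto simp: x_def)
  moreover have "p i (x (Suc i)) = x i" for i
  proof (cases "n \<le> i")
    case True
    then show ?thesis using u(3)[of "i - n"] by (simp add: x_def Suc_diff_le)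
  next
    case False
    then obtain k where k: "n = i + Suc k" by (metis add_Suc_right less_imp_Suc_add not_le)
    have "x (Suc i) = bond A p (Suc i) k a"
      using k u(2) a by (cases k) (auto simp: x_def)
    moreover have "x i = bond A p i (Suc k) a" using k by (simp add: x_def)
    ultimately show ?thesis using bond_left[of a i k] a k by simp
  qed
  ultimately have "x \<in> P" by (simp add: proj_lim_def)
  moreover have "x n = a" using u(2) by (simp add: x_def)
  ultimately show ?thesis by blast
qed

lemma lim_agree:
  assumes "x \<in> P" "y \<in> P" "x n = y n" "k \<le> n"
  shows "x k = y k"
  using bond_lim[of x k "n - k"] bond_lim[of y k "n - k"] assms by simp

lemma lim_adj:
  assumes "x \<in> P" "y \<in> P" "(x n, y n) \<in> adj (A n)" "k \<le> n"
  shows "(x k, y k) \<in> adj (A k)"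
  using Epi_adj[OF bond_Epi[of k "n - k"], of "x n" "y n"] bond_lim[of x k "n - k"]
    bond_lim[of y k "n - k"] assms by simp

section \<open>The extension property and the limit relation\<close>

lemma Epi_up:
  assumes "f \<in> Epi (A n) B" "n \<le> m"
  shows "\<exists>g\<in>Epi (A m) B. \<forall>x\<in>P. g (x m) = f (x n)"
proof -
  let ?g = "compose (verts (A m)) f (bond A p n (m - n))"
  have b: "bond A p n (m - n) \<in> Epi (A m) (A n)" using bond_Epi[of n "m - n"] assms by simp
  have "?g \<in> Epi (A m) B" by (rule Epi_compose[OF b assms(1) adj_sub])
  moreover have "?g (x m) = f (x n)" if "x \<in> P" for x
    using bond_lim[OF that, of n "m - n"] assms(2) lim_verts[OF that] by (simp add: compose_def)
  ultimately show ?thesis by blast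
qed

lemma Epi_extension:
  assumes "linear_graph (B :: nat rgraph)" "f \<in> Epi B (A n)"
  shows "\<exists>m\<ge>L. \<exists>g\<in>Epi (A m) B. \<forall>x\<in>P. f (g (x m)) = x n"
proof -
  obtain k g where k: "n < k" "g \<in> Epi (A k) B" "compose (verts (A k)) f g = bond A p n (k - n)"
    using generic assms unfolding generic_sequence_def by blast
  have fg: "f (g (x k)) = x n" if "x \<in> P" for x
  proof -
    have "f (g (x k)) = compose (verts (A k)) f g (x k)"
      using lim_verts[OF that] by (simp add: compose_def)
    then show ?thesis using k bond_lim[OF that, of n "k - n"] by simp
  qed
  obtain h where "h \<in> Epi (A (max k L)) B" "\<forall>x\<in>P. h (x (max k L)) = g (x k)"
    using Epi_up[OF k(2), of "max k L"] by auto
  then have "\<exists>g\<in>Epi (A (max k L)) B. \<forall>x\<in>P. f (g (x (max k L))) = x n" using fg by force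
  then show ?thesis by (meson max.cobounded2)
qed

text \<open>Genericity only solves problems over a level. Amalgamating \<open>f\<close> with
  \<open>\<phi>\<close> yields an epimorphism onto \<open>A n\<close>, which reduces an arbitrary
  base \<open>C\<close> to that case.\<close>

lemma Epi_extension_over:
  assumes B: "linear_graph (B :: nat rgraph)" and C: "linear_graph (C :: nat rgraph)"
    and f: "f \<in> Epi B C" and \<phi>: "\<phi> \<in> Epi (A n) C"
  shows "\<exists>m\<ge>L. \<exists>g\<in>Epi (A m) B. \<forall>x\<in>P. f (g (x m)) = \<phi> (x n)"
proof -
  obtain E :: "nat rgraph" and u v where E: "linear_graph E" "u \<in> Epi E B" "v \<in> Epi E (A n)"
    "\<And>x. x \<in> verts E \<Longrightarrow> f (u x) = \<phi> (v x)"
    by (rule Epi_amalgam[OF B lin C f \<phi>]) blast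
  obtain m g where m: "m \<ge> L" "g \<in> Epi (A m) E" "\<forall>x\<in>P. v (g (x m)) = x n"
    using Epi_extension[OF E(1,3)] by blast
  have "f (compose (verts (A m)) u g (x m)) = \<phi> (x n)" if "x \<in> P" for x
    using lim_verts[OF that, of m] E(4)[OF Epi_mem[OF m(2)]] m(3) that by (simp add: compose_def)
  then show ?thesis using m(1) Epi_compose[OF m(2) E(2) adj_sub] by blast
qed

lemma lim_Epi_iff: "\<phi> \<in> lim_Epi A p B \<longleftrightarrow> (\<exists>n. \<exists>f\<in>Epi (A n) B. \<phi> = (\<lambda>x\<in>P. f (x n)))"
  unfolding lim_Epi_def by blast

text \<open>The projections to the levels are themselves limit epimorphisms, and every limit
  epimorphism factors through one of them.\<close>

lemma lim_rel_iff: "(x, y) \<in> lim_rel A p \<longleftrightarrow> x \<in> P \<and> y \<in> P \<and> (\<forall>n. (x n, y n) \<in> adj (A n))"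
proof
  assume r: "(x, y) \<in> lim_rel A p"
  then have xy: "x \<in> P" "y \<in> P" by (auto simp: lim_rel_def)
  have "(x n, y n) \<in> adj (A n)" for n
  proof -
    have "(\<lambda>x\<in>P. bond A p n 0 (x n)) \<in> lim_Epi A p (A n)"
      using bond_Epi[of n 0] unfolding lim_Epi_iff by (metis add_0_right)
    then have "((\<lambda>x\<in>P. bond A p n 0 (x n)) x, (\<lambda>x\<in>P. bond A p n 0 (x n)) y) \<in> adj (A n)"
      using r lin[of n] unfolding lim_rel_def by blast
    then show ?thesis using xy lim_verts by simp
  qed
  then show "x \<in> P \<and> y \<in> P \<and> (\<forall>n. (x n, y n) \<in> adj (A n))" using xy by blast
next
  assume "x \<in> P \<and> y \<in> P \<and> (\<forall>n. (x n, y n) \<in> adj (A n))"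
  then have "(f (x n), f (y n)) \<in> adj B" if "f \<in> Epi (A n) B" for f n and B :: "nat rgraph"
    using Epi_adj[OF that] by blast
  then show "(x, y) \<in> lim_rel A p"
    using \<open>x \<in> P \<and> y \<in> P \<and> _\<close> by (auto simp: lim_rel_def lim_Epi_iff)
qed

text \<open>By genericity some level maps through a path stretched as in \<open>Epi_thin\<close>,
  and epimorphisms do not increase coordinate distances. This is what absorbs bounded
  errors.\<close>

lemma thin_level:
  "\<exists>m\<ge>n. \<forall>x\<in>P. \<forall>y\<in>P. \<bar>int (crd (A m) (x m)) - int (crd (A m) (y m))\<bar> \<le> int K \<longrightarrow>
     (x n, y n) \<in> adj (A n)"
proof -
  obtain B :: "nat rgraph" and f where B: "linear_graph B" "f \<in> Epi B (A n)"
    and f: "\<And>x y. x \<in> verts B \<Longrightarrow> y \<in> verts B \<Longrightarrow>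
      \<bar>int (crd B x) - int (crd B y)\<bar> \<le> int K \<Longrightarrow> (f x, f y) \<in> adj (A n)"
    by (rule Epi_thin[OF lin, of n K]) blast
  obtain m g where m: "m \<ge> n" "g \<in> Epi (A m) B" "\<forall>x\<in>P. f (g (x m)) = x n"
    using Epi_extension[OF B] by blast
  obtain w where w: "wmap (len (A m)) (len B) w" "g = mk (A m) B w" by (rule Epi_mk[OF lin B(1) m(2)])
  have "(x n, y n) \<in> adj (A n)"
    if xy: "x \<in> P" "y \<in> P" "\<bar>int (crd (A m) (x m)) - int (crd (A m) (y m))\<bar> \<le> int K" for x y
  proof -
    have c: "crd (A m) (z m) \<le> len (A m)" if "z \<in> P" for z
      using crd_le[OF lin lim_verts[OF that]] .
    have "crd B (g (z m)) = w (crd (A m) (z m))" if "z \<in> P" for z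
      using that c wmap_le[OF w(1)] by (simp add: w(2) mk_apply lim_verts B(1))
    moreover have "\<bar>int (w (crd (A m) (x m))) - int (w (crd (A m) (y m)))\<bar>
        \<le> \<bar>int (crd (A m) (x m)) - int (crd (A m) (y m))\<bar>"
      using wmap_dist[OF w(1)] c xy by blast
    ultimately have "\<bar>int (crd B (g (x m))) - int (crd B (g (y m)))\<bar> \<le> int K" using xy by simp
    then have "(f (g (x m)), f (g (y m))) \<in> adj (A n)"
      using f[of "g (x m)" "g (y m)"] Epi_mem[OF m(2) lim_verts] xy by blast
    then show ?thesis using m(3) xy by simp
  qed
  then show ?thesis using m(1) by blast
qed

lemma equiv_lim_rel: "equiv P (lim_rel A p)"
proof (rule equivI)
  show "lim_rel A p \<subseteq> P \<times> P" by (auto simp: lim_rel_def)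
  show "refl_on P (lim_rel A p)"
    by (auto simp: refl_on_def lim_rel_iff intro: adj_refl[OF lin] lim_verts)
  show "sym (lim_rel A p)"
    by (auto simp: sym_def lim_rel_iff intro: adj_sym[OF lin])
  show "trans (lim_rel A p)"
  proof (rule transI)
    fix x y z assume xy: "(x, y) \<in> lim_rel A p" and yz: "(y, z) \<in> lim_rel A p"
    have "(x n, z n) \<in> adj (A n)" for n
    proof -
      \<comment> \<open>Two successive adjacencies amount to a distance of at most 2 on level
        \<open>m\<close>, which is adjacency on level \<open>n\<close>.\<close>
      obtain m where m: "\<forall>x\<in>P. \<forall>y\<in>P.
          \<bar>int (crd (A m) (x m)) - int (crd (A m) (y m))\<bar> \<le> int 2 \<longrightarrow> (x n, y n) \<in> adj (A n)"
        using thin_level[of n 2] by blast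
      have "\<bar>int (crd (A m) (x m)) - int (crd (A m) (y m))\<bar> \<le> 1"
        "\<bar>int (crd (A m) (y m)) - int (crd (A m) (z m))\<bar> \<le> 1"
        using xy yz adj_iff[OF lin] by (auto simp: lim_rel_iff)
      then show ?thesis using m xy yz by (auto simp: lim_rel_iff)
    qed
    then show "(x, z) \<in> lim_rel A p" using xy yz by (auto simp: lim_rel_iff)
  qed
qed

lemma pr_eq_iff: "x \<in> P \<Longrightarrow> y \<in> P \<Longrightarrow> pr A p x = pr A p y \<longleftrightarrow> (x, y) \<in> lim_rel A p"
  unfolding pr_def by (rule eq_equiv_class_iff[OF equiv_lim_rel])


section \<open>Automorphisms and homogeneity\<close>

text \<open>The working form of the conditions on automorphisms: by \<open>AutI\<close> and
  \<open>AutE\<close> an extensional map is in \<open>Aut A p\<close> exactly if it and a two-sided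
  inverse on the limit are of this kind, continuity included.\<close>

definition level_map :: "((nat \<Rightarrow> nat) \<Rightarrow> nat \<Rightarrow> nat) \<Rightarrow> bool" where
  "level_map \<sigma> \<longleftrightarrow> \<sigma> \<in> P \<rightarrow> P \<and> (\<forall>n. \<exists>m. \<exists>t\<in>Epi (A m) (A n). \<forall>x\<in>P. \<sigma> x n = t (x m))"

lemma level_map_level:
  "level_map \<sigma> \<Longrightarrow> \<exists>m. \<exists>t\<in>Epi (A m) (A n). \<forall>x\<in>P. \<sigma> x n = t (x m)"
  by (simp add: level_map_def)

lemma continuous_proj: "continuous_map X (discrete_topology (verts (A n))) (\<lambda>x. x n)"
  unfolding lim_topology_def
  by (intro continuous_map_from_subtopology continuous_map_product_projection) simp

lemma level_map_continuous:
  assumes "level_map \<sigma>"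
  shows "continuous_map X X \<sigma>"
proof -
  have "continuous_map X (discrete_topology (verts (A n))) (\<lambda>x. \<sigma> x n)" for n
  proof -
    obtain m t where t: "t \<in> Epi (A m) (A n)" "\<forall>x\<in>P. \<sigma> x n = t (x m)"
      using level_map_level[OF assms] by blast
    have "continuous_map X (discrete_topology (verts (A n))) (t \<circ> (\<lambda>x. x m))"
      by (rule continuous_map_compose[OF continuous_proj]) (use Epi_mem[OF t(1)] in auto)
    then show ?thesis
      by (rule continuous_map_eq) (use t(2) in \<open>simp add: topspace_lim_topology\<close>)
  qed
  then have "continuous_map X (product_topology (\<lambda>n. discrete_topology (verts (A n))) UNIV) \<sigma>"
    by (simp add: continuous_map_componentwise_UNIV)
  then show ?thesis
    using assms unfolding level_map_def
    by (subst (2) lim_topology_def) (auto simp: continuous_map_in_subtopology topspace_lim_topology)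
qed

lemma level_map_lim_Epi:
  assumes "level_map \<sigma>" "\<phi> \<in> lim_Epi A p B"
  shows "compose P \<phi> \<sigma> \<in> lim_Epi A p B"
proof -
  obtain n f where f: "f \<in> Epi (A n) B" "\<phi> = (\<lambda>x\<in>P. f (x n))" using assms(2) by (auto simp: lim_Epi_iff)
  obtain m t where t: "t \<in> Epi (A m) (A n)" "\<forall>x\<in>P. \<sigma> x n = t (x m)"
    using level_map_level[OF assms(1)] by blast
  have "compose P \<phi> \<sigma> = (\<lambda>x\<in>P. compose (verts (A m)) f t (x m))"
    using t(2) assms(1) lim_verts by (fastforce simp: f(2) compose_def level_map_def)
  then show ?thesis using Epi_compose[OF t(1) f(1) adj_sub] by (auto simp: lim_Epi_iff)
qed

lemma homeo_inv_eq:
  assumes "\<And>x. x \<in> topspace Y \<Longrightarrow> \<sigma> x \<in> topspace Y \<and> \<tau> (\<sigma> x) = x"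
    "\<And>x. x \<in> topspace Y \<Longrightarrow> \<tau> x \<in> topspace Y \<and> \<sigma> (\<tau> x) = x" "x \<in> topspace Y"
  shows "homeo_inv Y \<sigma> x = \<tau> x"
proof -
  have "inj_on \<sigma> (topspace Y)" using assms(1) by (metis inj_onI)
  then have "inv_into (topspace Y) \<sigma> (\<sigma> (\<tau> x)) = \<tau> x" by (rule inv_into_f_f) (use assms(2,3) in blast)
  then show ?thesis using assms(2,3) by (simp add: homeo_inv_def)
qed

lemma AutI:
  assumes \<sigma>: "level_map \<sigma>" and \<tau>: "level_map \<tau>" and ext: "\<sigma> \<in> extensional P"
    and inv: "\<And>x. x \<in> P \<Longrightarrow> \<tau> (\<sigma> x) = x" "\<And>x. x \<in> P \<Longrightarrow> \<sigma> (\<tau> x) = x"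
  shows "\<sigma> \<in> Aut A p"
proof -
  have in_P: "\<sigma> x \<in> P" "\<tau> x \<in> P" if "x \<in> P" for x using \<sigma> \<tau> that by (auto simp: level_map_def)
  have "homeomorphic_maps X X \<sigma> \<tau>"
    using level_map_continuous[OF \<sigma>] level_map_continuous[OF \<tau>] inv
    by (simp add: homeomorphic_maps_def topspace_lim_topology)
  then have "\<sigma> \<in> Homeo X" using ext by (auto simp: Homeo_def homeomorphic_maps_map topspace_lim_topology)
  moreover have "homeo_inv X \<sigma> x = \<tau> x" if "x \<in> P" for x
    by (rule homeo_inv_eq) (use in_P inv that in \<open>auto simp: topspace_lim_topology\<close>)
  then have "compose P \<phi> (homeo_inv X \<sigma>) = compose P \<phi> \<tau>" for \<phi> :: "(nat \<Rightarrow> nat) \<Rightarrow> nat"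
    by (auto simp: compose_def restrict_def)
  ultimately show ?thesis
    using level_map_lim_Epi[OF \<sigma>] level_map_lim_Epi[OF \<tau>] by (simp add: Aut_def)
qed

text \<open>It suffices to test with the projections to the levels, which are limit
  epimorphisms.\<close>

lemma lim_Epi_level_map:
  assumes "\<sigma> \<in> P \<rightarrow> P" "\<And>n \<phi>. \<phi> \<in> lim_Epi A p (A n) \<Longrightarrow> compose P \<phi> \<sigma> \<in> lim_Epi A p (A n)"
  shows "level_map \<sigma>"
proof -
  have "\<exists>m. \<exists>t\<in>Epi (A m) (A n). \<forall>x\<in>P. \<sigma> x n = t (x m)" for n
  proof -
    have "(\<lambda>x\<in>P. bond A p n 0 (x n)) \<in> lim_Epi A p (A n)"
      using bond_Epi[of n 0] unfolding lim_Epi_iff by (metis add_0_right)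
    from assms(2)[OF this] obtain m t where t: "t \<in> Epi (A m) (A n)"
      "compose P (\<lambda>x\<in>P. bond A p n 0 (x n)) \<sigma> = (\<lambda>x\<in>P. t (x m))" by (auto simp: lim_Epi_iff)
    have "\<sigma> x n = t (x m)" if "x \<in> P" for x
    proof -
      have "\<sigma> x \<in> P" using assms(1) that by blast
      then have "compose P (\<lambda>x\<in>P. bond A p n 0 (x n)) \<sigma> x = \<sigma> x n"
        using that lim_verts by (simp add: compose_def)
      then show ?thesis using t(2) that by simp
    qed
    then show ?thesis using t(1) by blast
  qed
  then show ?thesis using assms(1) by (simp add: level_map_def)
qed

lemma AutE:
  assumes "\<sigma> \<in> Aut A p"
  shows "level_map \<sigma>" "level_map (homeo_inv X \<sigma>)" "\<sigma> \<in> extensional P"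
    "\<And>x. x \<in> P \<Longrightarrow> homeo_inv X \<sigma> (\<sigma> x) = x" "\<And>x. x \<in> P \<Longrightarrow> \<sigma> (homeo_inv X \<sigma> x) = x"
proof -
  have h: "homeomorphic_map X X \<sigma>" and ext: "\<sigma> \<in> extensional P"
    using assms by (auto simp: Aut_def Homeo_def topspace_lim_topology)
  have inj: "inj_on \<sigma> P" and im: "\<sigma> ` P = P"
    using h homeomorphic_imp_injective_map[OF h] homeomorphic_imp_surjective_map[OF h]
    by (auto simp: topspace_lim_topology)
  show "\<sigma> \<in> extensional P" by (rule ext)
  show "homeo_inv X \<sigma> (\<sigma> x) = x" "\<sigma> (homeo_inv X \<sigma> x) = x" if "x \<in> P" for x
    using inj im that by (auto simp: homeo_inv_def topspace_lim_topology f_inv_into_f)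
  have "homeo_inv X \<sigma> x \<in> P" if "x \<in> P" for x
    using im that inv_into_into[of x \<sigma> P] by (simp add: homeo_inv_def topspace_lim_topology)
  then show "level_map (homeo_inv X \<sigma>)"
    using assms lin by (intro lim_Epi_level_map) (auto simp: Aut_def)
  show "level_map \<sigma>"
    using assms lin im by (intro lim_Epi_level_map) (auto simp: Aut_def)
qed

lemma Aut_in: "\<sigma> \<in> Aut A p \<Longrightarrow> x \<in> P \<Longrightarrow> \<sigma> x \<in> P"
  using AutE(1)[of \<sigma>] by (auto simp: level_map_def)

lemma inv_in: "\<sigma> \<in> Aut A p \<Longrightarrow> x \<in> P \<Longrightarrow> homeo_inv X \<sigma> x \<in> P"
  using AutE(2)[of \<sigma>] by (auto simp: level_map_def)

lemma Aut_level:
  assumes "\<sigma> \<in> Aut A p"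
  obtains m t where "t \<in> Epi (A m) (A n)" "\<And>x. x \<in> P \<Longrightarrow> \<sigma> x n = t (x m)"
  using AutE(1)[OF assms] unfolding level_map_def by blast

lemma level_map_compose:
  assumes "level_map \<sigma>" "level_map \<tau>"
  shows "level_map (compose P \<sigma> \<tau>)"
proof (rule lim_Epi_level_map)
  have in_P: "\<tau> x \<in> P" "\<sigma> x \<in> P" if "x \<in> P" for x using assms that by (auto simp: level_map_def)
  then show "compose P \<sigma> \<tau> \<in> P \<rightarrow> P" by (auto simp: compose_def)
  fix n \<phi> assume "\<phi> \<in> lim_Epi A p (A n)"
  then have "compose P (compose P \<phi> \<sigma>) \<tau> \<in> lim_Epi A p (A n)"
    by (intro level_map_lim_Epi assms)
  moreover have "compose P (compose P \<phi> \<sigma>) \<tau> = compose P \<phi> (compose P \<sigma> \<tau>)"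
    using in_P by (auto simp: compose_def fun_eq_iff)
  ultimately show "compose P \<phi> (compose P \<sigma> \<tau>) \<in> lim_Epi A p (A n)" by simp
qed

lemma conj_Aut:
  assumes g: "g \<in> Aut A p" and \<gamma>: "\<gamma> \<in> Aut A p"
  shows "compose P g (compose P \<gamma> (homeo_inv X g)) \<in> Aut A p"
proof (rule AutI)
  show "level_map (compose P g (compose P \<gamma> (homeo_inv X g)))"
    "level_map (compose P g (compose P (homeo_inv X \<gamma>) (homeo_inv X g)))"
    by (intro level_map_compose AutE(1,2) g \<gamma>)+
qed (use AutE(4,5)[OF g] AutE(4,5)[OF \<gamma>] Aut_in[OF g] Aut_in[OF \<gamma>] inv_in[OF g] inv_in[OF \<gamma>]
    in \<open>simp_all add: compose_def\<close>)

section \<open>Back and forth along the generic sequence\<close>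

text \<open>A point of the limit is determined by compatible vertices on cofinally many levels;
  compatibility is expressed through points \<open>z\<close> of the limit, which avoids composites
  of bonding maps.\<close>

lemma thread:
  assumes c: "strict_mono c" and v: "\<And>i. v i \<in> verts (A (c i))"
    and co: "\<And>i z. z \<in> P \<Longrightarrow> z (c (Suc i)) = v (Suc i) \<Longrightarrow> z (c i) = v i"
  shows "\<exists>y\<in>P. \<forall>i. y (c i) = v i"
proof -
  have "\<exists>z. \<forall>i. z i \<in> P \<and> z i (c i) = v i"
    using proj_onto[OF v] by (intro choice) blast
  then obtain z where z: "\<And>i. z i \<in> P" "\<And>i. z i (c i) = v i" by blast
  have down: "z (i + j) (c i) = v i" for i j
  proof -
    have "w (c (i + j)) = v (i + j) \<Longrightarrow> w (c i) = v i" if "w \<in> P" for w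
      by (induction j) (use co[OF that] in auto)
    then show ?thesis using z by blast
  qed
  \<comment> \<open>Since \<open>k \<le> c k\<close>, the point \<open>z k\<close> already has the
    final value in coordinate \<open>k\<close>, so the diagonal is compatible.\<close>
  define y where "y k = z k k" for k
  have y: "y k = z j k" if "k \<le> j" for j k
    unfolding y_def
    by (rule lim_agree[OF z(1) z(1), of _ "c k"])
      (use down[of k "j - k"] z(2)[of k] that strict_mono_imp_increasing[OF c] in auto)
  have "y k \<in> verts (A k)" "p k (y (Suc k)) = y k" for k
    using lim_verts[OF z(1)] lim_p[OF z(1)] y[of k "Suc k"] by (auto simp: y_def)
  then have "y \<in> P" by (simp add: proj_lim_def)
  moreover have "y (c i) = v i" for i
    using y[of "c i" "c i"] down[of i "c i - i"] strict_mono_imp_increasing[OF c, of i] by simp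
  ultimately show ?thesis by blast
qed

lemma cofinal_eq:
  fixes c :: "nat \<Rightarrow> nat"
  assumes "strict_mono c" "x \<in> P" "y \<in> P" "\<And>i. x (c i) = y (c i)"
  shows "x = y"
proof
  fix k show "x k = y k"
    by (rule lim_agree[OF assms(2,3,4)]) (rule strict_mono_imp_increasing[OF assms(1)])
qed

text \<open>The maps \<open>t\<^sub>i\<close> with even \<open>i\<close> define a map of the limit, those with odd \<open>i\<close> its inverse,
  because the composites of consecutive ones are bonding maps of the sequence.\<close>

lemma zigzag_map:
  assumes a: "strict_mono a" and t: "\<And>i. t i \<in> Epi (A (a (Suc i))) (A (a i))"
    and tt: "\<And>i x. x \<in> P \<Longrightarrow> t i (t (Suc i) (x (a (Suc (Suc i))))) = x (a i)"
  shows "\<exists>\<sigma>\<in>extensional P. \<sigma> \<in> P \<rightarrow> P \<and> (\<forall>x\<in>P. \<forall>i. \<sigma> x (a (2 * i + j)) = t (2 * i + j) (x (a (Suc (2 * i + j)))))"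
proof -
  have c: "strict_mono (\<lambda>i. a (2 * i + j))"
    using a by (auto simp: strict_mono_def)
  have "\<exists>y\<in>P. \<forall>i. y (a (2 * i + j)) = t (2 * i + j) (x (a (Suc (2 * i + j))))" if x: "x \<in> P" for x
  proof (rule thread[OF c])
    show "t (2 * i + j) (x (a (Suc (2 * i + j)))) \<in> verts (A (a (2 * i + j)))" for i
      by (rule Epi_mem[OF t lim_verts[OF x]])
    fix i z
    let ?k = "2 * i + j"
    assume "z \<in> P" "z (a (2 * Suc i + j)) = t (2 * Suc i + j) (x (a (Suc (2 * Suc i + j))))"
    \<comment> \<open>Inserting the value of \<open>z\<close> into the composite of two maps at
      \<open>?k\<close> leaves two consecutive maps applied to \<open>x\<close>, which contract as
      well.\<close>
    then show "z (a ?k) = t ?k (x (a (Suc ?k)))"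
      using tt[of z ?k] tt[OF x, of "Suc ?k"] by simp
  qed
  then obtain \<sigma> where \<sigma>: "\<And>x. x \<in> P \<Longrightarrow> \<sigma> x \<in> P"
    "\<And>x i. x \<in> P \<Longrightarrow> \<sigma> x (a (2 * i + j)) = t (2 * i + j) (x (a (Suc (2 * i + j))))" by metis
  then show ?thesis by (intro bexI[of _ "restrict \<sigma> P"]) auto
qed

lemma zigzag_level_map:
  assumes a: "strict_mono a" and t: "\<And>i. t i \<in> Epi (A (a (Suc i))) (A (a i))"
    and \<sigma>: "\<sigma> \<in> P \<rightarrow> P" "\<forall>x\<in>P. \<forall>i. \<sigma> x (a (2 * i + j)) = t (2 * i + j) (x (a (Suc (2 * i + j))))"
  shows "level_map \<sigma>"
  unfolding level_map_def
proof (intro conjI allI \<sigma>(1))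
  fix n
  let ?k = "2 * n + j"
  have le: "n \<le> a ?k" using strict_mono_imp_increasing[OF a, of ?k] by simp
  have b: "bond A p n (a ?k - n) \<in> Epi (A (a ?k)) (A n)" using bond_Epi[of n "a ?k - n"] le by simp
  have "\<sigma> x n = compose (verts (A (a (Suc ?k)))) (bond A p n (a ?k - n)) (t ?k) (x (a (Suc ?k)))"
    if x: "x \<in> P" for x
  proof -
    have "\<sigma> x \<in> P" using \<sigma>(1) x by blast
    then have "\<sigma> x n = bond A p n (a ?k - n) (\<sigma> x (a ?k))" using bond_lim[of "\<sigma> x" n "a ?k - n"] le by simp
    then show ?thesis using \<sigma>(2) x lim_verts[OF x] by (simp add: compose_def)
  qed
  then show "\<exists>m. \<exists>u\<in>Epi (A m) (A n). \<forall>x\<in>P. \<sigma> x n = u (x m)"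
    using Epi_compose[OF t b adj_sub] by blast
qed

text \<open>Only the first map \<open>t0\<close> involves \<open>\<phi>\<close> and
  \<open>\<psi>\<close>; it solves the equation on levels. From then on genericity supplies, for
  each map, a next one such that the composite of the two is a projection between levels.\<close>

lemma homogeneous:
  assumes C: "linear_graph (C :: nat rgraph)" and \<phi>: "\<phi> \<in> Epi (A n) C" and \<psi>: "\<psi> \<in> Epi (A m) C"
  shows "\<exists>\<sigma>\<in>Aut A p. \<forall>x\<in>P. \<phi> (\<sigma> x n) = \<psi> (x m)"
proof -
  obtain k t0 where k: "k \<ge> Suc n" "t0 \<in> Epi (A k) (A n)" "\<forall>x\<in>P. \<phi> (t0 (x k)) = \<psi> (x m)"
    using Epi_extension_over[OF lin C \<phi> \<psi>] by blast
  \<comment> \<open>A state \<open>(a, b, t)\<close> records a map \<open>t\<close> from level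
    \<open>b\<close> to level \<open>a\<close>; the next state starts at \<open>b\<close>.\<close>
  define ok where "ok s \<longleftrightarrow> (case s of (a, b, t) \<Rightarrow> a < b \<and> t \<in> Epi (A b) (A a))" for s
  define nxt where "nxt s s' \<longleftrightarrow> (case (s, s') of ((a, b, t), (a', b', t')) \<Rightarrow>
      a' = b \<and> (\<forall>x\<in>P. t (t' (x b')) = x a))"
    for s s' :: "nat \<times> nat \<times> (nat \<Rightarrow> nat)"
  have "\<exists>s. \<forall>i. (ok (s i) \<and> (i = 0 \<longrightarrow> s i = (n, k, t0))) \<and> nxt (s i) (s (Suc i))"
  proof (rule dependent_nat_choice)
    show "\<exists>s. ok s \<and> ((0::nat) = 0 \<longrightarrow> s = (n, k, t0))" using k by (simp add: ok_def)
    fix s and i :: nat assume s: "ok s \<and> (i = 0 \<longrightarrow> s = (n, k, t0))"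
    obtain a b t where abt: "s = (a, b, t)" by (cases s)
    then have "t \<in> Epi (A b) (A a)" using s by (simp add: ok_def)
    then obtain c t' where "c \<ge> Suc b" "t' \<in> Epi (A c) (A b)" "\<forall>x\<in>P. t (t' (x c)) = x a"
      using Epi_extension[OF lin] by blast
    then show "\<exists>s'. (ok s' \<and> (Suc i = 0 \<longrightarrow> s' = (n, k, t0))) \<and> nxt s s'"
      by (intro exI[of _ "(b, c, t')"]) (simp add: ok_def nxt_def abt)
  qed
  then obtain s where s: "\<And>i. ok (s i)" "s 0 = (n, k, t0)" "\<And>i. nxt (s i) (s (Suc i))" by blast
  define a where "a i = fst (s i)" for i
  define t where "t i = snd (snd (s i))" for i
  have s_eq: "s i = (a i, a (Suc i), t i)" for i
    using s(3)[of i] by (auto simp: nxt_def a_def t_def split: prod.splits)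
  have a: "strict_mono a"
    using s(1) by (intro strict_mono_Suc_iff[THEN iffD2] allI) (simp add: s_eq ok_def)
  have t: "t i \<in> Epi (A (a (Suc i))) (A (a i))" for i
    using s(1)[of i] by (simp add: s_eq ok_def)
  have tt: "t i (t (Suc i) (x (a (Suc (Suc i))))) = x (a i)" if "x \<in> P" for i x
    using s(3)[of i] that by (simp add: s_eq nxt_def)
  obtain \<sigma> where \<sigma>: "\<sigma> \<in> extensional P" "\<sigma> \<in> P \<rightarrow> P"
    "\<forall>x\<in>P. \<forall>i. \<sigma> x (a (2 * i + 0)) = t (2 * i + 0) (x (a (Suc (2 * i + 0))))"
    using zigzag_map[OF a t tt, of 0] by blast
  obtain \<tau> where \<tau>: "\<tau> \<in> P \<rightarrow> P"
    "\<forall>x\<in>P. \<forall>i. \<tau> x (a (2 * i + 1)) = t (2 * i + 1) (x (a (Suc (2 * i + 1))))"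
    using zigzag_map[OF a t tt, of 1] by blast
  have in_P: "\<sigma> x \<in> P" "\<tau> x \<in> P" if "x \<in> P" for x using \<sigma>(2) \<tau>(1) that by blast+
  have "\<tau> (\<sigma> x) = x" if x: "x \<in> P" for x
  proof (rule cofinal_eq[of "\<lambda>i. a (2 * i + 1)"])
    show "\<tau> (\<sigma> x) (a (2 * i + 1)) = x (a (2 * i + 1))" for i
    proof -
      have "\<tau> (\<sigma> x) (a (2 * i + 1)) = t (2 * i + 1) (\<sigma> x (a (2 * Suc i + 0)))"
        using \<tau>(2) in_P(1)[OF x] by simp
      also have "\<sigma> x (a (2 * Suc i + 0)) = t (2 * Suc i + 0) (x (a (Suc (2 * Suc i + 0))))"
        using \<sigma>(3) x by blast
      finally show ?thesis using tt[OF x, of "2 * i + 1"] by simp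
    qed
  qed (use a in_P x in \<open>auto simp: strict_mono_def\<close>)
  moreover have "\<sigma> (\<tau> x) = x" if x: "x \<in> P" for x
  proof (rule cofinal_eq[of "\<lambda>i. a (2 * i)"])
    show "\<sigma> (\<tau> x) (a (2 * i)) = x (a (2 * i))" for i
    proof -
      have "\<sigma> (\<tau> x) (a (2 * i)) = t (2 * i) (\<tau> x (a (2 * i + 1)))"
        using \<sigma>(3) in_P(2)[OF x] by simp
      also have "\<tau> x (a (2 * i + 1)) = t (2 * i + 1) (x (a (Suc (2 * i + 1))))"
        using \<tau>(2) x by blast
      finally show ?thesis using tt[OF x, of "2 * i"] by simp
    qed
  qed (use a in_P x in \<open>auto simp: strict_mono_def\<close>)
  ultimately have "\<sigma> \<in> Aut A p"
    by (intro AutI[OF zigzag_level_map[OF a t \<sigma>(2,3)] zigzag_level_map[OF a t \<tau>] \<sigma>(1)])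
  moreover have "\<phi> (\<sigma> x n) = \<psi> (x m)" if x: "x \<in> P" for x
  proof -
    have "s 0 = (a 0, a (Suc 0), t 0)" by (rule s_eq)
    then have e: "a 0 = n" "a (Suc 0) = k" "t 0 = t0" using s(2) by simp_all
    have "\<sigma> x (a (2 * 0 + 0)) = t (2 * 0 + 0) (x (a (Suc (2 * 0 + 0))))" using \<sigma>(3) x by blast
    then show ?thesis using k(3) x e by simp
  qed
  ultimately show ?thesis by blast
qed

end


section \<open>Compactness, category, and the uniform topology\<close>

lemma compactin_increasing_cover:
  fixes U :: "nat \<Rightarrow> 'a set"
  assumes K: "compactin T K" and U: "\<And>n. openin T (U n)" and mono: "\<And>m n. m \<le> n \<Longrightarrow> U m \<subseteq> U n"
    and cover: "K \<subseteq> (\<Union>n. U n)"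
  shows "\<exists>n. K \<subseteq> U n"
proof -
  obtain F where F: "finite F" "F \<subseteq> range U" "K \<subseteq> \<Union>F"
    using compactinD[OF K, of "range U"] U cover by auto
  then obtain N where N: "finite N" "F = U ` N" by (meson finite_subset_image)
  obtain b where "\<forall>n\<in>N. n \<le> b" using N(1) finite_nat_set_iff_bounded_le by blast
  then have "\<Union>F \<subseteq> U b" using N(2) mono by blast
  then show ?thesis using F(3) by blast
qed

lemma comeagre_in_dense_open:
  assumes K: "countable K" and op: "\<And>k. k \<in> K \<Longrightarrow> openin T (W k)"
    and dense: "\<And>k V. k \<in> K \<Longrightarrow> openin T V \<Longrightarrow> V \<noteq> {} \<Longrightarrow> V \<inter> W k \<noteq> {}"
    and sub: "\<And>x. x \<in> topspace T \<Longrightarrow> (\<And>k. k \<in> K \<Longrightarrow> x \<in> W k) \<Longrightarrow> x \<in> S"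
    and S: "S \<subseteq> topspace T"
  shows "comeagre_in T S"
proof -
  \<comment> \<open>\<open>meagre_in\<close> asks for equality with a union of nowhere dense sets,
    so the complements of the \<open>W k\<close> are cut down to the complement of
    \<open>S\<close>.\<close>
  let ?N = "(\<lambda>k. (topspace T - S) - W k) ` K"
  have "nowhere_dense_in T ((topspace T - S) - W k)" if "k \<in> K" for k
    unfolding nowhere_dense_in_def
  proof (intro conjI)
    let ?I = "T interior_of (T closure_of (topspace T - S - W k))"
    have "closedin T (topspace T - W k)" using op[OF that] by blast
    then have "T closure_of (topspace T - S - W k) \<subseteq> topspace T - W k"
      by (rule closure_of_minimal[rotated]) blast
    then have "?I \<subseteq> topspace T - W k" by (meson interior_of_subset order_trans)
    then show "?I = {}" using dense[OF that openin_interior_of, of "T closure_of (topspace T - S - W k)"] by blast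
  qed blast
  moreover have "topspace T - S = \<Union>?N" using sub by blast
  moreover have "countable ?N" using K by simp
  ultimately show ?thesis using S unfolding comeagre_in_def meagre_in_def by blast
qed

lemma product_nbhd:
  assumes "openin (product_topology T I) V" "x \<in> V"
  obtains U where "finite {i \<in> I. U i \<noteq> topspace (T i)}" "\<And>i. i \<in> I \<Longrightarrow> openin (T i) (U i)"
    "x \<in> Pi\<^sub>E I U" "Pi\<^sub>E I U \<subseteq> V"
proof -
  from bspec[OF assms(1)[unfolded openin_product_topology_alt] assms(2)]
  show thesis by (elim exE conjE) (rule that, simp_all)
qed

lemma Homeo_sub_cfunspace:
  assumes "compact_space Y" "mtopology_of d = Y" "G \<subseteq> Homeo Y"
  shows "G \<subseteq> mspace (cfunspace Y d)"
proof -
  have "topspace (subtopology (mtopology_of (cfunspace Y d)) G) = G"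
    using topspace_uniform_topology_Homeo[OF assms] by (simp only: uniform_topology_def)
  then have "mspace (cfunspace Y d) \<inter> G = G" by (simp only: topspace_subtopology topspace_mtopology_of)
  then show ?thesis by blast
qed

lemma openin_uniform_topologyD:
  assumes Y: "compact_space Y" "mtopology_of d = Y" and G: "G \<subseteq> Homeo Y"
    and V: "openin (uniform_topology Y d G) V" and g: "g \<in> V"
  shows "\<exists>\<epsilon>>0. \<forall>h\<in>G. (\<forall>x\<in>topspace Y. mdist d (g x) (h x) \<le> \<epsilon>) \<longrightarrow> h \<in> V"
proof -
  interpret C: Metric_space "mspace (cfunspace Y d)" "mdist (cfunspace Y d)" by (rule Metric_space_mspace_mdist)
  obtain T where T: "openin C.mtopology T" "V = T \<inter> G"
    using V by (auto simp only: uniform_topology_def openin_subtopology mtopology_of_def)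
  then obtain r where r: "r > 0" "C.mball g r \<subseteq> T" using g C.openin_mtopology by blast
  have gG: "g \<in> mspace (cfunspace Y d)" using g T Homeo_sub_cfunspace[OF Y G] by blast
  show ?thesis
  proof (intro exI[of _ "r / 2"] conjI ballI impI)
    \<comment> \<open>A pointwise bound yields only a weak inequality for the supremum, so half the
      radius is used to stay in the open ball.\<close>
    show "r / 2 > 0" using r by simp
    fix h assume h: "h \<in> G" "\<forall>x\<in>topspace Y. mdist d (g x) (h x) \<le> r / 2"
    have "mdist (cfunspace Y d) g h \<le> r / 2" by (rule mdist_cfunspace_le) (use r h in auto)
    then have "h \<in> C.mball g r" using gG h Homeo_sub_cfunspace[OF Y G] r(1)
      unfolding C.in_mball by (intro conjI) auto
    then show "h \<in> V" using r T h by blast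
  qed
qed

lemma openin_uniform_topologyI:
  assumes Y: "compact_space Y" "mtopology_of d = Y" and G: "G \<subseteq> Homeo Y" and V: "V \<subseteq> G"
    and ball: "\<And>g. g \<in> V \<Longrightarrow> \<exists>\<epsilon>>0. \<forall>h\<in>G. (\<forall>x\<in>topspace Y. mdist d (g x) (h x) \<le> \<epsilon>) \<longrightarrow> h \<in> V"
  shows "openin (uniform_topology Y d G) V"
proof (subst openin_subopen, intro ballI)
  interpret C: Metric_space "mspace (cfunspace Y d)" "mdist (cfunspace Y d)" by (rule Metric_space_mspace_mdist)
  fix g assume g: "g \<in> V"
  then obtain \<epsilon> where e: "\<epsilon> > 0" "\<forall>h\<in>G. (\<forall>x\<in>topspace Y. mdist d (g x) (h x) \<le> \<epsilon>) \<longrightarrow> h \<in> V"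
    using ball by blast
  have gG: "g \<in> mspace (cfunspace Y d)" using g V Homeo_sub_cfunspace[OF Y G] by blast
  have "h \<in> V" if h: "h \<in> C.mball g \<epsilon> \<inter> G" for h
  proof -
    have hC: "h \<in> mspace (cfunspace Y d)" "mdist (cfunspace Y d) g h < \<epsilon>"
      using h unfolding Int_iff C.in_mball by blast+
    have "mdist d (g x) (h x) \<le> \<epsilon>" if "x \<in> topspace Y" for x
      by (rule mdist_cfunspace_imp_mdist_le[OF gG hC(1) _ that]) (use hC(2) in simp)
    then show ?thesis using e h by blast
  qed
  moreover have "openin (uniform_topology Y d G) (C.mball g \<epsilon> \<inter> G)"
    unfolding uniform_topology_def mtopology_of_def by (intro openin_subtopology_Int C.openin_mball)
  moreover have "g \<in> C.mball g \<epsilon> \<inter> G" using gG e g V unfolding Int_iff C.centre_in_mball_iff by blast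
  ultimately show "\<exists>T. openin (uniform_topology Y d G) T \<and> g \<in> T \<and> T \<subseteq> V" by blast
qed

context generic_seq
begin

section \<open>Compactness of the limit and levels as neighbourhoods\<close>

lemma openin_coord: "openin X {x \<in> P. x n \<in> S}"
proof -
  have "openin X {x \<in> topspace X. x n \<in> S \<inter> verts (A n)}"
    by (rule openin_continuous_map_preimage[OF continuous_proj]) simp
  moreover have "{x \<in> topspace X. x n \<in> S \<inter> verts (A n)} = {x \<in> P. x n \<in> S}"
    using lim_verts by (auto simp: topspace_lim_topology)
  ultimately show ?thesis by simp
qed

lemma compact_X: "compact_space X"
proof -
  let ?T = "product_topology (\<lambda>n. discrete_topology (verts (A n))) UNIV"
  have top: "topspace ?T = {x. \<forall>n. x n \<in> verts (A n)}" by auto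
  have op: "openin ?T {x \<in> topspace ?T. x n = a}" for n a
  proof -
    have "continuous_map ?T (discrete_topology (verts (A n))) (\<lambda>x. x n)"
      by (rule continuous_map_product_projection) simp
    from openin_continuous_map_preimage[OF this, of "{a} \<inter> verts (A n)"]
    have "openin ?T {x \<in> topspace ?T. x n \<in> {a} \<inter> verts (A n)}" by simp
    moreover have "{x \<in> topspace ?T. x n \<in> {a} \<inter> verts (A n)} = {x \<in> topspace ?T. x n = a}"
      by auto
    ultimately show ?thesis by simp
  qed
  let ?D = "\<lambda>n a b. {x \<in> topspace ?T. x n = a} \<inter> {x \<in> topspace ?T. x (Suc n) = b}"
  have "topspace ?T - P = \<Union>{?D n a b | n a b. p n b \<noteq> a}"
    unfolding proj_lim_def top by blast
  also have "openin ?T \<dots>"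
    by (rule openin_Union) (use op openin_Int in blast)
  finally have "closedin ?T P" unfolding closedin_def proj_lim_def top by blast
  moreover have "compact_space ?T"
    by (simp add: compact_space_product_topology compact_space_discrete_topology finite_verts[OF lin])
  ultimately show ?thesis
    unfolding lim_topology_def by (meson closedin_compact_space compact_space_subtopology)
qed

lemma openin_level:
  "openin (prod_topology X X) {z \<in> P \<times> P. R (fst z n) (snd z n)}"
proof -
  have "{z \<in> P \<times> P. R (fst z n) (snd z n)} = (\<Union>a. {x \<in> P. x n \<in> {a}} \<times> {y \<in> P. y n \<in> {b. R a b}})"
    by auto
  also have "openin (prod_topology X X) \<dots>"
    by (intro openin_Union ballI) (auto simp: openin_prod_Times_iff intro: openin_coord[of _ "{_}", simplified] openin_coord[of _ "{b. R _ b}", simplified])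
  finally show ?thesis .
qed

lemma compact_XX: "compact_space (prod_topology X X)"
  using compact_X by (simp add: compact_space_prod_topology)

lemma topspace_XX: "topspace (prod_topology X X) = P \<times> P"
  by (simp add: topspace_lim_topology)

lemma compactin_diff:
  assumes "openin (prod_topology X X) W"
  shows "compactin (prod_topology X X) (P \<times> P - W)"
proof (rule closedin_compact_space[OF compact_XX])
  show "closedin (prod_topology X X) (P \<times> P - W)"
    using assms openin_closedin_eq[of "prod_topology X X" W] unfolding topspace_XX by blast
qed

text \<open>The pairs outside \<open>W\<close> form a compact set, covered by the open sets where
  \<open>R\<close> fails on level \<open>n\<close>; these increase with \<open>n\<close>. With
  equality for \<open>R\<close> this compares levels with a metric on the limit, with adjacency it
  does so for the quotient.\<close>

lemma uniform_level:
  assumes W: "openin (prod_topology X X) W"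
    and mono: "\<And>m n x y. x \<in> P \<Longrightarrow> y \<in> P \<Longrightarrow> m \<le> n \<Longrightarrow> R n (x n) (y n) \<Longrightarrow> R m (x m) (y m)"
    and all: "\<And>x y. x \<in> P \<Longrightarrow> y \<in> P \<Longrightarrow> (\<And>n. R n (x n) (y n)) \<Longrightarrow> (x, y) \<in> W"
  shows "\<exists>n. \<forall>x\<in>P. \<forall>y\<in>P. R n (x n) (y n) \<longrightarrow> (x, y) \<in> W"
proof -
  have K: "compactin (prod_topology X X) (P \<times> P - W)"
    by (rule compactin_diff[OF W])
  have "\<exists>n. P \<times> P - W \<subseteq> {z \<in> P \<times> P. \<not> R n (fst z n) (snd z n)}"
  proof (rule compactin_increasing_cover[OF K])
    show "openin (prod_topology X X) {z \<in> P \<times> P. \<not> R n (fst z n) (snd z n)}" for n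
      by (rule openin_level[of "\<lambda>a b. \<not> R n a b" n])
    show "{z \<in> P \<times> P. \<not> R m (fst z m) (snd z m)} \<subseteq> {z \<in> P \<times> P. \<not> R n (fst z n) (snd z n)}"
      if "m \<le> n" for m n using mono[OF _ _ that] by auto
    show "P \<times> P - W \<subseteq> (\<Union>n. {z \<in> P \<times> P. \<not> R n (fst z n) (snd z n)})"
    proof
      fix z assume z: "z \<in> P \<times> P - W"
      show "z \<in> (\<Union>n. {z \<in> P \<times> P. \<not> R n (fst z n) (snd z n)})"
      proof (rule ccontr)
        assume "\<not> ?thesis"
        then have "R n (fst z n) (snd z n)" for n using z by blast
        then have "(fst z, snd z) \<in> W" using z by (intro all) auto
        then show False using z by simp
      qed
    qed
  qed
  then obtain n where n: "P \<times> P - W \<subseteq> {z \<in> P \<times> P. \<not> R n (fst z n) (snd z n)}" by blast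
  have "(x, y) \<in> W" if "x \<in> P" "y \<in> P" "R n (x n) (y n)" for x y
    using n that by (fastforce dest: subsetD[of _ _ "(x, y)"])
  then show ?thesis by blast
qed

lemma openin_mdist_less:
  assumes "continuous_map X (mtopology_of d) f"
  shows "openin (prod_topology X X) {z \<in> P \<times> P. mdist d (f (fst z)) (f (snd z)) < \<epsilon>}"
    and "openin (prod_topology X X) {z \<in> P \<times> P. mdist d (f (fst z)) (f (snd z)) > \<epsilon>}"
proof -
  have "continuous_map (prod_topology X X) euclideanreal (\<lambda>z. mdist d ((f \<circ> fst) z) ((f \<circ> snd) z))"
    by (intro continuous_map_mdist continuous_map_compose[OF continuous_map_fst assms]
        continuous_map_compose[OF continuous_map_snd assms])
  from openin_continuous_map_preimage[OF this, of "{..<\<epsilon>}"] openin_continuous_map_preimage[OF this, of "{\<epsilon><..}"]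
  show "openin (prod_topology X X) {z \<in> P \<times> P. mdist d (f (fst z)) (f (snd z)) < \<epsilon>}"
    "openin (prod_topology X X) {z \<in> P \<times> P. mdist d (f (fst z)) (f (snd z)) > \<epsilon>}"
    by (simp_all add: topspace_lim_topology)
qed

lemma level_fine:
  assumes "mtopology_of d\<^sub>0 = X" "\<epsilon> > 0"
  shows "\<exists>n. \<forall>x\<in>P. \<forall>y\<in>P. x n = y n \<longrightarrow> mdist d\<^sub>0 x y < \<epsilon>"
proof -
  let ?W = "{z \<in> P \<times> P. mdist d\<^sub>0 (fst z) (snd z) < \<epsilon>}"
  have id: "continuous_map X (mtopology_of d\<^sub>0) (\<lambda>x. x)" using assms(1) by simp
  have ms: "mspace d\<^sub>0 = P" using assms(1) by (metis topspace_lim_topology topspace_mtopology_of)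
  have "\<exists>n. \<forall>x\<in>P. \<forall>y\<in>P. x n = y n \<longrightarrow> (x, y) \<in> ?W"
  proof (rule uniform_level[where R = "\<lambda>_ a b. a = b"])
    show "openin (prod_topology X X) ?W" by (rule openin_mdist_less[OF id])
    show "x m = y m" if "x \<in> P" "y \<in> P" "m \<le> n" "x n = y n" for m n x y
      using lim_agree that by blast
    show "(x, y) \<in> ?W" if "x \<in> P" "y \<in> P" "\<And>n. x n = y n" for x y
    proof -
      have "x = y" using that(3) by blast
      then show ?thesis
        using that assms(2) ms
          by (simp add: Metric_space.zero[OF Metric_space_mspace_mdist, THEN iffD2])
    qed
  qed
  then show ?thesis by auto
qed

text \<open>The pairs differing in coordinate \<open>n\<close> form a compact set of pairs of
  distinct points, on which the distance is bounded away from zero.\<close>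

lemma metric_fine:
  assumes "mtopology_of d\<^sub>0 = X"
  shows "\<exists>\<epsilon>>0. \<forall>x\<in>P. \<forall>y\<in>P. mdist d\<^sub>0 x y \<le> \<epsilon> \<longrightarrow> x n = y n"
proof -
  let ?W = "{z \<in> P \<times> P. fst z n = snd z n}"
  let ?U = "\<lambda>j. {z \<in> P \<times> P. mdist d\<^sub>0 (fst z) (snd z) > 1 / real (Suc j)}"
  have id: "continuous_map X (mtopology_of d\<^sub>0) (\<lambda>x. x)" using assms(1) by simp
  have ms: "mspace d\<^sub>0 = P" using assms(1) by (metis topspace_lim_topology topspace_mtopology_of)
  have "openin (prod_topology X X) ?W" by (rule openin_level[of "(=)"])
  then have K: "compactin (prod_topology X X) (P \<times> P - ?W)"
    by (rule compactin_diff)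
  have "\<exists>j. P \<times> P - ?W \<subseteq> ?U j"
  proof (rule compactin_increasing_cover[OF K])
    show "openin (prod_topology X X) (?U j)" for j by (rule openin_mdist_less[OF id])
    show "?U i \<subseteq> ?U j" if "i \<le> j" for i j
    proof -
      have "1 / real (Suc j) \<le> 1 / real (Suc i)" using that by (simp add: field_simps)
      then show ?thesis by auto
    qed
    show "P \<times> P - ?W \<subseteq> (\<Union>j. ?U j)"
    proof
      fix z assume z: "z \<in> P \<times> P - ?W"
      then have "fst z \<noteq> snd z" by auto
      then have "mdist d\<^sub>0 (fst z) (snd z) \<noteq> 0" using z ms
        by (auto simp: Metric_space.zero[OF Metric_space_mspace_mdist])
      then have "mdist d\<^sub>0 (fst z) (snd z) > 0" using mdist_nonneg[of d\<^sub>0 "fst z" "snd z"] by linarith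
      then obtain j where "inverse (real (Suc j)) < mdist d\<^sub>0 (fst z) (snd z)"
        using reals_Archimedean by blast
      then show "z \<in> (\<Union>j. ?U j)" using z by (auto simp: inverse_eq_divide)
    qed
  qed
  then obtain j where "P \<times> P - ?W \<subseteq> ?U j" by blast
  then have "\<forall>x\<in>P. \<forall>y\<in>P. mdist d\<^sub>0 x y \<le> 1 / real (Suc j) \<longrightarrow> x n = y n" by force
  then show ?thesis by (intro exI[of _ "1 / real (Suc j)"]) simp
qed

lemma Aut_Homeo: "Aut A p \<subseteq> Homeo X"
  by (auto simp: Aut_def)

text \<open>With the converse \<open>Aut_nbhd_level\<close> this shows that agreement on a level
  generates the uniform topology on the automorphisms, whatever metric is used.\<close>

lemma openin_Aut_level:
  assumes d\<^sub>0: "mtopology_of d\<^sub>0 = X" and F: "\<And>\<gamma> \<gamma>'. \<gamma> \<in> V \<Longrightarrow> \<gamma>' \<in> Aut A p \<Longrightarrow> (\<And>x. x \<in> P \<Longrightarrow> \<gamma>' x n = \<gamma> x n) \<Longrightarrow> \<gamma>' \<in> V"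
    and V: "V \<subseteq> Aut A p"
  shows "openin (uniform_topology X d\<^sub>0 (Aut A p)) V"
proof (rule openin_uniform_topologyI[OF compact_X d\<^sub>0 Aut_Homeo V])
  obtain \<epsilon> where e: "\<epsilon> > 0" "\<forall>x\<in>P. \<forall>y\<in>P. mdist d\<^sub>0 x y \<le> \<epsilon> \<longrightarrow> x n = y n"
    using metric_fine[OF d\<^sub>0] by blast
  fix g assume g: "g \<in> V"
  have "h \<in> V" if h: "h \<in> Aut A p" "\<forall>x\<in>topspace X. mdist d\<^sub>0 (g x) (h x) \<le> \<epsilon>" for h
  proof (rule F[OF g h(1)])
    fix x assume x: "x \<in> P"
    then have "g x \<in> P" "h x \<in> P" using g V h Aut_in by blast+
    moreover have "mdist d\<^sub>0 (g x) (h x) \<le> \<epsilon>" using h(2) x by (simp add: topspace_lim_topology)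
    ultimately have "g x n = h x n" using e(2) by blast
    then show "h x n = g x n" by simp
  qed
  then show "\<exists>\<epsilon>>0. \<forall>h\<in>Aut A p. (\<forall>x\<in>topspace X. mdist d\<^sub>0 (g x) (h x) \<le> \<epsilon>) \<longrightarrow> h \<in> V"
    using e(1) by blast
qed

lemma Aut_nbhd_level:
  assumes d\<^sub>0: "mtopology_of d\<^sub>0 = X" and V: "openin (uniform_topology X d\<^sub>0 (Aut A p)) V" "\<gamma> \<in> V"
  shows "\<exists>n. \<forall>\<gamma>'\<in>Aut A p. (\<forall>x\<in>P. \<gamma>' x n = \<gamma> x n) \<longrightarrow> \<gamma>' \<in> V"
proof -
  obtain \<epsilon> where e: "\<epsilon> > 0" "\<forall>h\<in>Aut A p. (\<forall>x\<in>topspace X. mdist d\<^sub>0 (\<gamma> x) (h x) \<le> \<epsilon>) \<longrightarrow> h \<in> V"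
    using openin_uniform_topologyD[OF compact_X d\<^sub>0 Aut_Homeo V] by blast
  obtain n where n: "\<forall>x\<in>P. \<forall>y\<in>P. x n = y n \<longrightarrow> mdist d\<^sub>0 x y < \<epsilon>" using level_fine[OF d\<^sub>0 e(1)] by blast
  have \<gamma>: "\<gamma> \<in> Aut A p"
    using V openin_subset topspace_uniform_topology_Homeo[OF compact_X d\<^sub>0 Aut_Homeo] by blast
  have "\<gamma>' \<in> V" if g: "\<gamma>' \<in> Aut A p" "\<forall>x\<in>P. \<gamma>' x n = \<gamma> x n" for \<gamma>'
  proof -
    have "mdist d\<^sub>0 (\<gamma> x) (\<gamma>' x) \<le> \<epsilon>" if x: "x \<in> topspace X" for x
    proof -
      have "x \<in> P" using x by (simp add: topspace_lim_topology)
      then have "mdist d\<^sub>0 (\<gamma> x) (\<gamma>' x) < \<epsilon>" using n g(2) Aut_in[OF \<gamma>] Aut_in[OF g(1)] by simp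
      then show ?thesis by simp
    qed
    then show ?thesis using e(2) g(1) by blast
  qed
  then show ?thesis by blast
qed

end


section \<open>The quotient and generic tuples\<close>

context generic_seq
begin

abbreviation "Y \<equiv> pseudoarc A p"

lemma topspace_Y: "topspace Y = pr A p ` P"
  by (simp add: pseudoarc_def topspace_quotient_topology topspace_lim_topology)

lemma quotient_map_pr: "quotient_map X Y (pr A p)"
  unfolding pseudoarc_def by (rule quotient_map_quotient_topology)

lemma continuous_map_pr: "continuous_map X Y (pr A p)"
  by (rule quotient_imp_continuous_map[OF quotient_map_pr])

lemma compact_Y: "compact_space Y"
proof -
  have "compactin Y (pr A p ` P)"
    using image_compactin[OF _ continuous_map_pr, of P] compact_X
    by (simp add: compact_space_def topspace_lim_topology)
  then show ?thesis by (simp add: compact_space_def topspace_Y)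
qed

lemma Hausdorff_Y: "mtopology_of d = Y \<Longrightarrow> Hausdorff_space Y"
  by (metis Metric_space.Hausdorff_space_mtopology Metric_space_mspace_mdist mtopology_of_def)

lemma pr_eq: "(x, y) \<in> lim_rel A p \<Longrightarrow> pr A p x = pr A p y"
  using pr_eq_iff[of x y] lim_rel_iff[of x y] by simp

text \<open>Points adjacent on all levels are identified by \<open>pr\<close>, so compactness bounds
  the distance of points adjacent on one fine level.\<close>

lemma level_quotient_fine:
  assumes d: "mtopology_of d = Y" and e: "\<epsilon> > 0"
  shows "\<exists>n. \<forall>x\<in>P. \<forall>y\<in>P. (x n, y n) \<in> adj (A n) \<longrightarrow> mdist d (pr A p x) (pr A p y) < \<epsilon>"
proof -
  let ?W = "{z \<in> P \<times> P. mdist d (pr A p (fst z)) (pr A p (snd z)) < \<epsilon>}"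
  have "\<exists>n. \<forall>x\<in>P. \<forall>y\<in>P. (x n, y n) \<in> adj (A n) \<longrightarrow> (x, y) \<in> ?W"
  proof (rule uniform_level[where R = "\<lambda>n a b. (a, b) \<in> adj (A n)"])
    show "openin (prod_topology X X) ?W"
      by (rule openin_mdist_less) (use continuous_map_pr d in simp)
    show "(x m, y m) \<in> adj (A m)" if "x \<in> P" "y \<in> P" "m \<le> n" "(x n, y n) \<in> adj (A n)" for m n x y
      using lim_adj that by blast
    show "(x, y) \<in> ?W" if "x \<in> P" "y \<in> P" "\<And>n. (x n, y n) \<in> adj (A n)" for x y
    proof -
      have "pr A p x = pr A p y" by (rule pr_eq) (use that in \<open>simp add: lim_rel_iff\<close>)
      moreover have "pr A p x \<in> mspace d" "pr A p y \<in> mspace d"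
        using that d topspace_Y by (metis imageI topspace_mtopology_of)+
      ultimately have "mdist d (pr A p x) (pr A p y) = 0"
        by (simp add: Metric_space.zero[OF Metric_space_mspace_mdist, THEN iffD2])
      then show ?thesis using that e by simp
    qed
  qed
  then show ?thesis by auto
qed

text \<open>Epimorphisms pass to higher levels, so finitely many can be given the same source. The
  predicate \<open>Q\<close> is left open because this serves both the given automorphisms and the
  homeomorphisms to be approximated.\<close>

lemma common_level:
  assumes F: "finite F" and lev: "\<And>i. i \<in> F \<Longrightarrow> \<exists>m. \<exists>t\<in>Epi (A m) B. \<forall>x\<in>P. Q i x (t (x m))"
  shows "\<exists>m\<ge>L. \<forall>i\<in>F. \<exists>t\<in>Epi (A m) B. \<forall>x\<in>P. Q i x (t (x m))"
  using F lev
proof (induction F)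
  case (insert j F)
  have "\<exists>m\<ge>L. \<forall>i\<in>F. \<exists>t\<in>Epi (A m) B. \<forall>x\<in>P. Q i x (t (x m))"
    by (rule insert.IH) (rule insert.prems, simp)
  then obtain m where m: "m \<ge> L" "\<forall>i\<in>F. \<exists>t\<in>Epi (A m) B. \<forall>x\<in>P. Q i x (t (x m))" by blast
  obtain n u where u: "u \<in> Epi (A n) B" "\<forall>x\<in>P. Q j x (u (x n))"
    using insert.prems[of j] by blast
  have "\<exists>t\<in>Epi (A (max m n)) B. \<forall>x\<in>P. Q i x (t (x (max m n)))" if i: "i \<in> insert j F" for i
  proof -
    have up: ?thesis if t: "t \<in> Epi (A k) B" "\<forall>x\<in>P. Q i x (t (x k))" "k \<le> max m n" for t k
    proof -
      obtain g where "g \<in> Epi (A (max m n)) B" "\<forall>x\<in>P. g (x (max m n)) = t (x k)"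
        using Epi_up[OF t(1,3)] by blast
      then show ?thesis using t(2) by (intro bexI[of _ g]) auto
    qed
    show ?thesis
    proof (cases "i = j")
      case True
      then show ?thesis using up[OF u(1)] u(2) by simp
    next
      case False
      then obtain t where "t \<in> Epi (A m) B" "\<forall>x\<in>P. Q i x (t (x m))" using m(2) i by blast
      then show ?thesis using up by simp
    qed
  qed
  moreover have "L \<le> max m n" using m(1) by simp
  ultimately show ?case by blast
qed auto

text \<open>The relation that \<open>\<delta>\<close> induces between the vertices of a sufficiently fine level and those of
  the level \<open>k\<close> has pairwise adjacent values, so that it is resolved by an epimorphism.\<close>

lemma approximation:
  assumes d: "mtopology_of d = Y" and \<delta>: "\<delta> \<in> Homeo Y"
  shows "\<exists>m. \<exists>q\<in>Epi (A m) (A k). \<forall>x\<in>P. \<forall>y\<in>P. pr A p y = \<delta> (pr A p x) \<longrightarrow> (q (x m), y k) \<in> adj (A k)"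
proof -
  let ?XX = "prod_topology X X" and ?YY = "prod_topology Y Y" and ?pr = "pr A p"
  have h: "homeomorphic_map Y Y \<delta>" using \<delta> by (simp add: Homeo_def)
  then have cd: "continuous_map Y Y \<delta>" and im: "\<delta> ` topspace Y = topspace Y"
    using homeomorphic_imp_continuous_map homeomorphic_imp_surjective_map by blast+
  have \<delta>pr: "\<exists>y\<in>P. ?pr y = \<delta> (?pr x)" if "x \<in> P" for x
  proof -
    have "\<delta> (?pr x) \<in> topspace Y" using im that topspace_Y by blast
    then show ?thesis unfolding topspace_Y by force
  qed
  have pr\<delta>: "\<exists>x\<in>P. ?pr y = \<delta> (?pr x)" if "y \<in> P" for y
  proof -
    have "?pr y \<in> \<delta> ` topspace Y" using im that topspace_Y by blast
    then show ?thesis unfolding topspace_Y by blast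
  qed
  \<comment> \<open>\<open>C\<close> consists of the pairs in the quotient with some representatives
    that are not adjacent on level \<open>k\<close>. As a compact set in a Hausdorff space it is
    closed.\<close>
  let ?N = "P \<times> P - {z \<in> P \<times> P. (fst z k, snd z k) \<in> adj (A k)}"
  define C where "C = (\<lambda>z. ((?pr \<circ> fst) z, (?pr \<circ> snd) z)) ` ?N"
  have "compactin ?XX ?N" by (rule compactin_diff[OF openin_level])
  then have "compactin ?YY C" unfolding C_def
    by (rule image_compactin) (intro continuous_map_pairedI
        continuous_map_compose[OF continuous_map_fst continuous_map_pr]
        continuous_map_compose[OF continuous_map_snd continuous_map_pr])
  moreover have "Hausdorff_space ?YY"
    using Hausdorff_Y[OF d] by (simp add: Hausdorff_space_prod_topology)
  ultimately have C: "closedin ?YY C" using compactin_imp_closedin by blast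
  have c\<delta>pr: "continuous_map X Y (\<delta> \<circ> ?pr)" by (rule continuous_map_compose[OF continuous_map_pr cd])
  let ?f = "\<lambda>z. (((\<delta> \<circ> ?pr) \<circ> fst) z, ((\<delta> \<circ> ?pr) \<circ> snd) z)"
  have f: "continuous_map ?XX ?YY ?f"
    by (intro continuous_map_pairedI continuous_map_compose[OF continuous_map_fst c\<delta>pr]
        continuous_map_compose[OF continuous_map_snd c\<delta>pr])
  \<comment> \<open>An open set of pairs, whose images under \<open>\<delta>\<close> have only
    representatives adjacent on level \<open>k\<close>. It contains every pair in the limit
    relation, hence all pairs adjacent on some fine level \<open>l\<close>.\<close>
  let ?W = "{z \<in> topspace ?XX. ?f z \<in> topspace ?YY - C}"
  have W: "openin ?XX ?W"
    by (rule openin_continuous_map_preimage[OF f]) (use C in blast)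
  have CD: "(u k, v k) \<in> adj (A k)"
    if "(x, y) \<in> ?W" "u \<in> P" "v \<in> P" "?pr u = \<delta> (?pr x)" "?pr v = \<delta> (?pr y)" for x y u v
  proof (rule ccontr)
    assume "(u k, v k) \<notin> adj (A k)"
    then have "(u, v) \<in> ?N" using that by simp
    then have "(?pr u, ?pr v) \<in> C" unfolding C_def by force
    then show False using that by simp
  qed
  have "\<exists>l. \<forall>x\<in>P. \<forall>y\<in>P. (x l, y l) \<in> adj (A l) \<longrightarrow> (x, y) \<in> ?W"
  proof (rule uniform_level[where R = "\<lambda>n a b. (a, b) \<in> adj (A n)"])
    show "openin ?XX ?W" by (rule W)
    show "(x m, y m) \<in> adj (A m)" if "x \<in> P" "y \<in> P" "m \<le> n" "(x n, y n) \<in> adj (A n)" for m n x y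
      using lim_adj that by blast
    show "(x, y) \<in> ?W" if xy: "x \<in> P" "y \<in> P" "\<And>n. (x n, y n) \<in> adj (A n)" for x y
    proof -
      have e: "?pr x = ?pr y" by (rule pr_eq) (use xy in \<open>simp add: lim_rel_iff\<close>)
      have "?f (x, y) \<notin> C"
      proof
        assume "?f (x, y) \<in> C"
        then obtain w where w: "w \<in> ?N" "?f (x, y) = ((?pr \<circ> fst) w, (?pr \<circ> snd) w)"
          unfolding C_def by (rule imageE) (rule that)
        obtain u v where "w = (u, v)" by (cases w)
        then have uv: "(u, v) \<in> ?N" "?pr u = \<delta> (?pr x)" "?pr v = \<delta> (?pr y)"
          using w by auto
        then have "?pr u = ?pr v" using e by simp
        then have "(u, v) \<in> lim_rel A p" using uv(1) by (subst pr_eq_iff[symmetric]) auto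
        then show False using uv(1) by (simp add: lim_rel_iff)
      qed
      moreover have "?f (x, y) \<in> topspace ?YY"
        using im xy topspace_Y by auto
      ultimately show ?thesis using xy by (simp add: topspace_lim_topology)
    qed
  qed
  then obtain l where l: "\<And>x y. x \<in> P \<Longrightarrow> y \<in> P \<Longrightarrow> (x l, y l) \<in> adj (A l) \<Longrightarrow> (x, y) \<in> ?W" by blast
  define S where "S a = {b. \<exists>x\<in>P. \<exists>y\<in>P. x l = a \<and> ?pr y = \<delta> (?pr x) \<and> b = y k}" for a
  obtain E :: "nat rgraph" and f q where E: "linear_graph E" "f \<in> Epi E (A l)" "q \<in> Epi E (A k)"
    and qS: "\<And>x. x \<in> verts E \<Longrightarrow> q x \<in> S (f x)"
  proof (rule Epi_select[OF lin lin])
    show "S a \<noteq> {} \<and> S a \<subseteq> verts (A k)" if a: "a \<in> verts (A l)" for a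
    proof -
      obtain x where x: "x \<in> P" "x l = a" using proj_onto[OF a] by blast
      obtain y where "y \<in> P" "?pr y = \<delta> (?pr x)" using \<delta>pr[OF x(1)] by blast
      then have "y k \<in> S a" using x unfolding S_def by blast
      then show ?thesis using lim_verts unfolding S_def by blast
    qed
    show "(b, b') \<in> adj (A k)" if aa: "(a, a') \<in> adj (A l)" and b: "b \<in> S a" "b' \<in> S a'" for a a' b b'
    proof -
      obtain x y where x: "x \<in> P" "y \<in> P" "x l = a" "?pr y = \<delta> (?pr x)" "b = y k"
        using b(1) unfolding S_def by blast
      obtain x' y' where x': "x' \<in> P" "y' \<in> P" "x' l = a'" "?pr y' = \<delta> (?pr x')" "b' = y' k"
        using b(2) unfolding S_def by blast
      show ?thesis unfolding x(5) x'(5)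
        by (rule CD[OF l[OF x(1) x'(1)] x(2) x'(2) x(4) x'(4)]) (use aa x x' in simp)
    qed
    show "\<exists>a\<in>verts (A l). b \<in> S a" if b: "b \<in> verts (A k)" for b
    proof -
      obtain y where y: "y \<in> P" "y k = b" using proj_onto[OF b] by blast
      obtain x where "x \<in> P" "?pr y = \<delta> (?pr x)" using pr\<delta>[OF y(1)] by blast
      then show ?thesis using y lim_verts[of x l] unfolding S_def by blast
    qed
  qed blast
  obtain m g where m: "g \<in> Epi (A m) E" "\<forall>x\<in>P. f (g (x m)) = x l"
    using Epi_extension[OF E(1,2)] by blast
  have "(compose (verts (A m)) q g (x m), y k) \<in> adj (A k)"
    if xy: "x \<in> P" "y \<in> P" "?pr y = \<delta> (?pr x)" for x y
  proof -
    \<comment> \<open>The selected value comes from a point \<open>u\<close> that may differ from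
      \<open>x\<close>, but both lie over the same vertex of level \<open>l\<close>, and
      \<open>CD\<close> applies through the loop there.\<close>
    have "q (g (x m)) \<in> S (x l)" using qS[OF Epi_mem[OF m(1) lim_verts[OF xy(1)]]] m(2) xy(1) by simp
    then obtain u v where uv: "u \<in> P" "v \<in> P" "u l = x l" "?pr v = \<delta> (?pr u)" "q (g (x m)) = v k"
      unfolding S_def by blast
    have "(v k, y k) \<in> adj (A k)"
      by (rule CD[OF l[OF uv(1) xy(1)] uv(2) xy(2) uv(4) xy(3)])
        (use uv(3) adj_refl[OF lin lim_verts[OF xy(1)]] in simp)
    then show ?thesis using uv(5) lim_verts[OF xy(1)] by (simp add: compose_def)
  qed
  then show ?thesis using Epi_compose[OF m(1) E(3) adj_sub] by blast
qed

section \<open>Induced homeomorphisms and the conjugation step\<close>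

lemma homeo_inv_Aut:
  assumes "\<sigma> \<in> Aut A p"
  shows "homeo_inv X \<sigma> \<in> Aut A p"
proof (rule AutI[where \<tau> = \<sigma>])
  show "homeo_inv X \<sigma> \<in> extensional P" by (simp add: homeo_inv_def topspace_lim_topology)
qed (rule AutE[OF assms]; assumption?)+

lemma induced_pr: "\<sigma> \<in> Aut A p \<Longrightarrow> x \<in> P \<Longrightarrow> induced A p \<sigma> (pr A p x) = pr A p (\<sigma> x)"
  by (rule Aut_induced_pr[OF equiv_lim_rel])

lemma induced_continuous:
  assumes \<sigma>: "\<sigma> \<in> Aut A p"
  shows "continuous_map Y Y (induced A p \<sigma>)"
proof (rule continuous_compose_quotient_map[OF quotient_map_pr])
  have "continuous_map X Y (pr A p \<circ> \<sigma>)"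
    by (rule continuous_map_compose[OF level_map_continuous[OF AutE(1)[OF \<sigma>]] continuous_map_pr])
  then show "continuous_map X Y (induced A p \<sigma> \<circ> pr A p)"
    by (rule continuous_map_eq) (simp add: topspace_lim_topology induced_pr[OF \<sigma>])
qed

lemma induced_Homeo:
  assumes \<sigma>: "\<sigma> \<in> Aut A p"
  shows "induced A p \<sigma> \<in> Homeo Y"
proof -
  let ?\<tau> = "homeo_inv X \<sigma>"
  have \<tau>: "?\<tau> \<in> Aut A p" by (rule homeo_inv_Aut[OF \<sigma>])
  have "homeomorphic_maps Y Y (induced A p \<sigma>) (induced A p ?\<tau>)"
    unfolding homeomorphic_maps_def
  proof (intro conjI ballI induced_continuous \<sigma> \<tau>)
    fix c assume "c \<in> topspace Y"
    then obtain x where x: "x \<in> P" "c = pr A p x" by (auto simp: topspace_Y)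
    show "induced A p ?\<tau> (induced A p \<sigma> c) = c" "induced A p \<sigma> (induced A p ?\<tau> c) = c"
      using x \<sigma> \<tau> AutE(4,5)[OF \<sigma>] Aut_in[OF \<sigma>] inv_in[OF \<sigma>] by (simp_all add: induced_pr)
  qed
  then show ?thesis by (auto simp: Homeo_def homeomorphic_maps_map induced_def)
qed

text \<open>The crucial step: the epimorphisms \<open>t i\<close> representing \<open>\<gamma> i\<close> on the level \<open>n\<close> are combined with
  the \<open>Q i\<close> in a common zigzag path, and homogeneity turns the lifts into automorphisms.\<close>

lemma conjugate_follows:
  assumes n: "0 < len (A n)" and F: "finite F" and \<gamma>: "\<And>i. i \<in> F \<Longrightarrow> \<gamma> i \<in> Aut A p"
    and kl: "k \<le> l" and Q: "\<And>i. i \<in> F \<Longrightarrow> Q i \<in> Epi (A l) (A k)"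
  shows "\<exists>\<gamma>' h. h \<in> Aut A p \<and> (\<forall>i\<in>F. \<gamma>' i \<in> Aut A p \<and> (\<forall>x\<in>P. \<gamma>' i x n = \<gamma> i x n \<and>
     \<bar>int (crd (A k) (Q i (x l))) - int (crd (A k) (h (\<gamma>' i (homeo_inv X h x)) k))\<bar> \<le> 4))"
proof -
  have "\<exists>m\<ge>n. \<forall>i\<in>F. \<exists>t\<in>Epi (A m) (A n). \<forall>x\<in>P. \<gamma> i x n = t (x m)"
    by (rule common_level[OF F]) (rule level_map_level[OF AutE(1)[OF \<gamma>]])
  then obtain m t where m: "m \<ge> n" and t: "\<And>i. i \<in> F \<Longrightarrow> t i \<in> Epi (A m) (A n)"
    "\<And>i x. i \<in> F \<Longrightarrow> x \<in> P \<Longrightarrow> \<gamma> i x n = t i (x m)" by metis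
  \<comment> \<open>\<open>t0\<close> and \<open>Q0\<close> represent the identity in place of
    \<open>t i\<close> and \<open>Q i\<close>; their common lift \<open>r0\<close> serves as the
    reference with which the lifts \<open>r i\<close> are compared.\<close>
  obtain t0 where t0: "t0 \<in> Epi (A m) (A n)" "\<And>x. x \<in> P \<Longrightarrow> t0 (x m) = x n"
    using bond_Epi[of n "m - n"] bond_lim[of _ n "m - n"] m by auto
  obtain Q0 where Q0: "Q0 \<in> Epi (A l) (A k)" "\<And>x. x \<in> P \<Longrightarrow> Q0 (x l) = x k"
    using bond_Epi[of k "l - k"] bond_lim[of _ k "l - k"] kl by auto
  obtain E B :: "nat rgraph" and f g e and c :: "nat \<Rightarrow> int"
    where EB: "linear_graph E" "linear_graph B"
      and fge: "f \<in> Epi E (A m)" "g \<in> Epi E (A l)" "e \<in> Epi B (A n)"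
      and lift: "\<And>p q. p \<in> Epi (A m) (A n) \<Longrightarrow> q \<in> Epi (A l) (A k) \<Longrightarrow> \<exists>r\<in>Epi E B. \<forall>x\<in>verts E.
        e (r x) = p (f x) \<and> \<bar>c (r x) - int (crd (A k) (q (g x)))\<bar> \<le> 2"
    by (rule Epi_lift[OF lin lin lin lin n]) blast
  obtain r0 where r0: "r0 \<in> Epi E B" "\<And>x. x \<in> verts E \<Longrightarrow> e (r0 x) = t0 (f x)"
    "\<And>x. x \<in> verts E \<Longrightarrow> \<bar>c (r0 x) - int (crd (A k) (Q0 (g x)))\<bar> \<le> 2"
    using lift[OF t0(1) Q0(1)] by blast
  have "\<forall>i\<in>F. \<exists>r. r \<in> Epi E B \<and> (\<forall>x\<in>verts E. e (r x) = t i (f x) \<and>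
      \<bar>c (r x) - int (crd (A k) (Q i (g x)))\<bar> \<le> 2)" using lift t(1) Q by blast
  then obtain r where r: "\<And>i. i \<in> F \<Longrightarrow> r i \<in> Epi E B"
    "\<And>i x. i \<in> F \<Longrightarrow> x \<in> verts E \<Longrightarrow> e (r i x) = t i (f x)"
    "\<And>i x. i \<in> F \<Longrightarrow> x \<in> verts E \<Longrightarrow> \<bar>c (r i x) - int (crd (A k) (Q i (g x)))\<bar> \<le> 2"
    by (metis (no_types, lifting))
  \<comment> \<open>Genericity places the lifted picture on a level \<open>s\<close> of the limit in
    such a way that \<open>f\<close> after \<open>a\<close> is the projection to level
    \<open>m\<close>.\<close>
  obtain s a where a: "a \<in> Epi (A s) E" "\<And>x. x \<in> P \<Longrightarrow> f (a (x s)) = x m"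
    using Epi_extension[OF EB(1) fge(1)] by blast
  have aE: "a (x s) \<in> verts E" if "x \<in> P" for x by (rule Epi_mem[OF a(1) lim_verts[OF that]])
  have hom: "\<exists>\<sigma>\<in>Aut A p. \<forall>x\<in>P. u (a (\<sigma> x s)) = v (a (x s))"
    if "u \<in> Epi E B" "v \<in> Epi E B" for u v
  proof -
    have "\<exists>\<sigma>\<in>Aut A p. \<forall>x\<in>P. compose (verts (A s)) u a (\<sigma> x s) = compose (verts (A s)) v a (x s)"
      by (intro homogeneous[OF EB(2)] Epi_compose[OF a(1) _ adj_sub] that)
    then obtain \<sigma> where \<sigma>: "\<sigma> \<in> Aut A p"
      "\<forall>x\<in>P. compose (verts (A s)) u a (\<sigma> x s) = compose (verts (A s)) v a (x s)" by blast
    have "u (a (\<sigma> x s)) = v (a (x s))" if "x \<in> P" for x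
      using bspec[OF \<sigma>(2) that] lim_verts[OF that] lim_verts[OF Aut_in[OF \<sigma>(1) that]] by (simp add: compose_def)
    then show ?thesis using \<sigma>(1) by blast
  qed
  \<comment> \<open>Homogeneity over the zigzag path: the new automorphism turns the reference lift
    \<open>r0\<close> into the lift \<open>r i\<close>.\<close>
  have "\<forall>i\<in>F. \<exists>\<sigma>. \<sigma> \<in> Aut A p \<and> (\<forall>x\<in>P. r0 (a (\<sigma> x s)) = r i (a (x s)))"
    using hom[OF r0(1) r(1)] by blast
  then obtain \<gamma>' where \<gamma>': "\<And>i. i \<in> F \<Longrightarrow> \<gamma>' i \<in> Aut A p"
    "\<And>i x. i \<in> F \<Longrightarrow> x \<in> P \<Longrightarrow> r0 (a (\<gamma>' i x s)) = r i (a (x s))" by metis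
  \<comment> \<open>Conjugation by \<open>h\<close> turns the walk \<open>g\<close> after
    \<open>a\<close>, along which \<open>Q i\<close> was lifted, into the projection to level
    \<open>l\<close>.\<close>
  obtain h where h: "h \<in> Aut A p" "\<And>x. x \<in> P \<Longrightarrow> h x l = g (a (x s))"
  proof -
    have "\<exists>h\<in>Aut A p. \<forall>x\<in>P. (\<lambda>v\<in>verts (A l). v) (h x l) = compose (verts (A s)) g a (x s)"
      by (rule homogeneous[OF lin Epi_id[OF adj_sub] Epi_compose[OF a(1) fge(2) adj_sub]])
    then obtain h where h: "h \<in> Aut A p"
      "\<forall>x\<in>P. (\<lambda>v\<in>verts (A l). v) (h x l) = compose (verts (A s)) g a (x s)" by blast
    have "h x l = g (a (x s))" if "x \<in> P" for x
      using bspec[OF h(2) that] lim_verts[OF that] lim_verts[OF Aut_in[OF h(1) that]] by (simp add: compose_def)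
    then show thesis using that h(1) by blast
  qed
  have "\<gamma>' i x n = \<gamma> i x n" if i: "i \<in> F" and x: "x \<in> P" for i x
  proof -
    have gx: "\<gamma>' i x \<in> P" using Aut_in[OF \<gamma>'(1)[OF i] x] .
    have "\<gamma>' i x n = t0 (f (a (\<gamma>' i x s)))" using t0(2)[OF gx] a(2)[OF gx] by simp
    also have "\<dots> = e (r i (a (x s)))" using r0(2)[OF aE[OF gx]] \<gamma>'(2)[OF i x] by simp
    also have "\<dots> = \<gamma> i x n" using r(2)[OF i aE[OF x]] a(2)[OF x] t(2)[OF i x] by simp
    finally show ?thesis .
  qed
  moreover have "\<bar>int (crd (A k) (Q i (x l))) - int (crd (A k) (h (\<gamma>' i (homeo_inv X h x)) k))\<bar> \<le> 4"
    if i: "i \<in> F" and x: "x \<in> P" for i x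
  proof -
    define y where "y = homeo_inv X h x"
    have y: "y \<in> P" "h y = x" using inv_in[OF h(1) x] AutE(5)[OF h(1) x] by (simp_all add: y_def)
    have gy: "\<gamma>' i y \<in> P" using Aut_in[OF \<gamma>'(1)[OF i] y(1)] .
    have e: "Q i (x l) = Q i (g (a (y s)))" "h (\<gamma>' i y) k = Q0 (g (a (\<gamma>' i y s)))"
      using h(2)[OF y(1)] y(2) Q0(2)[OF Aut_in[OF h(1) gy]] h(2)[OF gy] by simp_all
    \<comment> \<open>Both coordinates are within 2 of the tooth of the same vertex, since
      \<open>r i\<close> at \<open>y\<close> equals \<open>r0\<close> at the image of
      \<open>y\<close>; this gives 4.\<close>
    have "\<bar>c (r i (a (y s))) - int (crd (A k) (Q i (g (a (y s)))))\<bar> \<le> 2"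
      by (rule r(3)[OF i aE[OF y(1)]])
    moreover have "\<bar>c (r i (a (y s))) - int (crd (A k) (Q0 (g (a (\<gamma>' i y s)))))\<bar> \<le> 2"
      using r0(3)[OF aE[OF gy]] \<gamma>'(2)[OF i y(1)] by simp
    ultimately show ?thesis unfolding y_def[symmetric] e by linarith
  qed
  ultimately show ?thesis using h(1) \<gamma>'(1) by blast
qed

section \<open>The countably many dense open conditions\<close>

text \<open>Some level, and hence every later one, maps onto the path with one edge. Such levels
  provide the teeth of positive length for \<open>conjugate_follows\<close>.\<close>

lemma nontrivial_level: "\<exists>n\<ge>L. 0 < len (A n)"
proof -
  obtain m f where f: "f \<in> Epi (A m) (std_linear_graph 1)" using cofinal[OF linear_std] by blast
  obtain g where "g \<in> Epi (A (max m L)) (std_linear_graph 1)" using Epi_up[OF f, of "max m L"] by auto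
  then obtain w where w: "wmap (len (A (max m L))) 1 w"
    by (rule Epi_mk[OF lin linear_std]) (simp add: that)
  have "len (A (max m L)) \<noteq> 0"
  proof
    assume "len (A (max m L)) = 0"
    then have "w 0 = 0" "w 0 = 1" using wmap_onto[OF w, of 0] wmap_onto[OF w, of 1] by auto
    then show False by simp
  qed
  then show ?thesis by (intro exI[of _ "max m L"]) auto
qed

lemma finite_Epi: "finite (Epi (A l) (A k))"
proof (rule finite_subset)
  show "Epi (A l) (A k) \<subseteq> verts (A l) \<rightarrow>\<^sub>E verts (A k)" using Epi_funcset by blast
  show "finite (verts (A l) \<rightarrow>\<^sub>E verts (A k))" by (intro finite_PiE finite_verts lin)
qed

text \<open>Only finitely many indices occur, which keeps the condition open for infinite index
  sets; the bound 4 is the one achieved by \<open>conjugate_follows\<close>.\<close>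

definition conj_follow :: "'i set \<Rightarrow> nat \<times> nat \<times> 'i set \<times> ('i \<Rightarrow> nat \<Rightarrow> nat) \<Rightarrow>
    ('i \<Rightarrow> (nat \<Rightarrow> nat) \<Rightarrow> nat \<Rightarrow> nat) set" where
  "conj_follow I = (\<lambda>(k, l, F, Q). {\<gamma> \<in> I \<rightarrow>\<^sub>E Aut A p. \<exists>h\<in>Aut A p. \<forall>i\<in>F. \<forall>x\<in>P.
     \<bar>int (crd (A k) (Q i (x l))) - int (crd (A k) (h (\<gamma> i (homeo_inv X h x)) k))\<bar> \<le> 4})"

text \<open>The functions on \<open>F\<close> are extensional, so there are finitely many for fixed
  \<open>k\<close>, \<open>l\<close> and \<open>F\<close>, and the set of all data is countable for
  a countable index type.\<close>

definition follow_data :: "'i set \<Rightarrow> (nat \<times> nat \<times> 'i set \<times> ('i \<Rightarrow> nat \<Rightarrow> nat)) set" where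
  "follow_data I = (SIGMA k:UNIV. SIGMA l:{k..}. SIGMA F:{F. finite F \<and> F \<subseteq> I}.
     F \<rightarrow>\<^sub>E Epi (A l) (A k))"

lemma countable_follow_data:
  fixes I :: "'i::countable set"
  shows "countable (follow_data I)"
  unfolding follow_data_def
proof (intro countable_SIGMA)
  show "countable {F. finite F \<and> F \<subseteq> I}" by (rule countable_Collect_finite_subset) simp
  fix k l :: nat and F :: "'i set" assume "F \<in> {F. finite F \<and> F \<subseteq> I}"
  then show "countable (F \<rightarrow>\<^sub>E Epi (A l) (A k))"
    by (intro countable_finite finite_PiE) (auto simp: finite_Epi)
qed auto

context
  fixes d\<^sub>0 :: "(nat \<Rightarrow> nat) metric" and I :: "'i set"
  assumes d\<^sub>0: "mtopology_of d\<^sub>0 = X"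
begin

abbreviation "AutT \<equiv> uniform_topology X d\<^sub>0 (Aut A p)"

lemma topspace_AutT: "topspace AutT = Aut A p"
  by (rule topspace_uniform_topology_Homeo[OF compact_X d\<^sub>0 Aut_Homeo])

text \<open>The same witness \<open>h\<close> works nearby: coordinate \<open>k\<close> after
  \<open>h\<close> depends only on some level \<open>m\<close>, so agreement with
  \<open>\<gamma>\<close> on level \<open>m\<close> at the indices in \<open>F\<close>
  suffices.\<close>

lemma openin_conj_follow:
  assumes "z \<in> follow_data I"
  shows "openin (product_topology (\<lambda>i. AutT) I) (conj_follow I z)"
proof -
  obtain k l F Q where z: "z = (k, l, F, Q)" by (cases z)
  have F: "finite F" "F \<subseteq> I" using assms by (auto simp: z follow_data_def)
  show ?thesis unfolding openin_product_topology_alt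
  proof
    fix \<gamma> assume "\<gamma> \<in> conj_follow I z"
    then obtain h where \<gamma>: "\<gamma> \<in> I \<rightarrow>\<^sub>E Aut A p" and h: "h \<in> Aut A p" "\<And>i x. i \<in> F \<Longrightarrow> x \<in> P \<Longrightarrow>
      \<bar>int (crd (A k) (Q i (x l))) - int (crd (A k) (h (\<gamma> i (homeo_inv X h x)) k))\<bar> \<le> 4"
      by (auto simp: z conj_follow_def)
    obtain m t where t: "\<And>x. x \<in> P \<Longrightarrow> h x k = t (x m)" by (rule Aut_level[OF h(1), of k]) blast
    define U where "U i = (if i \<in> F then {\<gamma>' \<in> Aut A p. \<forall>x\<in>P. \<gamma>' x m = \<gamma> i x m} else Aut A p)" for i
    have "{i \<in> I. U i \<noteq> topspace AutT} \<subseteq> F" by (auto simp: U_def topspace_AutT)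
    then have "finite {i \<in> I. U i \<noteq> topspace AutT}" using F(1) finite_subset by blast
    moreover have "openin AutT (U i)" for i
      by (rule openin_Aut_level[OF d\<^sub>0, of _ m]) (auto simp: U_def split: if_splits)
    moreover have "\<gamma> \<in> Pi\<^sub>E I U" using \<gamma> by (auto simp: U_def PiE_iff)
    moreover have "Pi\<^sub>E I U \<subseteq> conj_follow I z"
    proof
      fix \<gamma>' assume g: "\<gamma>' \<in> Pi\<^sub>E I U"
      then have gA: "\<gamma>' \<in> I \<rightarrow>\<^sub>E Aut A p" by (auto simp: U_def PiE_iff split: if_splits)
      have "\<bar>int (crd (A k) (Q i (x l))) - int (crd (A k) (h (\<gamma>' i (homeo_inv X h x)) k))\<bar> \<le> 4"
        if i: "i \<in> F" and x: "x \<in> P" for i x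
      proof -
        let ?y = "homeo_inv X h x"
        have y: "?y \<in> P" by (rule inv_in[OF h(1) x])
        have iI: "i \<in> I" using i F(2) by blast
        have "\<gamma>' i \<in> U i" using g iI by (rule PiE_mem)
        then have "\<gamma>' i ?y m = \<gamma> i ?y m" using i y by (simp add: U_def)
        moreover have "\<gamma>' i ?y \<in> P" "\<gamma> i ?y \<in> P"
          using Aut_in[OF PiE_mem[OF gA iI] y] Aut_in[OF PiE_mem[OF \<gamma> iI] y] by auto
        ultimately have "h (\<gamma>' i ?y) k = h (\<gamma> i ?y) k" using t by simp
        then show ?thesis using h(2)[OF i x] by simp
      qed
      then show "\<gamma>' \<in> conj_follow I z" using gA h(1) by (auto simp: z conj_follow_def)
    qed
    ultimately show "\<exists>U. finite {i \<in> I. U i \<noteq> topspace AutT} \<and> (\<forall>i\<in>I. openin AutT (U i)) \<and>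
        \<gamma> \<in> Pi\<^sub>E I U \<and> Pi\<^sub>E I U \<subseteq> conj_follow I z" by blast
  qed
qed

text \<open>A basic box restricts finitely many indices, and one sufficiently high level
  \<open>n\<close> controls them all. \<open>conjugate_follows\<close> is applied to these indices
  together with those in \<open>F\<close>; all others keep their value.\<close>

lemma dense_conj_follow:
  assumes z: "z \<in> follow_data I" and V: "openin (product_topology (\<lambda>i. AutT) I) V" "V \<noteq> {}"
  shows "V \<inter> conj_follow I z \<noteq> {}"
proof -
  obtain k l F Q where zz: "z = (k, l, F, Q)" by (cases z)
  have F: "finite F" "F \<subseteq> I" "k \<le> l" and Q: "\<And>i. i \<in> F \<Longrightarrow> Q i \<in> Epi (A l) (A k)"
    using z by (auto simp: zz follow_data_def)
  obtain \<gamma> where gV: "\<gamma> \<in> V" using V(2) by blast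
  obtain U where U: "finite {i \<in> I. U i \<noteq> topspace AutT}" "\<And>i. i \<in> I \<Longrightarrow> openin AutT (U i)"
    "\<gamma> \<in> Pi\<^sub>E I U" "Pi\<^sub>E I U \<subseteq> V"
    by (rule product_nbhd[OF V(1) gV]) blast
  let ?F = "{i \<in> I. U i \<noteq> topspace AutT}"
  have \<gamma>: "\<gamma> i \<in> Aut A p" if "i \<in> I" for i
    using openin_subset[OF U(2)[OF that]] PiE_mem[OF U(3) that] by (auto simp: topspace_AutT)
  have "\<forall>i\<in>I. \<exists>n. \<forall>\<gamma>'\<in>Aut A p. (\<forall>x\<in>P. \<gamma>' x n = \<gamma> i x n) \<longrightarrow> \<gamma>' \<in> U i"
    using Aut_nbhd_level[OF d\<^sub>0 U(2) PiE_mem[OF U(3)]] by blast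
  then obtain N where N: "\<And>i \<gamma>'. i \<in> I \<Longrightarrow> \<gamma>' \<in> Aut A p \<Longrightarrow> (\<forall>x\<in>P. \<gamma>' x (N i) = \<gamma> i x (N i)) \<Longrightarrow> \<gamma>' \<in> U i"
    by metis
  obtain b where b: "\<forall>i\<in>?F. N i \<le> b" using finite_nat_set_iff_bounded_le[of "N ` ?F"] U(1) by auto
  obtain n where n: "n \<ge> b" "0 < len (A n)" using nontrivial_level by blast
  \<comment> \<open>Indices that matter only for the neighbourhood have nothing to follow; a bonding
    map is a harmless default.\<close>
  define Q' where "Q' i = (if i \<in> F then Q i else bond A p k (l - k))" for i
  have Q': "Q' i \<in> Epi (A l) (A k)" for i
    using Q bond_Epi[of k "l - k"] F(3) by (simp add: Q'_def)
  have fin: "finite (F \<union> ?F)" using F(1) U(1) by blast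
  have gA: "\<gamma> i \<in> Aut A p" if "i \<in> F \<union> ?F" for i using that F(2) \<gamma> by blast
  have "\<exists>\<gamma>' h. h \<in> Aut A p \<and> (\<forall>i\<in>F \<union> ?F. \<gamma>' i \<in> Aut A p \<and> (\<forall>x\<in>P. \<gamma>' i x n = \<gamma> i x n \<and>
     \<bar>int (crd (A k) (Q' i (x l))) - int (crd (A k) (h (\<gamma>' i (homeo_inv X h x)) k))\<bar> \<le> 4))"
    by (rule conjugate_follows[OF n(2) fin gA F(3) Q'])
  then obtain \<gamma>' h where h: "h \<in> Aut A p" and g': "\<And>i. i \<in> F \<union> ?F \<Longrightarrow> \<gamma>' i \<in> Aut A p"
    "\<And>i x. i \<in> F \<union> ?F \<Longrightarrow> x \<in> P \<Longrightarrow> \<gamma>' i x n = \<gamma> i x n"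
    "\<And>i x. i \<in> F \<union> ?F \<Longrightarrow> x \<in> P \<Longrightarrow>
      \<bar>int (crd (A k) (Q' i (x l))) - int (crd (A k) (h (\<gamma>' i (homeo_inv X h x)) k))\<bar> \<le> 4"
    by blast
  define \<eta> where "\<eta> = (\<lambda>i\<in>I. if i \<in> F \<union> ?F then \<gamma>' i else \<gamma> i)"
  have \<eta>: "\<eta> \<in> I \<rightarrow>\<^sub>E Aut A p" using g'(1) \<gamma> by (auto simp: \<eta>_def)
  have "\<eta> i \<in> U i" if i: "i \<in> I" for i
  proof (cases "i \<in> ?F")
    case True
    then have e: "\<eta> i = \<gamma>' i" by (simp add: \<eta>_def)
    have "\<gamma>' i x (N i) = \<gamma> i x (N i)" if x: "x \<in> P" for x
    proof (rule lim_agree[of "\<gamma>' i x" "\<gamma> i x" n "N i"])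
      show "\<gamma>' i x \<in> P" "\<gamma> i x \<in> P" using Aut_in[OF g'(1) x] Aut_in[OF \<gamma>[OF i] x] True by blast+
      show "\<gamma>' i x n = \<gamma> i x n" using g'(2) True x by blast
      show "N i \<le> n" using b n True by force
    qed
    then show ?thesis unfolding e using N[OF i g'(1)] True by blast
  next
    case False
    then show ?thesis using PiE_mem[OF \<eta> i] i by (simp add: topspace_AutT)
  qed
  then have "\<eta> \<in> Pi\<^sub>E I U" using \<eta> by (simp add: PiE_iff)
  then have "\<eta> \<in> V" using U(4) by blast
  moreover have "\<eta> \<in> conj_follow I z"
  proof -
    have "\<bar>int (crd (A k) (Q i (x l))) - int (crd (A k) (h (\<eta> i (homeo_inv X h x)) k))\<bar> \<le> 4"
      if i: "i \<in> F" and x: "x \<in> P" for i x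
    proof -
      have "\<eta> i = \<gamma>' i" "Q' i = Q i" using i F(2) by (auto simp: \<eta>_def Q'_def)
      then show ?thesis using g'(3)[of i x] i x by simp
    qed
    then show ?thesis using \<eta> h by (auto simp: zz conj_follow_def)
  qed
  ultimately show ?thesis by blast
qed

text \<open>A homeomorphism is represented by epimorphisms between levels, the conjugate follows
  these, and \<open>thin_level\<close> converts the total coordinate error into closeness in the
  quotient.\<close>

lemma dense_orbit_if_conj_follow:
  assumes d: "mtopology_of d = Y" and \<gamma>: "\<gamma> \<in> I \<rightarrow>\<^sub>E Aut A p"
    and fol: "\<And>z. z \<in> follow_data I \<Longrightarrow> \<gamma> \<in> conj_follow I z"
  shows "\<gamma> \<in> dense_orbit_tuples A p d I"
proof -
  let ?H = "uniform_topology Y d (Homeo Y)"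
  let ?O = "(\<lambda>g. \<lambda>i\<in>I. induced A p (diag_conj X I g \<gamma> i)) ` Aut A p"
  have top: "topspace ?H = Homeo Y" by (rule topspace_uniform_topology_Homeo[OF compact_Y d order_refl])
  have dc: "diag_conj X I g \<gamma> i = compose P g (compose P (\<gamma> i) (homeo_inv X g))" if "i \<in> I" for g i
    using that by (simp add: diag_conj_def topspace_lim_topology)
  have "\<delta> \<in> product_topology (\<lambda>i. ?H) I closure_of ?O" if \<delta>: "\<delta> \<in> I \<rightarrow>\<^sub>E Homeo Y" for \<delta>
    unfolding in_closure_of
  proof (intro conjI allI impI)
    show "\<delta> \<in> topspace (product_topology (\<lambda>i. ?H) I)" using \<delta> by (simp add: top)
    fix T assume "\<delta> \<in> T \<and> openin (product_topology (\<lambda>i. ?H) I) T"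
    then have T: "openin (product_topology (\<lambda>i. ?H) I) T" "\<delta> \<in> T" by simp_all
    obtain U where U: "finite {i \<in> I. U i \<noteq> topspace ?H}" "\<And>i. i \<in> I \<Longrightarrow> openin ?H (U i)"
      "\<delta> \<in> Pi\<^sub>E I U" "Pi\<^sub>E I U \<subseteq> T"
      by (rule product_nbhd[OF T]) blast
    let ?F = "{i \<in> I. U i \<noteq> topspace ?H}"
    have "\<forall>i\<in>I. \<exists>\<epsilon>>0. \<forall>h\<in>Homeo Y. (\<forall>x\<in>topspace Y. mdist d (\<delta> i x) (h x) \<le> \<epsilon>) \<longrightarrow> h \<in> U i"
      using openin_uniform_topologyD[OF compact_Y d order_refl U(2) PiE_mem[OF U(3)]] by blast
    then obtain E where E: "\<And>i. i \<in> I \<Longrightarrow> E i > 0"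
      "\<And>i h. i \<in> I \<Longrightarrow> h \<in> Homeo Y \<Longrightarrow> (\<forall>x\<in>topspace Y. mdist d (\<delta> i x) (h x) \<le> E i) \<Longrightarrow> h \<in> U i"
      by metis
    \<comment> \<open>The element 1 covers the case that no index is restricted.\<close>
    define \<epsilon> where "\<epsilon> = Min (insert 1 (E ` ?F))"
    have e: "\<epsilon> > 0" "\<And>i. i \<in> ?F \<Longrightarrow> \<epsilon> \<le> E i" using U(1) E(1) by (auto simp: \<epsilon>_def)
    obtain n where n: "\<forall>x\<in>P. \<forall>y\<in>P. (x n, y n) \<in> adj (A n) \<longrightarrow> mdist d (pr A p x) (pr A p y) < \<epsilon>"
      using level_quotient_fine[OF d e(1)] by blast
    \<comment> \<open>The tolerance 5 is 4 for following the epimorphism plus 1 for its adjacency to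
      the homeomorphism.\<close>
    obtain k where k: "\<forall>x\<in>P. \<forall>y\<in>P. \<bar>int (crd (A k) (x k)) - int (crd (A k) (y k))\<bar> \<le> int 5 \<longrightarrow>
      (x n, y n) \<in> adj (A n)" using thin_level[of n 5] by blast
    have "\<exists>l\<ge>k. \<forall>i\<in>?F. \<exists>q\<in>Epi (A l) (A k). \<forall>x\<in>P. \<forall>y\<in>P. pr A p y = \<delta> i (pr A p x) \<longrightarrow> (q (x l), y k) \<in> adj (A k)"
      by (rule common_level[OF U(1)]) (use approximation[OF d PiE_mem[OF \<delta>]] in blast)
    then obtain l where l: "l \<ge> k" "\<forall>i\<in>?F. \<exists>q. q \<in> Epi (A l) (A k) \<and>
        (\<forall>x\<in>P. \<forall>y\<in>P. pr A p y = \<delta> i (pr A p x) \<longrightarrow> (q (x l), y k) \<in> adj (A k))" by blast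
    from bchoice[OF l(2)] obtain q where q: "\<And>i. i \<in> ?F \<Longrightarrow> q i \<in> Epi (A l) (A k)"
      "\<And>i x y. i \<in> ?F \<Longrightarrow> x \<in> P \<Longrightarrow> y \<in> P \<Longrightarrow> pr A p y = \<delta> i (pr A p x) \<Longrightarrow> (q i (x l), y k) \<in> adj (A k)"
      by blast
    have "(k, l, ?F, restrict q ?F) \<in> follow_data I"
      using l(1) U(1) q(1) by (auto simp: follow_data_def)
    from fol[OF this] obtain h where h: "h \<in> Aut A p" "\<And>i x. i \<in> ?F \<Longrightarrow> x \<in> P \<Longrightarrow>
      \<bar>int (crd (A k) (q i (x l))) - int (crd (A k) (h (\<gamma> i (homeo_inv X h x)) k))\<bar> \<le> 4"
      by (auto simp: conj_follow_def)
    let ?\<eta> = "\<lambda>i\<in>I. induced A p (diag_conj X I h \<gamma> i)"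
    have conj: "diag_conj X I h \<gamma> i \<in> Aut A p" if "i \<in> I" for i
      unfolding dc[OF that] by (rule conj_Aut[OF h(1) PiE_mem[OF \<gamma> that]])
    have "?\<eta> i \<in> U i" if i: "i \<in> I" for i
    proof (cases "i \<in> ?F")
      case True
      have "induced A p (diag_conj X I h \<gamma> i) \<in> U i"
      proof (rule E(2)[OF i induced_Homeo[OF conj[OF i]]], rule ballI)
        fix c assume "c \<in> topspace Y"
        then obtain x where x: "x \<in> P" "c = pr A p x" by (auto simp: topspace_Y)
        let ?s = "diag_conj X I h \<gamma> i"
        have s: "?s x = h (\<gamma> i (homeo_inv X h x))" using x(1) by (simp add: dc[OF i] compose_def)
        have sP: "?s x \<in> P" by (rule Aut_in[OF conj[OF i] x(1)])
        have "homeomorphic_map Y Y (\<delta> i)" using PiE_mem[OF \<delta> i] by (simp add: Homeo_def)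
        then have "\<delta> i c \<in> topspace Y"
          using homeomorphic_imp_surjective_map x topspace_Y by blast
        then obtain y where y: "y \<in> P" "\<delta> i c = pr A p y" by (auto simp: topspace_Y)
        have "\<bar>int (crd (A k) (q i (x l))) - int (crd (A k) (y k))\<bar> \<le> 1"
          using q(2)[OF True x(1) y(1)] x(2) y(2) adj_iff[OF lin] by simp
        moreover have "\<bar>int (crd (A k) (q i (x l))) - int (crd (A k) (?s x k))\<bar> \<le> 4"
          unfolding s by (rule h(2)[OF True x(1)])
        ultimately have "\<bar>int (crd (A k) (y k)) - int (crd (A k) (?s x k))\<bar> \<le> int 5" by linarith
        then have "mdist d (pr A p y) (pr A p (?s x)) < \<epsilon>" using k n y(1) sP by blast
        then show "mdist d (\<delta> i c) (induced A p ?s c) \<le> E i"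
          using e(2)[OF True] x y induced_pr[OF conj[OF i] x(1)] by simp
      qed
      then show ?thesis using i by simp
    next
      case False
      then have "U i = Homeo Y" using i top by blast
      then show ?thesis using induced_Homeo[OF conj[OF i]] i by simp
    qed
    then have "?\<eta> \<in> T" using U(4) by (auto simp: PiE_iff)
    then show "\<exists>y. y \<in> ?O \<and> y \<in> T" using h(1) by blast
  qed
  moreover have "product_topology (\<lambda>i. ?H) I closure_of ?O \<subseteq> I \<rightarrow>\<^sub>E Homeo Y"
    using closure_of_subset_topspace[of "product_topology (\<lambda>i. ?H) I" ?O] by (simp add: top)
  ultimately have "product_topology (\<lambda>i. ?H) I closure_of ?O = I \<rightarrow>\<^sub>E Homeo Y" by blast
  then show ?thesis using \<gamma> by (simp add: dense_orbit_tuples_def)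
qed

end

text \<open>Stated for every index set of a countable type, so that finite tuples and sequences need
  no separate arguments.\<close>

lemma comeagre_dense_orbit_tuples:
  fixes I :: "'i::countable set"
  assumes d\<^sub>0: "mtopology_of d\<^sub>0 = X" and d: "mtopology_of d = Y"
  shows "comeagre_in (product_topology (\<lambda>i. uniform_topology X d\<^sub>0 (Aut A p)) I) (dense_orbit_tuples A p d I)"
proof (rule comeagre_in_dense_open[OF countable_follow_data[of I]])
  let ?T = "product_topology (\<lambda>i. uniform_topology X d\<^sub>0 (Aut A p)) I"
  have top: "topspace ?T = I \<rightarrow>\<^sub>E Aut A p" by (simp add: topspace_AutT[OF d\<^sub>0])
  show "openin ?T (conj_follow I z)" if "z \<in> follow_data I" for z
    by (rule openin_conj_follow[OF d\<^sub>0 that])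
  show "V \<inter> conj_follow I z \<noteq> {}" if "z \<in> follow_data I" "openin ?T V" "V \<noteq> {}" for z V
    by (rule dense_conj_follow[OF d\<^sub>0 that])
  show "\<gamma> \<in> dense_orbit_tuples A p d I"
    if "\<gamma> \<in> topspace ?T" "\<And>z. z \<in> follow_data I \<Longrightarrow> \<gamma> \<in> conj_follow I z" for \<gamma>
    by (rule dense_orbit_if_conj_follow[OF d\<^sub>0 d]) (use that top in auto)
  show "dense_orbit_tuples A p d I \<subseteq> topspace ?T"
    unfolding top by (auto simp: dense_orbit_tuples_def)
qed

end

theorem theorem4p1:
  fixes A :: "nat \<Rightarrow> nat rgraph" and p :: "nat \<Rightarrow> nat \<Rightarrow> nat"
    and d\<^sub>0 :: "(nat \<Rightarrow> nat) metric" and d :: "(nat \<Rightarrow> nat) set metric"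
  assumes "generic_sequence A p"
    and "mtopology_of d\<^sub>0 = lim_topology A p"
    and "mtopology_of d = pseudoarc A p"
  shows "(\<forall>n. comeagre_in
            (product_topology (\<lambda>i. uniform_topology (lim_topology A p) d\<^sub>0 (Aut A p)) {..<n::nat})
            (dense_orbit_tuples A p d {..<n})) \<and>
         comeagre_in
            (product_topology (\<lambda>i. uniform_topology (lim_topology A p) d\<^sub>0 (Aut A p)) (UNIV :: nat set))
            (dense_orbit_tuples A p d UNIV)"
proof -
  interpret generic_seq A p by unfold_locales (rule assms(1))
  show ?thesis by (intro conjI allI comeagre_dense_orbit_tuples assms(2,3))
qed

end
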